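(* Let $(X,S)$ be a minimal topological dynamical system with $X$ compact metric and acting group $\mathbb Z$. Let $\pi:(X,S)\to(X_\infty,S)$ be the extension to the maximal factor of order $\infty$. Then there are systems $X'$, $X_\infty'$ and extensions $\theta':X'\to X$, $\pi':X'\to X_\infty'$, $\theta:X_\infty'\to X_\infty$ with $\pi\circ\theta'=\theta\circ\pi'$ such that $\theta,\theta'$ are almost one-to-one extensions and, for each integer $d\ge1$, $(X_\infty',S)$ is (via $\pi'$) the topological cubic characteristic factor of order $d$ of $(X',S)$.
   Context: Here $T=\mathbb Z$, generated by the homeomorphism $S$. A system is minimal if all orbits are dense. An extension is a continuous equivariant surjection. An extension $\phi:X\to Y$ is almost one-to-one if there is a dense $G_\delta$ set $X_0\subseteq X$ with $\phi^{-1}(\phi(x))=\{x\}$ for all $x\in X_0$. Cubes. $X^{[k]}=X^{2^k}$ has coordinates indexed by $\{0,1\}^k$ (equivalently subsets of $\{1,\dots,k\}$, $\emptyset\leftrightarrow(0,\dots,0)$); $x^{[k]}$ has all coordinates $x$. An upper facet is a set $\{\epsilon\in\{0,1\}^k:\epsilon_i=1\}$. For $t\in T$, $t^{(\alpha)}\in T^{[k]}$ has coordinate $t$ on $\alpha$ and the identity elsewhere. $\mathcal F^{[k]}(T)$ is the subgroup of $T^{[k]}$ generated by $t^{(\alpha)}$, $t\in T$, $\alpha$ an upper facet, acting coordinatewise on $X^{[k]}$. Order $\infty$. $(x,y)\in\mathbf{RP}^{[k]}(X)$ if there are nets $(\mathbf f_\lambda)$ in $\mathcal F^{[k]}(T)$,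 $(x_\lambda),(y_\lambda)$ in $X$, and $\mathbf a_*\in X^{2^k-1}$ with $(\mathbf f_\lambda x_\lambda^{[k]},\mathbf f_\lambda y_\lambda^{[k]})\to(x,\mathbf a_*,y,\mathbf a_* )$ (first coordinate of each block is the $\emptyset$-coordinate). $\mathbf{RP}^{[\infty]}(X)=\bigcap_{k\ge1}\mathbf{RP}^{[k]}(X)$; for minimal $X$ it is a closed invariant equivalence relation and $X_\infty=X/\mathbf{RP}^{[\infty]}(X)$ is the maximal factor of order $\infty$ (a system is of order $\infty$ if its $\mathbf{RP}^{[\infty]}$ is the diagonal). Characteristic factors. For a map $\phi:A\to B$, a subset $L\subseteq A$ is $\phi$-saturated if $L=\phi^{-1}(\phi(L))$. Given an extension $\phi:(X,T)\to(Y,T)$, $(Y,T)$ is a topological cubic characteristic factor of order $d$ (of $X$) if there is a dense $G_\delta$ set $X_0\subseteq X$ such that for every $x\in X_0$ the set $\rho_*(\overline{\mathcal F^{[d]}(T)x^{[d]}})\subseteq X^{2^d-1}$ is $\phi^{2^d-1}$-saturated, where $\rho_*:X^{[d]}\to X^{2^d-1}$ is the projection onto the last $2^d-1$ coordinates (all coordinates except $\emptyset$) and $\phi^{2^d-1}=\phi\times\cdots\times\phi$. *)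

theory Defs
  imports "HOL-Analysis.Analysis"
begin

section \<open>Systems and extensions\<close>

text \<open>A system is a compact metrizable space, given as an abstract topology with carrier
  \<open>topspace X\<close>, together with a self-homeomorphism \<open>S\<close> that generates the action of the integers.
  Values of \<open>S\<close> outside the carrier are irrelevant.\<close>

definition metric_tds :: "'a topology \<Rightarrow> ('a \<Rightarrow> 'a) \<Rightarrow> bool" where
  "metric_tds X S \<longleftrightarrow> compact_space X \<and> metrizable_space X \<and> homeomorphic_map X X S"

definition int_iterate :: "'a topology \<Rightarrow> ('a \<Rightarrow> 'a) \<Rightarrow> int \<Rightarrow> 'a \<Rightarrow> 'a" where
  "int_iterate X S n =
     (if 0 \<le> n then S ^^ nat n else inv_into (topspace X) S ^^ nat (- n))"

definition minimal_tds :: "'a topology \<Rightarrow> ('a \<Rightarrow> 'a) \<Rightarrow> bool" where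
  "minimal_tds X S \<longleftrightarrow>
     (\<forall>x\<in>topspace X. X closure_of range (\<lambda>n. int_iterate X S n x) = topspace X)"

definition extension ::
  "'a topology \<Rightarrow> ('a \<Rightarrow> 'a) \<Rightarrow> 'b topology \<Rightarrow> ('b \<Rightarrow> 'b) \<Rightarrow> ('a \<Rightarrow> 'b) \<Rightarrow> bool" where
  "extension X S Y R \<phi> \<longleftrightarrow>
     continuous_map X Y \<phi> \<and> \<phi> ` topspace X = topspace Y \<and>
     (\<forall>x\<in>topspace X. \<phi> (S x) = R (\<phi> x))"

definition dense_gdelta :: "'a topology \<Rightarrow> 'a set \<Rightarrow> bool" where
  "dense_gdelta X A \<longleftrightarrow> gdelta_in X A \<and> X closure_of A = topspace X"

definition almost_one_to_one_extension ::
  "'a topology \<Rightarrow> ('a \<Rightarrow> 'a) \<Rightarrow> 'b topology \<Rightarrow> ('b \<Rightarrow> 'b) \<Rightarrow> ('a \<Rightarrow> 'b) \<Rightarrow> bool" where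
  "almost_one_to_one_extension X S Y R \<phi> \<longleftrightarrow>
     extension X S Y R \<phi> \<and>
     (\<exists>X\<^sub>0. dense_gdelta X X\<^sub>0 \<and>
        (\<forall>x\<in>X\<^sub>0. {x' \<in> topspace X. \<phi> x' = \<phi> x} = {x}))"


section \<open>Cubes and face groups\<close>

text \<open>The coordinates of a \<open>k\<close>-cube are the subsets of \<open>{1..k}\<close>; points of the cube space are
  extensional functions on \<open>Pow {1..k}\<close>.\<close>

abbreviation cube_index :: "nat \<Rightarrow> nat set set" where
  "cube_index k \<equiv> Pow {1..k}"

definition cube_space :: "nat \<Rightarrow> 'a topology \<Rightarrow> (nat set \<Rightarrow> 'a) topology" where
  "cube_space k X = product_topology (\<lambda>_. X) (cube_index k)"

definition diag :: "nat \<Rightarrow> 'a \<Rightarrow> nat set \<Rightarrow> 'a" where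
  "diag k x = (\<lambda>\<epsilon>\<in>cube_index k. x)"

text \<open>The upper facet given by \<open>i\<close> consists of the \<open>\<epsilon> \<subseteq> {1..k}\<close> with \<open>i \<in> \<epsilon>\<close>. The acting group is
  the additive group of integers, so an element of its cube power is an integer-valued function on
  the coordinates (extended by 0 off \<open>Pow {1..k}\<close>), and the face group is the
  subgroup generated by the functions that are a constant \<open>t\<close> on one upper facet and 0
  elsewhere.\<close>

inductive_set face_group :: "nat \<Rightarrow> (nat set \<Rightarrow> int) set" for k :: nat where
  zero: "(\<lambda>_. 0) \<in> face_group k"
| facet: "i \<in> {1..k} \<Longrightarrow>
    (\<lambda>\<epsilon>. if \<epsilon> \<in> cube_index k \<and> i \<in> \<epsilon> then t else 0) \<in> face_group k"
| add: "f \<in> face_group k \<Longrightarrow> g \<in> face_group k \<Longrightarrow> (\<lambda>\<epsilon>. f \<epsilon> + g \<epsilon>) \<in> face_group k"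
| minus: "f \<in> face_group k \<Longrightarrow> (\<lambda>\<epsilon>. - f \<epsilon>) \<in> face_group k"

definition cube_act ::
  "nat \<Rightarrow> 'a topology \<Rightarrow> ('a \<Rightarrow> 'a) \<Rightarrow> (nat set \<Rightarrow> int) \<Rightarrow> (nat set \<Rightarrow> 'a) \<Rightarrow> nat set \<Rightarrow> 'a" where
  "cube_act k X S f p = (\<lambda>\<epsilon>\<in>cube_index k. int_iterate X S (f \<epsilon>) (p \<epsilon>))"

definition face_orbit_closure ::
  "nat \<Rightarrow> 'a topology \<Rightarrow> ('a \<Rightarrow> 'a) \<Rightarrow> 'a \<Rightarrow> (nat set \<Rightarrow> 'a) set" where
  "face_orbit_closure k X S x =
     cube_space k X closure_of ((\<lambda>f. cube_act k X S f (diag k x)) ` face_group k)"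


section \<open>Regionally proximal relations and the maximal factor of order infinity\<close>

text \<open>Nets \<open>(f\<^sub>\<lambda>, x\<^sub>\<lambda>, y\<^sub>\<lambda>)\<close> are rendered as proper filters on the set of triples (the eventuality
  filter of the net): convergence along a net is convergence along its
  eventuality filter, and every proper filter arises in this way. The limits \<open>p\<close> and \<open>q\<close> are
  the points \<open>(x, a\<^sub>*)\<close> and \<open>(y, a\<^sub>*)\<close>.\<close>

definition RP :: "nat \<Rightarrow> 'a topology \<Rightarrow> ('a \<Rightarrow> 'a) \<Rightarrow> ('a \<times> 'a) set" where
  "RP k X S = {(x, y).
     \<exists>(F :: ((nat set \<Rightarrow> int) \<times> 'a \<times> 'a) filter) p q.
       F \<noteq> bot \<and>
       (\<forall>\<^sub>F (f, x', y') in F. f \<in> face_group k \<and> x' \<in> topspace X \<and> y' \<in> topspace X) \<and>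
       limitin (cube_space k X) (\<lambda>(f, x', y'). cube_act k X S f (diag k x')) p F \<and>
       limitin (cube_space k X) (\<lambda>(f, x', y'). cube_act k X S f (diag k y')) q F \<and>
       p {} = x \<and> q {} = y \<and>
       (\<forall>\<epsilon>\<in>cube_index k - {{}}. p \<epsilon> = q \<epsilon>)}"

definition RP_infinity :: "'a topology \<Rightarrow> ('a \<Rightarrow> 'a) \<Rightarrow> ('a \<times> 'a) set" where
  "RP_infinity X S = (\<Inter>k\<in>{1..}. RP k X S)"

text \<open>The quotient space of \<open>X\<close> by \<open>R\<close>: the points are the classes \<open>R `` {x}\<close>, and the topology is
  the final one for the projection \<open>x \<mapsto> R `` {x}\<close>.\<close>

definition quotient_space :: "'a topology \<Rightarrow> ('a \<times> 'a) set \<Rightarrow> 'a set topology" where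
  "quotient_space X R =
     topology (\<lambda>U. U \<subseteq> topspace X // R \<and> openin X {x \<in> topspace X. R `` {x} \<in> U})"

lemma openin_quotient_space:
  "openin (quotient_space X R) U \<longleftrightarrow>
     U \<subseteq> topspace X // R \<and> openin X {x \<in> topspace X. R `` {x} \<in> U}"
proof -
  let ?P = "\<lambda>U. U \<subseteq> topspace X // R \<and> openin X {x \<in> topspace X. R `` {x} \<in> U}"
  have "istopology ?P"
    unfolding istopology_def
  proof (intro conjI allI impI)
    fix U V assume "?P U" "?P V"
    moreover have "{x \<in> topspace X. R `` {x} \<in> U \<inter> V} =
      {x \<in> topspace X. R `` {x} \<in> U} \<inter> {x \<in> topspace X. R `` {x} \<in> V}" by blast
    ultimately show "U \<inter> V \<subseteq> topspace X // R" "openin X {x \<in> topspace X. R `` {x} \<in> U \<inter> V}"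
      by auto
  next
    fix \<K> assume *: "\<forall>K\<in>\<K>. ?P K"
    then show "\<Union>\<K> \<subseteq> topspace X // R" by blast
    have "{x \<in> topspace X. R `` {x} \<in> \<Union>\<K>} = (\<Union>K\<in>\<K>. {x \<in> topspace X. R `` {x} \<in> K})"
      by blast
    then show "openin X {x \<in> topspace X. R `` {x} \<in> \<Union>\<K>}" using * by auto
  qed
  then show ?thesis
    by (simp add: quotient_space_def)
qed

lemma topspace_quotient_space [simp]: "topspace (quotient_space X R) = topspace X // R"
proof
  show "topspace (quotient_space X R) \<subseteq> topspace X // R"
    using openin_quotient_space openin_topspace by blast
  have "{x \<in> topspace X. R `` {x} \<in> topspace X // R} = topspace X"
    by (auto intro: quotientI)
  then have "openin (quotient_space X R) (topspace X // R)"
    by (simp add: openin_quotient_space)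
  then show "topspace X // R \<subseteq> topspace (quotient_space X R)"
    by (rule openin_subset)
qed

lemma quotient_map_quotient_space: "quotient_map X (quotient_space X R) (\<lambda>x. R `` {x})"
  unfolding quotient_map_def by (auto simp: openin_quotient_space quotient_def)

definition X_infinity :: "'a topology \<Rightarrow> ('a \<Rightarrow> 'a) \<Rightarrow> 'a set topology" where
  "X_infinity X S = quotient_space X (RP_infinity X S)"

definition pi_infinity :: "'a topology \<Rightarrow> ('a \<Rightarrow> 'a) \<Rightarrow> 'a \<Rightarrow> 'a set" where
  "pi_infinity X S x = RP_infinity X S `` {x}"

text \<open>For an invariant equivalence relation the induced homeomorphism takes the class of \<open>x\<close> to
  the class of \<open>S x\<close>, which is the image of the class of \<open>x\<close> under \<open>S\<close>.\<close>

definition S_infinity :: "('a \<Rightarrow> 'a) \<Rightarrow> 'a set \<Rightarrow> 'a set" where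
  "S_infinity S C = S ` C"


section \<open>Topological cubic characteristic factors\<close>

definition saturated :: "'a set \<Rightarrow> ('a \<Rightarrow> 'b) \<Rightarrow> 'a set \<Rightarrow> bool" where
  "saturated A \<phi> L \<longleftrightarrow> L \<subseteq> A \<and> L = {a \<in> A. \<phi> a \<in> \<phi> ` L}"

abbreviation star_index :: "nat \<Rightarrow> nat set set" where
  "star_index d \<equiv> cube_index d - {{}}"

definition star_proj :: "nat \<Rightarrow> (nat set \<Rightarrow> 'a) \<Rightarrow> nat set \<Rightarrow> 'a" where
  "star_proj d p = restrict p (star_index d)"

definition star_map :: "nat \<Rightarrow> ('a \<Rightarrow> 'b) \<Rightarrow> (nat set \<Rightarrow> 'a) \<Rightarrow> nat set \<Rightarrow> 'b" where
  "star_map d \<phi> p = (\<lambda>\<epsilon>\<in>star_index d. \<phi> (p \<epsilon>))"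

definition cubic_characteristic_factor ::
  "nat \<Rightarrow> 'a topology \<Rightarrow> ('a \<Rightarrow> 'a) \<Rightarrow> 'b topology \<Rightarrow> ('b \<Rightarrow> 'b) \<Rightarrow> ('a \<Rightarrow> 'b) \<Rightarrow> bool" where
  "cubic_characteristic_factor d X S Y R \<phi> \<longleftrightarrow>
     extension X S Y R \<phi> \<and>
     (\<exists>X\<^sub>0. dense_gdelta X X\<^sub>0 \<and>
        (\<forall>x\<in>X\<^sub>0. saturated (star_index d \<rightarrow>\<^sub>E topspace X) (star_map d \<phi>)
                   (star_proj d ` face_orbit_closure d X S x)))"

end

theory Submission
  imports Defs
begin

text \<open>
  Write \<open>Q\<^sup>d\<close> for the closure of all translates \<open>f x\<^sup>[\<^sup>d\<^sup>]\<close> and \<open>F\<close> for the face group. The Ellis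
  semigroup argument shows that diagonal points are uniformly recurrent under \<open>F\<close>; together with the
  symmetries of the cube this gives the key fact that \<open>z\<^sup>[\<^sup>d\<^sup>]\<close> lies in the \<open>F\<close>-orbit closure of every
  point of \<open>Q\<^sup>d\<close> based at \<open>z\<close>. Hence \<open>(x, y)\<close> is in \<open>RP\<^sup>[\<^sup>\<infinity>\<^sup>]\<close> iff all corners \<open>(x, y, \<dots>, y)\<close> are in
  \<open>Q\<^sup>d\<close>, and \<open>RP\<^sup>[\<^sup>\<infinity>\<^sup>]\<close> is a closed invariant equivalence relation.

  The fibres of \<open>\<pi>\<close> vary continuously over a dense \<open>G\<^sub>\<delta>\<close> set. Let \<open>Y'\<close> be the closure of
  these fibres in the hyperspace of \<open>X\<close> and \<open>X'\<close> the set of pairs \<open>(x, K)\<close> with \<open>x \<in> K \<in> Y'\<close>. Both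
  are almost one-to-one over \<open>X\<close> and its factor, and \<open>\<pi>' : X' \<rightarrow> Y'\<close> is open. The points of \<open>Q\<^sup>d(X')\<close>
  in which a coordinate can be replaced by any point of its \<open>\<pi>'\<close>-fibre form a closed
  invariant set because \<open>\<pi>'\<close> is open, and the set contains the diagonal points over continuity points
  because corners lift uniquely there. So \<open>Q\<^sup>d(X')\<close> is \<open>\<pi>'\<close>-saturated, and for generic \<open>x\<close> the
  points of \<open>Q\<^sup>d(X')\<close> based at \<open>x\<close> are exactly the \<open>F\<close>-orbit closure of \<open>x\<^sup>[\<^sup>d\<^sup>]\<close>.
\<close>

section \<open>Compact semigroups, iterates and face groups\<close>

text \<open>The obstacle is to move a cube to its base point by limits of face group elements. A
  minimal idempotent of their enveloping semigroup may act differently at different vertices. The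
  proof builds one that applies a single map \<omega> at every non-empty vertex and still generates
  a minimal left ideal, so that anything done to its fixed points can be undone at all vertices
  together. The induction compares faces embedded in different ways; hence all finite sets of
  directions are vertices, and substitutions of directions act on the semigroup. Corners detect
  regional proximality only up to a shift of dimension: a corner in \<open>Q^(k+1)\<close> gives
  order k, and order k gives a corner in \<open>Q^k\<close>. The shift vanishes in the intersection
  over all orders. Nowhere dense sets and continuity of fibres are expressed by saturated subsets of
  X, and hyperspace points are sequences of minima of countably many functions, which places both
  new systems in one type of real sequences.\<close>

lemma ex_minimal_closed_set:
  assumes "compact_space P"
    and clo: "\<And>B. B \<in> \<S> \<Longrightarrow> closedin P B \<and> B \<noteq> {}"
    and Inter: "\<And>\<C>. \<C> \<subseteq> \<S> \<Longrightarrow> \<C> \<noteq> {} \<Longrightarrow> \<Inter>\<C> \<noteq> {} \<Longrightarrow> \<Inter>\<C> \<in> \<S>"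
    and "B0 \<in> \<S>"
  obtains B where "B \<in> \<S>" "\<And>B'. B' \<in> \<S> \<Longrightarrow> B' \<subseteq> B \<Longrightarrow> B' = B"
proof -
  \<comment> \<open>Complements turn the search for a minimal set into one for a maximal
    set.\<close>
  have "\<exists>M\<in>uminus ` \<S>. \<forall>X\<in>uminus ` \<S>. M \<subseteq> X \<longrightarrow> X = M"
  proof (rule subset_Zorn_nonempty)
    show "uminus ` \<S> \<noteq> {}" using assms(4) by auto
    fix \<C> :: "'a set set" assume "\<C> \<noteq> {}" and ch: "subset.chain (uminus ` \<S>) \<C>"
    define \<D> where "\<D> = uminus ` \<C>"
    have sub: "\<D> \<subseteq> \<S>" and ne: "\<D> \<noteq> {}"
      using ch \<open>\<C> \<noteq> {}\<close> by (auto simp: \<D>_def subset_chain_def)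
    have tot: "A \<subseteq> B \<or> B \<subseteq> A" if "A \<in> \<D>" "B \<in> \<D>" for A B
    proof -
      have "- A \<in> \<C>" "- B \<in> \<C>" using that by (auto simp: \<D>_def)
      then have "- A \<subseteq> - B \<or> - B \<subseteq> - A" using ch unfolding subset_chain_def by blast
      then show ?thesis by blast
    qed
    \<comment> \<open>A finite non-empty subfamily of a chain contains its own intersection, which
      is therefore non-empty; compactness passes this on to the whole chain.\<close>
    have "\<Inter>\<D> \<noteq> {}"
    proof -
      have fin: "\<exists>B\<in>\<F>. \<Inter>\<F> = B" if "finite \<F>" "\<F> \<noteq> {}" "\<F> \<subseteq> \<D>" for \<F>
        using that
      proof (induction rule: finite_ne_induct)
        case (insert A \<F>)
        then obtain B where "B \<in> \<F>" "\<Inter>\<F> = B" by auto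
        then have "\<Inter>(insert A \<F>) = A \<inter> B" "A \<subseteq> B \<or> B \<subseteq> A" using tot[of A B] insert.prems by auto
        then show ?case using \<open>B \<in> \<F>\<close> by (metis inf.absorb1 inf.absorb2 insertCI)
      qed auto
      have "\<Inter>\<F> \<noteq> {}" if \<F>: "finite \<F>" "\<F> \<subseteq> \<D>" for \<F>
      proof (cases "\<F> = {}")
        case False
        then obtain B where "B \<in> \<F>" "\<Inter>\<F> = B" using fin \<F> by metis
        then show ?thesis using clo[of B] sub \<F>(2) by auto
      qed auto
      then show ?thesis
        using \<open>compact_space P\<close>[unfolded compact_space_fip, rule_format, of \<D>] sub clo
        by (simp add: subset_iff)
    qed
    then have "\<Inter>\<D> \<in> \<S>" using Inter sub ne by blast
    moreover have "\<Union>\<C> = - \<Inter>\<D>" by (auto simp: \<D>_def)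
    ultimately show "\<Union>\<C> \<in> uminus ` \<S>" by blast
  qed
  then obtain B where B: "B \<in> \<S>" "\<forall>X\<in>uminus ` \<S>. - B \<subseteq> X \<longrightarrow> X = - B" by blast
  have "B' = B" if "B' \<in> \<S>" "B' \<subseteq> B" for B'
  proof -
    have "- B' = - B" using B(2) that by simp
    then show ?thesis by simp
  qed
  with B(1) show ?thesis by (rule that)
qed

text \<open>Ellis-Numakura. For \<open>e\<close> in a minimal closed subsemigroup \<open>B\<close>,
  the set \<open>B e\<close> is again a closed subsemigroup, hence all of \<open>B\<close>, so some
  \<open>f\<close> has \<open>f e = e\<close>. The elements with this property form a closed
  subsemigroup too, so \<open>e\<close> is one of them.\<close>

lemma ex_idempotent:
  assumes "compact_space P" "Hausdorff_space P" "topspace P \<noteq> {}"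
    and closed: "\<And>x y. x \<in> topspace P \<Longrightarrow> y \<in> topspace P \<Longrightarrow> mul x y \<in> topspace P"
    and assoc: "\<And>x y z. x \<in> topspace P \<Longrightarrow> y \<in> topspace P \<Longrightarrow> z \<in> topspace P \<Longrightarrow>
      mul (mul x y) z = mul x (mul y z)"
    and cont: "\<And>y. y \<in> topspace P \<Longrightarrow> continuous_map P P (\<lambda>x. mul x y)"
  shows "\<exists>e\<in>topspace P. mul e e = e"
proof -
  define \<S> where "\<S> = {B. closedin P B \<and> B \<noteq> {} \<and> (\<forall>x\<in>B. \<forall>y\<in>B. mul x y \<in> B)}"
  obtain B where B: "B \<in> \<S>" and min: "\<And>B'. B' \<in> \<S> \<Longrightarrow> B' \<subseteq> B \<Longrightarrow> B' = B"
  proof (rule ex_minimal_closed_set[OF assms(1), of \<S> "topspace P"])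
    show "topspace P \<in> \<S>" using assms(3) closed by (auto simp: \<S>_def)
    show "\<Inter>\<C> \<in> \<S>" if "\<C> \<subseteq> \<S>" "\<C> \<noteq> {}" "\<Inter>\<C> \<noteq> {}" for \<C>
    proof -
      have "closedin P (\<Inter>\<C>)" using that(1,2) by (intro closedin_Inter) (auto simp: \<S>_def)
      moreover have "mul x y \<in> \<Inter>\<C>" if xy: "x \<in> \<Inter>\<C>" "y \<in> \<Inter>\<C>" for x y
      proof
        fix C assume "C \<in> \<C>"
        then show "mul x y \<in> C" using xy \<open>\<C> \<subseteq> \<S>\<close> by (auto simp: \<S>_def)
      qed
      ultimately show ?thesis using that(3) by (auto simp: \<S>_def)
    qed
  qed (auto simp: \<S>_def)
  then obtain e where e: "e \<in> B" by (auto simp: \<S>_def)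
  have cB: "closedin P B" and mB: "\<And>x y. x \<in> B \<Longrightarrow> y \<in> B \<Longrightarrow> mul x y \<in> B"
    using B by (auto simp: \<S>_def)
  have sub: "B \<subseteq> topspace P" using cB closedin_subset by blast
  have eP: "e \<in> topspace P" using sub e by blast
  have cl: "closed_map P P (\<lambda>x. mul x e)"
    by (rule T1_Spaces.continuous_imp_closed_map[OF cont[OF eP] assms(1,2)])
  have "(\<lambda>x. mul x e) ` B \<in> \<S>"
  proof -
    have "mul (mul x e) (mul y e) \<in> (\<lambda>x. mul x e) ` B" if "x \<in> B" "y \<in> B" for x y
    proof -
      have "mul (mul x e) (mul y e) = mul (mul (mul x e) y) e"
        using assoc[of "mul x e" y e] closed[of x e] that sub eP by (auto simp: subset_iff)
      then show ?thesis using that e mB by auto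
    qed
    then show ?thesis using cl cB e by (auto simp: \<S>_def closed_map_def)
  qed
  then have "(\<lambda>x. mul x e) ` B = B" using min mB e by blast
  then obtain f where f: "f \<in> B" "mul f e = e" using e by (metis imageE)
  define B' where "B' = {x \<in> B. mul x e = e}"
  have "closedin P {x \<in> topspace P. mul x e \<in> {e}}"
    using closedin_continuous_map_preimage[OF cont[OF eP], of "{e}"] assms(2) eP
    by (simp add: closedin_Hausdorff_singleton)
  then have "closedin P (B \<inter> {x \<in> topspace P. mul x e \<in> {e}})" using cB by blast
  moreover have "B \<inter> {x \<in> topspace P. mul x e \<in> {e}} = B'" using sub by (auto simp: B'_def)
  ultimately have "closedin P B'" by simp
  moreover have "mul x y \<in> B'" if "x \<in> B'" "y \<in> B'" for x y
    using that assoc[of x y e] sub eP mB by (auto simp: B'_def)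
  ultimately have "B' \<in> \<S>" using f by (auto simp: \<S>_def B'_def)
  then have "B' = B" using min by (auto simp: B'_def)
  then show ?thesis using e eP by (auto simp: B'_def)
qed

section \<open>Integer iterates of the homeomorphism\<close>

lemma int_iterate_0: "int_iterate X S 0 = id"
  by (auto simp: int_iterate_def)

lemma int_iterate_1: "int_iterate X S 1 = S"
  by (auto simp: int_iterate_def)

locale compact_tds =
  fixes X :: "'a topology" and S :: "'a \<Rightarrow> 'a"
  assumes tds: "metric_tds X S"
begin

abbreviation "M \<equiv> topspace X"
abbreviation "T \<equiv> int_iterate X S"

lemma compact: "compact_space X" and metrizable: "metrizable_space X"
  and homeo: "homeomorphic_map X X S"
  using tds by (auto simp: metric_tds_def)

lemma Hausdorff: "Hausdorff_space X"
  using metrizable by (rule metrizable_imp_Hausdorff_space)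

lemma inj_S: "inj_on S M" and image_S: "S ` M = M" and cont_S: "continuous_map X X S"
  using homeo by (auto simp: homeomorphic_eq_everything_map)

lemma cont_inv_S: "continuous_map X X (inv_into M S)"
proof -
  obtain g where g: "continuous_map X X g" "\<And>x. x \<in> M \<Longrightarrow> S (g x) = x" "\<And>x. x \<in> M \<Longrightarrow> g (S x) = x"
    using homeo by (auto simp: homeomorphic_map_maps homeomorphic_maps_def)
  have "inv_into M S x = g x" if "x \<in> M" for x
    using that g inj_S by (metis continuous_map_funspace funcset_mem inv_into_f_f)
  then show ?thesis using g(1) by (metis continuous_map_eq)
qed

lemma cont_T: "continuous_map X X (T n)"
proof -
  have *: "continuous_map X X (f ^^ k)" if "continuous_map X X f" for f and k :: nat
  proof (induction k)
    case (Suc k)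
    then show ?case using continuous_map_compose[OF _ that] by (simp only: funpow.simps)
  qed simp
  show ?thesis using *[OF cont_S] *[OF cont_inv_S] by (simp add: int_iterate_def)
qed

lemma T_in: "x \<in> M \<Longrightarrow> T n x \<in> M"
  using cont_T by (meson continuous_map_funspace funcset_mem)

lemma T_Suc: assumes "x \<in> M" shows "T (n + 1) x = S (T n x)"
proof (cases "n \<ge> 0")
  case True
  then show ?thesis by (simp add: int_iterate_def nat_add_distrib)
next
  case False
  then have "nat (- n) = Suc (nat (- (n + 1)))" by linarith
  then have "T n x = inv_into M S (T (n + 1) x)"
    using False by (auto simp: int_iterate_def)
  then show ?thesis using T_in[OF assms, of "n + 1"] image_S
    by (simp add: f_inv_into_f)
qed

lemma T_add: assumes "x \<in> M" shows "T (m + n) x = T m (T n x)"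
proof (induction m rule: int_induct[where k = 0])
  case base
  then show ?case by (simp add: int_iterate_0)
next
  case (step1 i)
  then show ?case using T_Suc[OF assms, of "i + n"] T_Suc[OF T_in[OF assms], of i n]
    by (simp add: algebra_simps)
next
  case (step2 i)
  have "S (T (i - 1 + n) x) = S (T (i - 1) (T n x))"
    using step2 T_Suc[OF assms, of "i - 1 + n"] T_Suc[OF T_in[OF assms], of "i - 1" n] by simp
  then show ?case using inj_S T_in assms by (meson inj_onD)
qed

lemma T_inverse: assumes "x \<in> M" shows "T (- n) (T n x) = x" "T n (T (- n) x) = x"
  using T_add[OF assms, of "- n" n] T_add[OF assms, of n "- n"] by (auto simp: int_iterate_0)

end

text \<open>The acting group is abelian, so a product of facet generators depends only on the total
  exponent \<open>n i\<close> spent on each facet. From here on the face group is handled through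
  this vector.\<close>

lemma face_group_iff:
  "f \<in> face_group k \<longleftrightarrow> (\<exists>n. f = (\<lambda>\<epsilon>. if \<epsilon> \<in> cube_index k then sum n \<epsilon> else 0))"
proof
  assume "f \<in> face_group k"
  then show "\<exists>n. f = (\<lambda>\<epsilon>. if \<epsilon> \<in> cube_index k then sum n \<epsilon> else 0)"
  proof induction
    case zero
    show ?case by (rule exI[of _ "\<lambda>_. 0"]) auto
  next
    case (facet i t)
    show ?case
      by (rule exI[of _ "\<lambda>j. if j = i then t else 0"])
        (auto simp: fun_eq_iff finite_subset[OF _ finite_atLeastAtMost])
  next
    case (add f g)
    then obtain m n where "f = (\<lambda>\<epsilon>. if \<epsilon> \<in> cube_index k then sum m \<epsilon> else 0)"
      "g = (\<lambda>\<epsilon>. if \<epsilon> \<in> cube_index k then sum n \<epsilon> else 0)" by auto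
    then show ?case
      by (intro exI[of _ "\<lambda>i. m i + n i"]) (auto simp: sum.distrib)
  next
    case (minus f)
    then obtain n where "f = (\<lambda>\<epsilon>. if \<epsilon> \<in> cube_index k then sum n \<epsilon> else 0)" by auto
    then show ?case
      by (intro exI[of _ "\<lambda>i. - n i"]) (auto simp: sum_negf)
  qed
next
  assume "\<exists>n. f = (\<lambda>\<epsilon>. if \<epsilon> \<in> cube_index k then sum n \<epsilon> else 0)"
  then obtain n where f: "f = (\<lambda>\<epsilon>. if \<epsilon> \<in> cube_index k then sum n \<epsilon> else 0)" by auto
  have "(\<lambda>\<epsilon>. if \<epsilon> \<in> cube_index k then sum n (\<epsilon> \<inter> A) else 0) \<in> face_group k"
    if "finite A" "A \<subseteq> {1..k}" for A
    using that
  proof induction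
    case empty
    then show ?case using face_group.zero by (simp add: fun_eq_iff cong: if_cong)
  next
    case (insert i A)
    have "sum n (\<epsilon> \<inter> insert i A) = sum n (\<epsilon> \<inter> A) + (if i \<in> \<epsilon> then n i else 0)" for \<epsilon>
      using insert by (auto simp: Int_insert_right)
    then have "(\<lambda>\<epsilon>. if \<epsilon> \<in> cube_index k then sum n (\<epsilon> \<inter> insert i A) else 0) =
      (\<lambda>\<epsilon>. (if \<epsilon> \<in> cube_index k then sum n (\<epsilon> \<inter> A) else 0) +
        (if \<epsilon> \<in> cube_index k \<and> i \<in> \<epsilon> then n i else 0))" by auto
    then show ?case using insert face_group.add face_group.facet by auto
  qed
  from this[of "{1..k}"] show "f \<in> face_group k"
    unfolding f by (auto simp: Int_absorb2 cong: if_cong)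
qed

definition face_point :: "nat \<Rightarrow> 'a topology \<Rightarrow> ('a \<Rightarrow> 'a) \<Rightarrow> (nat \<Rightarrow> int) \<Rightarrow> 'a \<Rightarrow> nat set \<Rightarrow> 'a" where
  "face_point d X S n x = (\<lambda>\<epsilon>\<in>cube_index d. int_iterate X S (sum n \<epsilon>) x)"

text \<open>This is \<open>Q^d\<close>. The base point ranges over an invariant set, so the diagonal
  translates are already included.\<close>

definition cubes :: "nat \<Rightarrow> 'a topology \<Rightarrow> ('a \<Rightarrow> 'a) \<Rightarrow> (nat set \<Rightarrow> 'a) set" where
  "cubes d X S = cube_space d X closure_of {face_point d X S n x |n x. x \<in> topspace X}"

lemma cube_act_diag:
  assumes "f = (\<lambda>\<epsilon>. if \<epsilon> \<in> cube_index k then sum n \<epsilon> else 0)"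
  shows "cube_act k X S f (diag k x) = face_point k X S n x"
  using assms by (auto simp: cube_act_def diag_def face_point_def)

lemma cube_act_diag_image:
  "(\<lambda>f. cube_act k X S f (diag k x)) ` face_group k = range (\<lambda>n. face_point k X S n x)"
proof -
  have "face_group k = range (\<lambda>n \<epsilon>. if \<epsilon> \<in> cube_index k then sum n \<epsilon> else 0)"
    using face_group_iff by blast
  then show ?thesis by (simp only: image_image cube_act_diag[OF refl])
qed

lemma face_orbit_closure_eq:
  "face_orbit_closure k X S x = cube_space k X closure_of range (\<lambda>n. face_point k X S n x)"
  by (simp only: face_orbit_closure_def cube_act_diag_image)

lemma topspace_cube_space: "topspace (cube_space d X) = cube_index d \<rightarrow>\<^sub>E topspace X"
  by (simp add: cube_space_def)

section \<open>The enveloping semigroup of the cube transformations\<close>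

text \<open>A vertex acts on a vector \<open>n\<close> by summing it over the vertex. The admissible
  \<phi> are those that turn such sums into sums of another vector; reading vertices through \<phi>
  then maps the face group, and with it the closure \<open>env\<close>, into itself.\<close>

definition dir_map :: "(nat set \<Rightarrow> nat set) \<Rightarrow> bool" where
  "dir_map \<phi> \<longleftrightarrow> (\<forall>\<epsilon>. finite \<epsilon> \<longrightarrow> finite (\<phi> \<epsilon>)) \<and>
     (\<forall>n :: nat \<Rightarrow> int. \<exists>m. \<forall>\<epsilon>. finite \<epsilon> \<longrightarrow> sum n (\<phi> \<epsilon>) = sum m \<epsilon>)"

text \<open>Direction \<open>i\<close> is substituted by the block \<open>A i\<close>; as the blocks
  are disjoint, the new vector is the sum of \<open>n\<close> over each block.\<close>

lemma dir_map_UN: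
  assumes "\<And>i. finite (A i)" "\<And>i j. i \<noteq> j \<Longrightarrow> A i \<inter> A j = {}"
  shows "dir_map (\<lambda>\<epsilon>. \<Union>i\<in>\<epsilon>. A i)"
  unfolding dir_map_def
proof (intro conjI allI impI)
  fix n :: "nat \<Rightarrow> int"
  show "\<exists>m. \<forall>\<epsilon>. finite \<epsilon> \<longrightarrow> sum n (\<Union>i\<in>\<epsilon>. A i) = sum m \<epsilon>"
    using assms by (intro exI[of _ "\<lambda>i. sum n (A i)"] allI impI sum.UNION_disjoint) auto
qed (use assms in auto)

lemma dir_map_Int: "dir_map (\<lambda>\<epsilon>. \<epsilon> \<inter> D)"
proof -
  have "(\<Union>i\<in>\<epsilon>. if i \<in> D then {i} else {}) = \<epsilon> \<inter> D" for \<epsilon> by auto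
  then show ?thesis using dir_map_UN[of "\<lambda>i. if i \<in> D then {i} else {}"] by (simp split: if_splits)
qed

lemma dir_map_Diff: "dir_map (\<lambda>\<epsilon>. \<epsilon> - D)"
  using dir_map_Int[of "- D"] by (simp add: Diff_eq)

lemma dir_map_facet: "finite A \<Longrightarrow> dir_map (\<lambda>\<epsilon>. if i \<in> \<epsilon> then A else {})"
proof -
  assume "finite A"
  have "(\<Union>j\<in>\<epsilon>. if j = i then A else {}) = (if i \<in> \<epsilon> then A else {})" for \<epsilon> by auto
  then show ?thesis using dir_map_UN[of "\<lambda>j. if j = i then A else {}"] \<open>finite A\<close>
    by (simp split: if_splits)
qed

text \<open>Directions in \<open>D\<close> are kept, \<open>i\<close> now moves the whole block
  \<open>A\<close>, and all others are dropped. This embeds a face diagonally into a cube.\<close>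

lemma dir_map_replace:
  assumes "finite A" "A \<inter> D = {}" "i \<notin> D"
  shows "dir_map (\<lambda>\<epsilon>. (\<epsilon> \<inter> D) \<union> (if i \<in> \<epsilon> then A else {}))"
proof -
  have "(\<Union>j\<in>\<epsilon>. if j \<in> D then {j} else if j = i then A else {}) =
    (\<epsilon> \<inter> D) \<union> (if i \<in> \<epsilon> then A else {})" for \<epsilon>
    using assms by auto
  moreover have "dir_map (\<lambda>\<epsilon>. \<Union>j\<in>\<epsilon>. if j \<in> D then {j} else if j = i then A else {})"
    by (rule dir_map_UN) (use assms in \<open>auto split: if_splits\<close>)
  ultimately show ?thesis by simp
qed

context compact_tds
begin

text \<open>Cubes of all dimensions are treated at once: the vertices are the finite sets of directions.
  Direction \<open>0\<close>, which does not occur in \<open>cube_index d\<close>, serves as an additional direction.\<close>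
abbreviation "coords \<equiv> {\<epsilon> :: nat set. finite \<epsilon>} \<times> M"

definition "coord_space = product_topology (\<lambda>_. X) coords"

definition gen :: "(nat \<Rightarrow> int) \<Rightarrow> nat set \<times> 'a \<Rightarrow> 'a" where
  "gen n = (\<lambda>(\<epsilon>, x)\<in>coords. T (sum n \<epsilon>) x)"

text \<open>The Ellis semigroup of the face group, acting at all vertices and on all points at
  once.\<close>

definition "env = coord_space closure_of range gen"

definition mul :: "(nat set \<times> 'a \<Rightarrow> 'a) \<Rightarrow> (nat set \<times> 'a \<Rightarrow> 'a) \<Rightarrow> nat set \<times> 'a \<Rightarrow> 'a" where
  "mul p q = (\<lambda>(\<epsilon>, x)\<in>coords. p (\<epsilon>, q (\<epsilon>, x)))"

definition pb :: "(nat set \<Rightarrow> nat set) \<Rightarrow> (nat set \<times> 'a \<Rightarrow> 'a) \<Rightarrow> nat set \<times> 'a \<Rightarrow> 'a" where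
  "pb \<phi> p = (\<lambda>(\<epsilon>, x)\<in>coords. p (\<phi> \<epsilon>, x))"

lemma compact_coord_space: "compact_space coord_space"
  unfolding coord_space_def by (simp add: compact_space_product_topology compact)

lemma Hausdorff_coord_space: "Hausdorff_space coord_space"
  unfolding coord_space_def by (simp add: Hausdorff_space_product_topology Hausdorff)

lemma topspace_coord_space: "topspace coord_space = coords \<rightarrow>\<^sub>E M"
  by (simp add: coord_space_def)

lemma gen_in: "gen n \<in> topspace coord_space"
  by (auto simp: gen_def topspace_coord_space T_in)

lemma closedin_env: "closedin coord_space env"
  by (simp add: env_def)

lemma gen_env: "gen n \<in> env"
  unfolding env_def by (meson closure_of_subset gen_in image_subsetI rangeI subset_iff)

lemma env_sub: "p \<in> env \<Longrightarrow> p \<in> coords \<rightarrow>\<^sub>E M"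
  using closedin_env closedin_subset topspace_coord_space by blast

lemma env_in: "p \<in> env \<Longrightarrow> finite \<epsilon> \<Longrightarrow> x \<in> M \<Longrightarrow> p (\<epsilon>, x) \<in> M"
  using env_sub by fastforce

lemma env_eqI:
  assumes "p \<in> coords \<rightarrow>\<^sub>E M" "q \<in> coords \<rightarrow>\<^sub>E M"
    and "\<And>\<epsilon> x. finite \<epsilon> \<Longrightarrow> x \<in> M \<Longrightarrow> p (\<epsilon>, x) = q (\<epsilon>, x)"
  shows "p = q"
  using assms by (intro PiE_ext[of p coords _ q]) auto

lemma gen_app [simp]: "finite \<epsilon> \<Longrightarrow> x \<in> M \<Longrightarrow> gen n (\<epsilon>, x) = T (sum n \<epsilon>) x"
  and mul_app [simp]: "finite \<epsilon> \<Longrightarrow> x \<in> M \<Longrightarrow> mul p q (\<epsilon>, x) = p (\<epsilon>, q (\<epsilon>, x))"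
  and pb_app [simp]: "finite \<epsilon> \<Longrightarrow> x \<in> M \<Longrightarrow> pb \<phi> p (\<epsilon>, x) = p (\<phi> \<epsilon>, x)"
  by (auto simp: gen_def mul_def pb_def)

lemma mul_in:
  assumes "p \<in> coords \<rightarrow>\<^sub>E M" "q \<in> coords \<rightarrow>\<^sub>E M" shows "mul p q \<in> coords \<rightarrow>\<^sub>E M"
  using assms by (auto simp: mul_def PiE_iff)

lemma mul_assoc:
  assumes "p \<in> coords \<rightarrow>\<^sub>E M" "q \<in> coords \<rightarrow>\<^sub>E M" "r \<in> coords \<rightarrow>\<^sub>E M"
  shows "mul (mul p q) r = mul p (mul q r)"
proof (rule env_eqI)
  fix \<epsilon> :: "nat set" and x assume "finite \<epsilon>" "x \<in> M"
  moreover have "r (\<epsilon>, x) \<in> M" using assms calculation by (auto simp: PiE_iff)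
  ultimately show "mul (mul p q) r (\<epsilon>, x) = mul p (mul q r) (\<epsilon>, x)" by simp
qed (auto intro!: mul_in assms)

lemma continuous_eval:
  assumes "finite \<epsilon>" "x \<in> M" shows "continuous_map coord_space X (\<lambda>p. p (\<epsilon>, x))"
  unfolding coord_space_def using assms by (intro continuous_map_product_projection) auto

lemma continuous_into_coord_space:
  assumes "\<And>\<epsilon> x. finite \<epsilon> \<Longrightarrow> x \<in> M \<Longrightarrow> continuous_map Z X (\<lambda>z. f z (\<epsilon>, x))"
    and "f ` topspace Z \<subseteq> extensional coords"
  shows "continuous_map Z coord_space f"
  unfolding coord_space_def continuous_map_componentwise using assms by auto

lemma continuous_mul_right:
  assumes "q \<in> coords \<rightarrow>\<^sub>E M"
  shows "continuous_map coord_space coord_space (\<lambda>p. mul p q)"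
proof (rule continuous_into_coord_space)
  fix \<epsilon> :: "nat set" and x assume *: "finite \<epsilon>" "x \<in> M"
  then have "q (\<epsilon>, x) \<in> M" using assms by auto
  with * show "continuous_map coord_space X (\<lambda>p. mul p q (\<epsilon>, x))"
    using continuous_eval[of \<epsilon> "q (\<epsilon>, x)"] by simp
qed (auto simp: mul_def)

lemma continuous_gen_mul: "continuous_map coord_space coord_space (\<lambda>q. mul (gen n) q)"
proof (rule continuous_into_coord_space)
  fix \<epsilon> :: "nat set" and x assume *: "finite \<epsilon>" "x \<in> M"
  have "continuous_map coord_space X (\<lambda>q. T (sum n \<epsilon>) (q (\<epsilon>, x)))"
    using continuous_map_compose[OF continuous_eval[OF *] cont_T] by (simp add: comp_def)
  then show "continuous_map coord_space X (\<lambda>q. mul (gen n) q (\<epsilon>, x))"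
    by (rule continuous_map_eq) (use * in \<open>auto simp: topspace_coord_space PiE_iff\<close>)
qed (auto simp: mul_def)

lemma continuous_pb:
  assumes "dir_map \<phi>" shows "continuous_map coord_space coord_space (pb \<phi>)"
proof (rule continuous_into_coord_space)
  fix \<epsilon> :: "nat set" and x assume *: "finite \<epsilon>" "x \<in> M"
  then show "continuous_map coord_space X (\<lambda>p. pb \<phi> p (\<epsilon>, x))"
    using continuous_eval[of "\<phi> \<epsilon>" x] assms by (simp add: dir_map_def)
qed (auto simp: pb_def)

lemma env_minimal:
  assumes "closedin coord_space {p \<in> topspace coord_space. P p}" "\<And>n. P (gen n)" "p \<in> env"
  shows "P p"
proof -
  have "env \<subseteq> {p \<in> topspace coord_space. P p}"
    unfolding env_def by (rule closure_of_minimal) (use assms gen_in in auto)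
  then show ?thesis using assms by auto
qed

lemma gen_mul_gen: "mul (gen m) (gen n) = gen (\<lambda>i. m i + n i)"
proof (rule env_eqI)
  show "mul (gen m) (gen n) (\<epsilon>, x) = gen (\<lambda>i. m i + n i) (\<epsilon>, x)" if "finite \<epsilon>" "x \<in> M" for \<epsilon> :: "nat set" and x
    using that by (simp add: T_in sum.distrib T_add)
qed (use gen_in mul_in in \<open>auto simp: topspace_coord_space\<close>)

text \<open>The closure is taken in two stages, because multiplication is continuous in the right
  factor only for a generator on the left, but always continuous in the left factor.\<close>

lemma env_mul: assumes "p \<in> env" "q \<in> env" shows "mul p q \<in> env"
proof -
  have gen: "mul (gen n) q \<in> env" for n
  proof (rule env_minimal[where P = "\<lambda>q. mul (gen n) q \<in> env"])
    show "closedin coord_space {q \<in> topspace coord_space. mul (gen n) q \<in> env}"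
      by (rule closedin_continuous_map_preimage[OF continuous_gen_mul closedin_env])
  qed (use assms gen_mul_gen gen_env in auto)
  show ?thesis
  proof (rule env_minimal[where P = "\<lambda>p. mul p q \<in> env"])
    show "closedin coord_space {p \<in> topspace coord_space. mul p q \<in> env}"
      using continuous_mul_right[OF env_sub[OF assms(2)]] closedin_env
      by (rule closedin_continuous_map_preimage)
  qed (use assms gen in auto)
qed

lemma env_pb: assumes "dir_map \<phi>" "p \<in> env" shows "pb \<phi> p \<in> env"
proof (rule env_minimal[where P = "\<lambda>p. pb \<phi> p \<in> env"])
  show "closedin coord_space {p \<in> topspace coord_space. pb \<phi> p \<in> env}"
    by (rule closedin_continuous_map_preimage[OF continuous_pb[OF assms(1)] closedin_env])
  fix n :: "nat \<Rightarrow> int"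
  obtain m where m: "\<And>\<epsilon>. finite \<epsilon> \<Longrightarrow> sum n (\<phi> \<epsilon>) = sum m \<epsilon>"
    using assms(1) unfolding dir_map_def by metis
  have "pb \<phi> (gen n) = gen m"
    using assms(1) by (intro env_eqI) (auto simp: m dir_map_def pb_def gen_def T_in)
  then show "pb \<phi> (gen n) \<in> env" using gen_env by simp
qed (use assms in auto)

text \<open>The sum over the empty vertex is 0, so generators fix the base point, and so do their
  limits.\<close>

lemma env_empty: assumes "p \<in> env" "x \<in> M" shows "p ({}, x) = x"
proof (rule env_minimal[where P = "\<lambda>p. p ({}, x) = x"])
  have "closedin coord_space {p \<in> topspace coord_space. p ({}, x) \<in> {x}}"
    using assms Hausdorff
    by (intro closedin_continuous_map_preimage[OF continuous_eval]) (auto simp: closedin_Hausdorff_singleton)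
  then show "closedin coord_space {p \<in> topspace coord_space. p ({}, x) = x}" by simp
qed (use assms in \<open>auto simp: int_iterate_0\<close>)

lemma closed_mul_right:
  assumes "closedin coord_space A" "q \<in> env"
  shows "closedin coord_space ((\<lambda>p. mul p q) ` A)"
  using T1_Spaces.continuous_imp_closed_map[OF continuous_mul_right[OF env_sub[OF assms(2)]]
      compact_coord_space Hausdorff_coord_space] assms(1) by (simp add: closed_map_def)

lemma ex_idempotent_env:
  assumes A: "closedin coord_space A" "A \<subseteq> env" "A \<noteq> {}"
    and mul: "\<And>p q. p \<in> A \<Longrightarrow> q \<in> A \<Longrightarrow> mul p q \<in> A"
  shows "\<exists>e\<in>A. mul e e = e"
proof -
  let ?P = "subtopology coord_space A"
  have top: "topspace ?P = A" using A(1) closedin_subset by fastforce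
  have "\<exists>e\<in>topspace ?P. mul e e = e"
  proof (rule ex_idempotent[where mul = mul])
    show "compact_space ?P"
      using A(1) compact_coord_space closedin_compact_space compact_space_subtopology by blast
    show "Hausdorff_space ?P" by (rule Hausdorff_space_subtopology[OF Hausdorff_coord_space])
    fix y assume "y \<in> topspace ?P"
    then have "y \<in> A" by (simp add: top)
    then show "continuous_map ?P ?P (\<lambda>x. mul x y)"
      using A mul continuous_mul_right[OF env_sub, of y]
      by (auto simp: continuous_map_in_subtopology continuous_map_from_subtopology)
    fix x z assume "x \<in> topspace ?P" "z \<in> topspace ?P"
    then have "x \<in> env" "y \<in> env" "z \<in> env" using A(2) \<open>y \<in> A\<close> by (auto simp del: topspace_subtopology simp: top)
    then show "mul (mul x y) z = mul x (mul y z)" by (intro mul_assoc env_sub)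
  next
    show "topspace ?P \<noteq> {}" using A(3) by (simp only: top not_False_eq_True)
    show "mul x y \<in> topspace ?P" if "x \<in> topspace ?P" "y \<in> topspace ?P" for x y
      using that mul unfolding top by blast
  qed
  then show ?thesis unfolding top .
qed

end

section \<open>Uniform idempotents\<close>

locale minimal_compact_tds = compact_tds +
  assumes minimal: "minimal_tds X S"
begin

lemma orbit_dense:
  assumes "closedin X A" "x \<in> M" "\<And>n. T n x \<in> A" shows "M \<subseteq> A"
proof -
  have "X closure_of range (\<lambda>n. T n x) \<subseteq> A" using assms by (intro closure_of_minimal) auto
  then show ?thesis using minimal assms(2) by (auto simp: minimal_tds_def)
qed

text \<open>Only direction 0 stays active, so the image of \<open>env\<close> is a copy of the
  enveloping semigroup of (X, T) itself.\<close>

definition single :: "(nat set \<times> 'a \<Rightarrow> 'a) \<Rightarrow> nat set \<times> 'a \<Rightarrow> 'a" where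
  "single p = pb (\<lambda>\<epsilon>. if 0 \<in> \<epsilon> then {0} else {}) p"

lemma single_app [simp]:
  "finite \<epsilon> \<Longrightarrow> x \<in> M \<Longrightarrow> single p (\<epsilon>, x) = (if 0 \<in> \<epsilon> then p ({0}, x) else p ({}, x))"
  by (simp add: single_def)

lemma single_env: "p \<in> env \<Longrightarrow> single p \<in> env"
  unfolding single_def by (rule env_pb[OF dir_map_facet]) auto

lemma single_ext [simp]: "single p \<in> extensional coords"
  by (auto simp: single_def pb_def)

lemma single_single: "single (single p) = single p"
  using single_ext by (intro extensionalityI[of _ coords]) auto

lemma single_mul:
  assumes "p \<in> env" "q \<in> env" shows "single (mul p q) = mul (single p) (single q)"
  by (intro extensionalityI[OF single_ext, of _ _]) (use assms env_in env_empty in \<open>auto simp: mul_def\<close>)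

lemma closedin_single: "closedin coord_space (single ` env)"
proof -
  have "continuous_map coord_space coord_space single"
    unfolding single_def[abs_def] by (rule continuous_pb[OF dir_map_facet]) auto
  then have "closed_map coord_space coord_space single"
    using T1_Spaces.continuous_imp_closed_map compact_coord_space Hausdorff_coord_space by blast
  then show ?thesis using closedin_env by (auto simp: closed_map_def)
qed

text \<open>\<open>w\<close> is an idempotent of a minimal left ideal \<open>L\<close>. It can be
  chosen to fix \<open>z\<close> because minimality of the system makes evaluation at
  \<open>z\<close> map \<open>L\<close> onto the space. For the last clause, \<open>v = v w\<close>
  lies in \<open>L\<close>, so the left ideal generated by \<open>v\<close> is \<open>L\<close>;
  hence \<open>w = q v\<close> for some \<open>q\<close>, and
  \<open>w v = q v v = w\<close>.\<close>

lemma ex_minimal_idempotent: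
  assumes z: "z \<in> M"
  obtains w where "w \<in> single ` env" "mul w w = w" "w ({0}, z) = z"
    "\<And>v. v \<in> single ` env \<Longrightarrow> mul v v = v \<Longrightarrow> mul v w = v \<Longrightarrow> mul w v = w"
proof -
  let ?E = "single ` env"
  have E_env: "p \<in> env" if "p \<in> ?E" for p using that single_env by auto
  have E_mul: "mul p q \<in> ?E" if "p \<in> ?E" "q \<in> ?E" for p q
  proof -
    from that obtain p' q' where "p = single p'" "q = single q'" "p' \<in> env" "q' \<in> env" by auto
    then have "mul p q = single (mul p' q')" by (simp add: single_mul)
    then show ?thesis using env_mul \<open>p' \<in> env\<close> \<open>q' \<in> env\<close> by auto
  qed
  define \<S> where "\<S> = {L. closedin coord_space L \<and> L \<noteq> {} \<and> L \<subseteq> ?E \<and> (\<forall>p\<in>?E. \<forall>q\<in>L. mul p q \<in> L)}"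
  obtain L where L: "L \<in> \<S>" and min: "\<And>B'. B' \<in> \<S> \<Longrightarrow> B' \<subseteq> L \<Longrightarrow> B' = L"
  proof (rule ex_minimal_closed_set[OF compact_coord_space, of \<S> ?E])
    show "?E \<in> \<S>" using closedin_single gen_env E_mul by (auto simp: \<S>_def)
    show "\<Inter>\<C> \<in> \<S>" if "\<C> \<subseteq> \<S>" "\<C> \<noteq> {}" "\<Inter>\<C> \<noteq> {}" for \<C>
    proof -
      have "closedin coord_space (\<Inter>\<C>)" using that(1,2) by (intro closedin_Inter) (auto simp: \<S>_def)
      moreover have "mul p q \<in> \<Inter>\<C>" if pq: "p \<in> ?E" "q \<in> \<Inter>\<C>" for p q
      proof
        fix C assume "C \<in> \<C>"
        then show "mul p q \<in> C" using pq \<open>\<C> \<subseteq> \<S>\<close> by (auto simp: \<S>_def)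
      qed
      moreover have "\<Inter>\<C> \<subseteq> ?E" using that(1,2) unfolding \<S>_def by fast
      ultimately show ?thesis using that(3) by (auto simp: \<S>_def)
    qed
  qed (auto simp: \<S>_def)
  have LE: "L \<subseteq> ?E" and Lc: "closedin coord_space L" and Lne: "L \<noteq> {}"
    and Li: "\<And>p q. p \<in> ?E \<Longrightarrow> q \<in> L \<Longrightarrow> mul p q \<in> L"
    using L by (auto simp: \<S>_def)
  have ev: "continuous_map coord_space X (\<lambda>p. p ({0}, z))"
    using continuous_eval[of "{0}" z] z by simp
  have "M \<subseteq> (\<lambda>p. p ({0}, z)) ` L"
  proof -
    obtain q where q: "q \<in> L" using Lne by auto
    have "T n (q ({0}, z)) \<in> (\<lambda>p. p ({0}, z)) ` L" for n
    proof -
      have "single (gen (\<lambda>_. n)) \<in> ?E" using gen_env by blast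
      then have "mul (single (gen (\<lambda>_. n))) q \<in> L" using Li q by blast
      moreover have "mul (single (gen (\<lambda>_. n))) q ({0}, z) = T n (q ({0}, z))"
        using z env_in[OF E_env, of q "{0}" z] q LE by auto
      ultimately show ?thesis by (metis imageI)
    qed
    moreover have "closedin X ((\<lambda>p. p ({0}, z)) ` L)"
      using T1_Spaces.continuous_imp_closed_map[OF ev compact_coord_space Hausdorff] Lc
      by (simp add: closed_map_def)
    moreover have "q ({0}, z) \<in> M" using env_in[OF E_env, of q "{0}" z] z q LE by auto
    ultimately show ?thesis using orbit_dense by blast
  qed
  then obtain q0 where q0: "q0 \<in> L" "q0 ({0}, z) = z" using z by auto
  \<comment> \<open>The elements of \<open>L\<close> that fix \<open>z\<close> form a closed
    subsemigroup, so Ellis' lemma applies to them.\<close>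
  let ?A = "L \<inter> {p \<in> topspace coord_space. p ({0}, z) \<in> {z}}"
  have "\<exists>e\<in>?A. mul e e = e"
  proof (rule ex_idempotent_env)
    show "closedin coord_space ?A"
      using Lc z Hausdorff closedin_continuous_map_preimage[OF ev, of "{z}"]
      by (auto simp: closedin_Hausdorff_singleton)
    show "?A \<subseteq> env" using LE E_env by auto
    show "?A \<noteq> {}" using q0 closedin_subset[OF Lc] by auto
    fix p q assume "p \<in> ?A" "q \<in> ?A"
    then have "mul p q \<in> L" "mul p q ({0}, z) = z" using Li LE z by auto
    then show "mul p q \<in> ?A" using closedin_subset[OF Lc] by auto
  qed
  then obtain w where w: "w \<in> L" "w ({0}, z) = z" "mul w w = w" by auto
  show ?thesis
  proof (rule that[of w])
    fix v assume v: "v \<in> ?E" "mul v v = v" "mul v w = v"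
    then have vL: "v \<in> L" using Li w by metis
    have vs: "v \<in> coords \<rightarrow>\<^sub>E M" using env_sub E_env v by blast
    have "(\<lambda>p. mul p v) ` ?E \<in> \<S>"
    proof -
      have "mul p (mul q v) \<in> (\<lambda>p. mul p v) ` ?E" if "p \<in> ?E" "q \<in> ?E" for p q
        using that E_mul mul_assoc[OF env_sub env_sub vs, of p q] E_env by (metis imageI)
      then show ?thesis
        using closed_mul_right[OF closedin_single E_env[OF v(1)]] E_mul v(1) gen_env
        by (auto simp: \<S>_def)
    qed
    moreover have "(\<lambda>p. mul p v) ` ?E \<subseteq> L" using Li vL by auto
    ultimately have "(\<lambda>p. mul p v) ` ?E = L" using min by blast
    then obtain q where q: "q \<in> ?E" "w = mul q v" using w(1) by blast
    have "q \<in> coords \<rightarrow>\<^sub>E M" using env_sub E_env q by blast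
    then have "mul (mul q v) v = mul q (mul v v)" using mul_assoc vs by blast
    then show "mul w v = w" using q v by simp
  qed (use w LE in auto)
qed

text \<open>The idempotent acts by the same \<open>\<omega>\<close> on all non-empty coordinates: it is the product of the
  copies of one minimal idempotent of the enveloping semigroup of \<open>(X, T)\<close> in all directions.\<close>
lemma ex_uniform_idempotent:
  assumes z: "z \<in> M"
  shows "\<exists>\<omega>. \<exists>U\<in>env. \<omega> z = z \<and> (\<forall>x\<in>M. \<omega> x \<in> M) \<and> (\<forall>x\<in>M. \<omega> (\<omega> x) = \<omega> x) \<and>
    (\<forall>\<epsilon> x. finite \<epsilon> \<longrightarrow> x \<in> M \<longrightarrow> U (\<epsilon>, x) = (if \<epsilon> = {} then x else \<omega> x)) \<and>
    (\<forall>v\<in>env. \<forall>\<eta>. finite \<eta> \<longrightarrow> (\<forall>x\<in>M. v (\<eta>, v (\<eta>, x)) = v (\<eta>, x)) \<longrightarrow>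
      (\<forall>x\<in>M. v (\<eta>, \<omega> x) = v (\<eta>, x)) \<longrightarrow> (\<forall>x\<in>M. \<omega> (v (\<eta>, x)) = \<omega> x))"
proof -
  obtain w where w: "w \<in> single ` env" "mul w w = w" "w ({0}, z) = z"
    and wmin: "\<And>v. v \<in> single ` env \<Longrightarrow> mul v v = v \<Longrightarrow> mul v w = v \<Longrightarrow> mul w v = w"
    using ex_minimal_idempotent[OF z] by blast
  have wE: "w \<in> env" using w single_env by auto
  have ws: "single w = w" using w single_single by auto
  define \<omega> where "\<omega> x = w ({0}, x)" for x
  have \<omega>M: "\<omega> x \<in> M" if "x \<in> M" for x using env_in[OF wE] that by (simp add: \<omega>_def)
  have \<omega>\<omega>: "\<omega> (\<omega> x) = \<omega> x" if "x \<in> M" for x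
    using arg_cong[OF w(2), of "\<lambda>p. p ({0}, x)"] that by (simp add: \<omega>_def)
  have w0: "w ({}, x) = x" if "x \<in> M" for x using env_empty[OF wE that] .
  \<comment> \<open>\<open>U n\<close> is the product of the copies of \<open>w\<close> in the first
    \<open>n\<close> directions; as \<omega> is idempotent, a vertex containing several of them is
    still moved by a single \<omega>.\<close>
  define U where "U n = (\<lambda>(\<epsilon>, x)\<in>coords. if \<epsilon> \<inter> {..<n} = {} then x else \<omega> x)" for n :: nat
  have U_app: "U n (\<epsilon>, x) = (if \<epsilon> \<inter> {..<n} = {} then x else \<omega> x)" if "finite \<epsilon>" "x \<in> M" for n \<epsilon> x
    using that by (simp add: U_def)
  have UP: "U n \<in> coords \<rightarrow>\<^sub>E M" for n using \<omega>M by (auto simp: U_def)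
  have Un: "U n \<in> env" for n
  proof (induction n)
    case 0
    have "U 0 = gen (\<lambda>_. 0)"
      using UP gen_in by (intro env_eqI) (auto simp: U_app int_iterate_0 topspace_coord_space)
    then show ?case using gen_env by simp
  next
    case (Suc n)
    let ?p = "pb (\<lambda>\<epsilon>. if n \<in> \<epsilon> then {0} else {}) w"
    have p: "?p \<in> env" by (rule env_pb[OF dir_map_facet wE]) auto
    have "U (Suc n) = mul (U n) ?p"
    proof (rule env_eqI)
      fix \<epsilon> :: "nat set" and x assume "finite \<epsilon>" "x \<in> M"
      then show "U (Suc n) (\<epsilon>, x) = mul (U n) ?p (\<epsilon>, x)"
        using w0 \<omega>M \<omega>\<omega> by (auto simp: U_app lessThan_Suc \<omega>_def[symmetric])
    qed (use UP p env_sub mul_in in auto)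
    then show ?case using env_mul[OF Suc p] by simp
  qed
  define V where "V = (\<lambda>(\<epsilon>, x)\<in>coords. if \<epsilon> = {} then x else \<omega> x)"
  have VP: "V \<in> coords \<rightarrow>\<^sub>E M" using \<omega>M by (auto simp: V_def)
  \<comment> \<open>A vertex is a finite set, so at each vertex the sequence is eventually
    constant.\<close>
  have "limitin coord_space U V sequentially"
    unfolding coord_space_def limitin_componentwise
  proof (intro conjI ballI)
    fix i assume "i \<in> coords"
    then obtain \<epsilon> x where i: "i = (\<epsilon>, x)" "finite \<epsilon>" "x \<in> M" by auto
    obtain N where N: "\<epsilon> \<subseteq> {..<N}" using i(2) finite_nat_iff_bounded by blast
    have "U n i = V i" if "n \<ge> N" for n
    proof -
      have "\<epsilon> \<inter> {..<n} = \<epsilon>" using N that by auto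
      then show ?thesis using i by (simp add: U_app V_def)
    qed
    then have "\<forall>\<^sub>F n in sequentially. U n i = V i" using eventually_sequentially by blast
    then show "limitin X (\<lambda>n. U n i) (V i) sequentially"
      by (rule limitin_eventually[rotated]) (use VP \<open>i \<in> coords\<close> in auto)
  qed (use VP UP in \<open>auto simp: PiE_iff\<close>)
  then have "V \<in> env"
    by (rule limitin_closedin[OF _ closedin_env]) (use Un in auto)
  have min: "\<omega> (v (\<eta>, x)) = \<omega> x" if v: "v \<in> env" "finite \<eta>"
    and vv: "\<forall>x\<in>M. v (\<eta>, v (\<eta>, x)) = v (\<eta>, x)"
    and vw: "\<forall>x\<in>M. v (\<eta>, \<omega> x) = v (\<eta>, x)" and x: "x \<in> M" for v \<eta> x
  proof -
    \<comment> \<open>The map that \<open>v\<close> induces at the vertex \<eta> belongs to the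
      enveloping semigroup of (X, T). Transported to direction 0 it can be compared with
      \<open>w\<close>.\<close>
    let ?v = "pb (\<lambda>\<epsilon>. if 0 \<in> \<epsilon> then \<eta> else {}) v"
    have vE: "?v \<in> env" by (rule env_pb[OF dir_map_facet]) (use v in auto)
    have v0: "v ({}, x) = x" if "x \<in> M" for x using env_empty[OF v(1) that] .
    have v_in: "v (\<epsilon>, x) \<in> M" if "finite \<epsilon>" "x \<in> M" for \<epsilon> x using env_in[OF v(1)] that .
    have "single ?v = ?v"
      by (rule env_eqI) (use single_env vE env_sub v in auto)
    then have "?v \<in> single ` env" using vE by (metis imageI)
    moreover have "mul ?v ?v = ?v"
      by (rule env_eqI) (use vE env_sub env_mul v v0 vv v_in in auto)
    moreover have "mul ?v w = ?v"
    proof (rule env_eqI)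
      fix \<epsilon> :: "nat set" and y assume y: "finite \<epsilon>" "y \<in> M"
      have "w (\<epsilon>, y) = (if 0 \<in> \<epsilon> then \<omega> y else y)"
        using y ws w0 single_app[of \<epsilon> y w] by (auto simp: \<omega>_def)
      then show "mul ?v w (\<epsilon>, y) = ?v (\<epsilon>, y)" using y \<omega>M v0 vw by auto
    qed (use vE env_sub env_mul wE in auto)
    ultimately have "mul w ?v = w" by (rule wmin)
    then have "mul w ?v ({0}, x) = w ({0}, x)" by simp
    then show ?thesis using x by (simp add: \<omega>_def)
  qed
  have "\<omega> z = z" using w(3) by (simp add: \<omega>_def)
  moreover have "\<forall>\<epsilon> x. finite \<epsilon> \<longrightarrow> x \<in> M \<longrightarrow> V (\<epsilon>, x) = (if \<epsilon> = {} then x else \<omega> x)"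
    by (simp add: V_def)
  ultimately show ?thesis
    using \<omega>M \<omega>\<omega> min \<open>V \<in> env\<close> by (intro exI[of _ \<omega>] bexI[of _ V] conjI ballI allI impI) auto
qed

text \<open>The last clause expresses that \<open>U\<close> generates a minimal left ideal of
  \<open>env\<close>: every multiple \<open>s U\<close> can be multiplied back to
  \<open>U\<close>.\<close>

definition uniform_idempotent :: "'a \<Rightarrow> ('a \<Rightarrow> 'a) \<Rightarrow> (nat set \<times> 'a \<Rightarrow> 'a) \<Rightarrow> bool" where
  "uniform_idempotent z \<omega> U \<longleftrightarrow>
    U \<in> env \<and> \<omega> z = z \<and> (\<forall>x\<in>M. \<omega> x \<in> M) \<and> (\<forall>x\<in>M. \<omega> (\<omega> x) = \<omega> x) \<and>
    (\<forall>\<epsilon> x. finite \<epsilon> \<longrightarrow> x \<in> M \<longrightarrow> U (\<epsilon>, x) = (if \<epsilon> = {} then x else \<omega> x)) \<and>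
    (\<forall>s\<in>env. \<exists>r\<in>env. \<forall>\<epsilon> x. finite \<epsilon> \<longrightarrow> x \<in> M \<longrightarrow> r (\<epsilon>, s (\<epsilon>, U (\<epsilon>, x))) = U (\<epsilon>, x))"

text \<open>The points fixed by the uniform idempotent can always be recovered: the idempotent \<open>v\<close> of the
  left ideal generated by \<open>s U\<close> satisfies \<open>U v = U\<close>.\<close>
lemma ex_uniform_idempotent_return:
  assumes z: "z \<in> M"
  shows "\<exists>\<omega> U. uniform_idempotent z \<omega> U"
proof -
  obtain \<omega> U where \<omega>: "\<omega> z = z" "\<forall>x\<in>M. \<omega> x \<in> M" "\<forall>x\<in>M. \<omega> (\<omega> x) = \<omega> x"
    and UE: "U \<in> env"
    and U: "\<forall>\<epsilon> x. finite \<epsilon> \<longrightarrow> x \<in> M \<longrightarrow> U (\<epsilon>, x) = (if \<epsilon> = {} then x else \<omega> x)"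
    and min: "\<forall>v\<in>env. \<forall>\<eta>. finite \<eta> \<longrightarrow> (\<forall>x\<in>M. v (\<eta>, v (\<eta>, x)) = v (\<eta>, x)) \<longrightarrow>
      (\<forall>x\<in>M. v (\<eta>, \<omega> x) = v (\<eta>, x)) \<longrightarrow> (\<forall>x\<in>M. \<omega> (v (\<eta>, x)) = \<omega> x)"
    using ex_uniform_idempotent[OF z] by (elim exE bexE conjE) (rule that)
  have "\<exists>r\<in>env. \<forall>\<epsilon> x. finite \<epsilon> \<longrightarrow> x \<in> M \<longrightarrow> r (\<epsilon>, s (\<epsilon>, U (\<epsilon>, x))) = U (\<epsilon>, x)" if s: "s \<in> env" for s
  proof -
    have sU: "mul s U \<in> env" using env_mul s UE by blast
    let ?A = "(\<lambda>p. mul p (mul s U)) ` env"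
    have "\<exists>v\<in>?A. mul v v = v"
    proof (rule ex_idempotent_env)
      show "closedin coord_space ?A" by (rule closed_mul_right[OF closedin_env sU])
      fix p q assume "p \<in> ?A" "q \<in> ?A"
      then obtain p' q' where pq: "p' \<in> env" "q' \<in> env" "p = mul p' (mul s U)" "q = mul q' (mul s U)" by auto
      have p: "p \<in> env" using pq env_mul sU by auto
      have "mul p q = mul (mul p q') (mul s U)"
        using mul_assoc[of p q' "mul s U"] pq p sU env_sub by auto
      then show "mul p q \<in> ?A" using pq p env_mul by auto
    qed (use env_mul sU gen_env in auto)
    then obtain t where t: "t \<in> env" and idem: "mul (mul t (mul s U)) (mul t (mul s U)) = mul t (mul s U)"
      by blast
    define v where "v = mul t (mul s U)"
    have vE: "v \<in> env" using env_mul t sU by (simp add: v_def)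
    have v_app: "v (\<epsilon>, x) = t (\<epsilon>, s (\<epsilon>, U (\<epsilon>, x)))" if "finite \<epsilon>" "x \<in> M" for \<epsilon> x
      using that by (simp add: v_def)
    have Uv: "U (\<epsilon>, v (\<epsilon>, x)) = U (\<epsilon>, x)" if "finite \<epsilon>" "x \<in> M" for \<epsilon> x
    proof (cases "\<epsilon> = {}")
      case True
      then show ?thesis using that U env_empty[OF vE] by simp
    next
      case False
      have "\<forall>y\<in>M. v (\<epsilon>, v (\<epsilon>, y)) = v (\<epsilon>, y)" "\<forall>y\<in>M. v (\<epsilon>, \<omega> y) = v (\<epsilon>, y)"
      proof safe
        fix y assume y: "y \<in> M"
        show "v (\<epsilon>, v (\<epsilon>, y)) = v (\<epsilon>, y)"
          using arg_cong[OF idem, of "\<lambda>p. p (\<epsilon>, y)"] that y by (simp add: v_def)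
        show "v (\<epsilon>, \<omega> y) = v (\<epsilon>, y)"
          using that y \<omega> False by (simp add: v_app U)
      qed
      then have "\<omega> (v (\<epsilon>, x)) = \<omega> x" using min vE that by blast
      then show ?thesis using that False U env_in[OF vE] by simp
    qed
    \<comment> \<open>The witness is \<open>U t\<close>, since
      \<open>U t s U = U v = U\<close>.\<close>
    have "mul U t \<in> env" using env_mul UE t by blast
    moreover have "mul U t (\<epsilon>, s (\<epsilon>, U (\<epsilon>, x))) = U (\<epsilon>, x)" if "finite \<epsilon>" "x \<in> M" for \<epsilon> x
      using that Uv[OF that] env_in[OF s] env_in[OF UE] by (simp add: v_app)
    ultimately show ?thesis by blast
  qed
  then have "uniform_idempotent z \<omega> U"
    unfolding uniform_idempotent_def by (intro conjI ballI \<omega> UE U)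
  then show ?thesis by blast
qed

section \<open>Moving a cube to its base point\<close>

context
  fixes z \<omega> U
  assumes z: "z \<in> M" and unif: "uniform_idempotent z \<omega> U"
begin

lemma U_env: "U \<in> env" and \<omega>_z: "\<omega> z = z"
  and \<omega>_\<omega>: "x \<in> M \<Longrightarrow> \<omega> (\<omega> x) = \<omega> x"
  and U_app: "finite \<epsilon> \<Longrightarrow> x \<in> M \<Longrightarrow> U (\<epsilon>, x) = (if \<epsilon> = {} then x else \<omega> x)"
  using unif unfolding uniform_idempotent_def by blast+

lemma U_z: "finite \<epsilon> \<Longrightarrow> U (\<epsilon>, z) = z"
  using U_app z \<omega>_z by simp

text \<open>At points fixed by \<omega> the map \<open>U\<close> is the identity at every vertex and
  drops out of the return property. One \<open>r\<close> serves all these points and all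
  vertices.\<close>

lemma return:
  assumes "s \<in> env"
  shows "\<exists>r\<in>env. \<forall>\<epsilon> x. finite \<epsilon> \<longrightarrow> x \<in> M \<longrightarrow> \<omega> x = x \<longrightarrow> r (\<epsilon>, s (\<epsilon>, x)) = x"
proof -
  obtain r where r: "r \<in> env" "\<forall>\<epsilon> x. finite \<epsilon> \<longrightarrow> x \<in> M \<longrightarrow> r (\<epsilon>, s (\<epsilon>, U (\<epsilon>, x))) = U (\<epsilon>, x)"
    using unif assms unfolding uniform_idempotent_def by blast
  have "r (\<epsilon>, s (\<epsilon>, x)) = x" if "finite \<epsilon>" "x \<in> M" "\<omega> x = x" for \<epsilon> x
  proof -
    have "U (\<epsilon>, x) = x" using U_app that by simp
    then show ?thesis using r(2) that by metis
  qed
  then show ?thesis using r(1) by blast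
qed

lemma return_z:
  assumes "s \<in> env"
  shows "\<exists>r\<in>env. \<forall>\<epsilon>. finite \<epsilon> \<longrightarrow> r (\<epsilon>, s (\<epsilon>, z)) = z"
  using return[OF assms] z \<omega>_z by blast

text \<open>The cubes \<open>s\<^sub>1 z\<close> and \<open>s\<^sub>2 z\<close>, obtained from \<open>s z\<close> by diagonal embeddings, differ only in
  the top vertex, so the \<open>\<tau>\<close> that makes the first one constant makes the second one constant up to
  the top vertex. There \<open>\<tau>\<close> fixes \<open>z\<close>, so undoing it on the facet \<open>i\<close> does not disturb the
  other vertices.\<close>
lemma env_top_vertex:
  assumes D: "finite D" "D \<noteq> {}" "j \<notin> D" and s: "s \<in> env"
    and low: "\<And>\<epsilon>. \<epsilon> \<subset> D \<Longrightarrow> s (insert j \<epsilon>, z) = z"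
    and top: "s (insert j D, z) = b" and b: "\<omega> b = b"
  obtains s' where "s' \<in> env" "\<And>\<epsilon>. \<epsilon> \<subset> D \<Longrightarrow> s' (\<epsilon>, z) = z" "s' (D, z) = b"
proof -
  obtain i where i: "i \<in> D" using D by auto
  let ?D = "D - {i}"
  have bM: "b \<in> M" using env_in[OF s] D z top by auto
  have fin: "finite \<epsilon>" if "\<epsilon> \<subseteq> D" for \<epsilon> using that D finite_subset by blast
  \<comment> \<open>\<open>?s1\<close> replaces \<open>i\<close> by \<open>j\<close>, while
    \<open>?s2\<close> lets \<open>i\<close> move both. At a vertex containing \<open>i\<close> both
    therefore read \<open>s\<close> on the face of \<open>j\<close>, where only the top value can
    differ from \<open>z\<close>.\<close>
  let ?s1 = "pb (\<lambda>\<epsilon>. (\<epsilon> \<inter> ?D) \<union> (if i \<in> \<epsilon> then {j} else {})) s"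
  let ?s2 = "pb (\<lambda>\<epsilon>. (\<epsilon> \<inter> ?D) \<union> (if i \<in> \<epsilon> then {i, j} else {})) s"
  have s12: "?s1 \<in> env" "?s2 \<in> env"
    by (rule env_pb[OF dir_map_replace s]; use D i in auto)+
  have s1: "?s1 (\<epsilon>, z) = (if i \<in> \<epsilon> then z else s (\<epsilon>, z))" if "\<epsilon> \<subseteq> D" for \<epsilon>
  proof (cases "i \<in> \<epsilon>")
    case True
    have "\<epsilon> \<inter> ?D \<union> {j} = insert j (\<epsilon> - {i})" using that by auto
    moreover have "\<epsilon> - {i} \<subset> D" using that i by auto
    ultimately show ?thesis using True fin[OF that] z low by simp
  next
    case False
    then have "\<epsilon> \<inter> ?D = \<epsilon>" using that by auto
    then show ?thesis using False fin[OF that] z by simp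
  qed
  have s2: "?s2 (\<epsilon>, z) = (if \<epsilon> = D then b else if i \<in> \<epsilon> then z else s (\<epsilon>, z))" if "\<epsilon> \<subseteq> D" for \<epsilon>
  proof (cases "i \<in> \<epsilon>")
    case True
    have "\<epsilon> \<inter> ?D \<union> {i, j} = insert j \<epsilon>" using that True by auto
    then show ?thesis using True fin[OF that] z low[of \<epsilon>] top that by auto
  next
    case False
    then have "\<epsilon> \<inter> ?D = \<epsilon>" "\<epsilon> \<noteq> D" using that i by auto
    then show ?thesis using False fin[OF that] z by simp
  qed
  obtain k0 where k0: "k0 \<in> env" "\<forall>\<epsilon>. finite \<epsilon> \<longrightarrow> k0 (\<epsilon>, s (\<epsilon>, z)) = z"
    using return_z[OF s] by blast
  let ?k = "pb (\<lambda>\<epsilon>. \<epsilon> - {i}) k0"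
  have k: "?k \<in> env" by (rule env_pb[OF dir_map_Diff k0(1)])
  have k_s: "?k (\<epsilon>, s (\<epsilon>, z)) = z" if "\<epsilon> \<subseteq> D" "i \<notin> \<epsilon>" for \<epsilon>
    using that fin[OF that(1)] k0(2) env_in[OF s _ z] by simp
  obtain \<sigma> where \<sigma>: "\<sigma> \<in> env" "\<forall>\<epsilon>. finite \<epsilon> \<longrightarrow> \<sigma> (\<epsilon>, mul ?k ?s1 (\<epsilon>, z)) = z"
    using return_z[OF env_mul[OF k s12(1)]] by blast
  let ?\<tau> = "mul \<sigma> ?k"
  have \<tau>: "?\<tau> \<in> env" using env_mul \<sigma> k by blast
  have \<tau>1: "?\<tau> (\<epsilon>, ?s1 (\<epsilon>, z)) = z" if "\<epsilon> \<subseteq> D" for \<epsilon>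
    using \<sigma>(2)[rule_format, OF fin[OF that]] fin[OF that] env_in[OF s12(1) _ z] z by simp
  have \<tau>D: "?\<tau> (D, z) = z" using \<tau>1[of D] s1[of D] i by simp
  have \<tau>2: "?\<tau> (\<epsilon>, ?s2 (\<epsilon>, z)) = (if \<epsilon> = D then ?\<tau> (D, b) else z)" if "\<epsilon> \<subseteq> D" for \<epsilon>
    using \<tau>1[OF that] s1[OF that] s2[OF that] by (auto split: if_splits)
  \<comment> \<open>This \<open>r\<close> also returns \<open>b\<close>, because \<omega> fixes
    \<open>b\<close>. Only its action at the vertex \<open>D\<close> is used, spread over the facet
    of \<open>i\<close>; off that facet the pullback reads the empty vertex and does
    nothing.\<close>
  obtain r where r: "r \<in> env"
    "\<forall>\<epsilon> x. finite \<epsilon> \<longrightarrow> x \<in> M \<longrightarrow> \<omega> x = x \<longrightarrow> r (\<epsilon>, ?\<tau> (\<epsilon>, x)) = x"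
    using return[OF \<tau>] by blast
  let ?\<gamma> = "pb (\<lambda>\<epsilon>. if i \<in> \<epsilon> then D else {}) r"
  have \<gamma>: "?\<gamma> \<in> env" by (rule env_pb[OF dir_map_facet r(1)]) (rule D)
  have rz: "r (D, z) = z" using r(2)[rule_format, OF D(1) z \<omega>_z] unfolding \<tau>D .
  have rb: "r (D, ?\<tau> (D, b)) = b" using r(2) D bM b by blast
  let ?s' = "mul ?\<gamma> (mul ?\<tau> ?s2)"
  have s': "?s' (\<epsilon>, z) = (if \<epsilon> = D then b else z)" if "\<epsilon> \<subseteq> D" for \<epsilon>
  proof -
    have "?\<tau> (D, b) \<in> M" by (rule env_in[OF \<tau> D(1) bM])
    then have "?s' (\<epsilon>, z) = ?\<gamma> (\<epsilon>, if \<epsilon> = D then ?\<tau> (D, b) else z)"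
      using \<tau>2[OF that] fin[OF that] z by simp
    also have "\<dots> = (if \<epsilon> = D then b else z)"
      using fin[OF that] z rz rb env_empty[OF r(1) z] i \<open>?\<tau> (D, b) \<in> M\<close> by auto
    finally show ?thesis .
  qed
  show ?thesis
    by (rule that[of ?s']) (use s' env_mul \<gamma> \<tau> s12 in auto)
qed

text \<open>The vertices are moved to \<open>z\<close> one at a time; applying \<open>r\<close> at \<open>\<epsilon> \<inter> D\<close> keeps those already moved.\<close>
lemma env_move_down_set:
  assumes t: "t \<in> env" and base: "t ({j}, z) = z"
    and V: "finite V" "\<And>\<epsilon>. \<epsilon> \<in> V \<Longrightarrow> finite \<epsilon> \<and> j \<notin> \<epsilon>" "\<And>\<epsilon> \<eta>. \<epsilon> \<in> V \<Longrightarrow> \<eta> \<subseteq> \<epsilon> \<Longrightarrow> \<eta> \<in> V"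
  shows "\<exists>s\<in>env. \<forall>\<epsilon>\<in>V. s (\<epsilon>, t (insert j \<epsilon>, z)) = z"
  using V
proof (induction "card V" arbitrary: V)
  case 0
  then show ?case using gen_env by auto
next
  case (Suc k)
  then have "V \<noteq> {}" by auto
  \<comment> \<open>Removing a maximal vertex leaves a family that is still closed under
    subsets.\<close>
  then obtain D where D: "D \<in> V" "\<And>\<epsilon>. \<epsilon> \<in> V \<Longrightarrow> D \<subseteq> \<epsilon> \<Longrightarrow> \<epsilon> = D"
    using finite_has_maximal[OF Suc.prems(1)] by metis
  have fin: "finite \<epsilon>" "j \<notin> \<epsilon>" if "\<epsilon> \<in> V" for \<epsilon> using Suc.prems(2) that by auto
  have tM: "t (insert j \<epsilon>, z) \<in> M" if "\<epsilon> \<in> V" for \<epsilon> using env_in[OF t _ z] fin[OF that] by simp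
  have "\<exists>s\<in>env. \<forall>\<epsilon>\<in>V - {D}. s (\<epsilon>, t (insert j \<epsilon>, z)) = z"
  proof (rule Suc.hyps(1))
    show "k = card (V - {D})" using Suc.hyps(2) Suc.prems(1) D(1) by simp
    show "\<eta> \<in> V - {D}" if "\<epsilon> \<in> V - {D}" "\<eta> \<subseteq> \<epsilon>" for \<epsilon> \<eta>
      using that Suc.prems(3)[of \<epsilon> \<eta>] D(2)[of \<epsilon>] by auto
  qed (use Suc.prems in auto)
  then obtain s0 where s0: "s0 \<in> env" "\<And>\<epsilon>. \<epsilon> \<in> V - {D} \<Longrightarrow> s0 (\<epsilon>, t (insert j \<epsilon>, z)) = z" by blast
  show ?case
  proof (cases "D = {}")
    case True
    then have "V = {{}}" using Suc.prems(3) D by blast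
    then show ?thesis using s0(1) env_empty[OF s0(1)] base z by auto
  next
    case False
    \<comment> \<open>Applying \<open>U\<close> keeps the values that are already \<open>z\<close>
      and makes the remaining value at \<open>D\<close> a fixed point of \<omega>, from which a
      return is possible.\<close>
    let ?s = "mul U s0"
    have s: "?s \<in> env" using env_mul U_env s0 by blast
    have s_z: "?s (\<epsilon>, t (insert j \<epsilon>, z)) = z" if "\<epsilon> \<in> V" "\<epsilon> \<noteq> D" for \<epsilon>
      using that s0(2)[of \<epsilon>] fin[OF that(1)] tM[OF that(1)] U_z by simp
    define b where "b = ?s (D, t (insert j D, z))"
    have bM: "b \<in> M" unfolding b_def by (rule env_in[OF s]) (use fin tM D in auto)
    have b: "\<omega> b = b"
      unfolding b_def using fin tM D False env_in[OF s0(1)] by (simp add: U_app \<omega>_\<omega>)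
    \<comment> \<open>Dropping \<open>j\<close> lets \<open>?s\<close> act on the face of
      \<open>j\<close> with the directions of \<epsilon> alone. On that face \<open>?p\<close> has
      the value \<open>z\<close> strictly below \<open>D\<close> and \<open>b\<close> at
      \<open>D\<close>.\<close>
    let ?p = "mul (pb (\<lambda>\<epsilon>. \<epsilon> - {j}) ?s) t"
    have p: "?p \<in> env" using env_mul env_pb[OF dir_map_Diff s] t by blast
    have p_app: "?p (insert j \<epsilon>, z) = ?s (\<epsilon>, t (insert j \<epsilon>, z))" if "\<epsilon> \<in> V" for \<epsilon>
    proof -
      have "insert j \<epsilon> - {j} = \<epsilon>" using fin[OF that] by auto
      then show ?thesis using fin[OF that] tM[OF that] z by simp
    qed
    obtain s' where s': "s' \<in> env" "\<And>\<epsilon>. \<epsilon> \<subset> D \<Longrightarrow> s' (\<epsilon>, z) = z" "s' (D, z) = b"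
    proof (rule env_top_vertex[of D j ?p b])
      show "?p (insert j \<epsilon>, z) = z" if "\<epsilon> \<subset> D" for \<epsilon>
        using that p_app s_z Suc.prems(3)[OF D(1)] by (metis psubsetE)
    qed (use fin[OF D(1)] False p b p_app[OF D(1)] in \<open>auto simp: b_def\<close>)
    obtain r where r: "r \<in> env" "\<forall>\<epsilon>. finite \<epsilon> \<longrightarrow> r (\<epsilon>, s' (\<epsilon>, z)) = z"
      using return_z[OF s'(1)] by blast
    have r_low: "r (\<epsilon>, z) = z" if "\<epsilon> \<subset> D" for \<epsilon>
      using r(2)[rule_format, of \<epsilon>] s'(2)[OF that] that fin(1)[OF D(1)]
      by (metis finite_subset psubset_imp_subset)
    have r_top: "r (D, b) = z" using r(2)[rule_format, OF fin(1)[OF D(1)]] s'(3) by simp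
    let ?q = "mul (pb (\<lambda>\<epsilon>. \<epsilon> \<inter> D) r) ?s"
    have "?q \<in> env" using env_mul env_pb[OF dir_map_Int r(1)] s by blast
    moreover have "?q (\<epsilon>, t (insert j \<epsilon>, z)) = z" if \<epsilon>: "\<epsilon> \<in> V" for \<epsilon>
    proof (cases "\<epsilon> = D")
      case True
      have "?q (D, t (insert j D, z)) = pb (\<lambda>\<epsilon>. \<epsilon> \<inter> D) r (D, b)"
        using fin[OF D(1)] tM[OF D(1)] by (simp only: mul_app b_def)
      then show ?thesis using True fin[OF D(1)] bM r_top by simp
    next
      case False
      have "\<epsilon> \<inter> D \<subset> D" using False D(2)[OF \<epsilon>] by auto
      then have "pb (\<lambda>\<epsilon>. \<epsilon> \<inter> D) r (\<epsilon>, z) = z" using fin[OF \<epsilon>] z r_low by simp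
      moreover have "?q (\<epsilon>, t (insert j \<epsilon>, z)) = pb (\<lambda>\<epsilon>. \<epsilon> \<inter> D) r (\<epsilon>, ?s (\<epsilon>, t (insert j \<epsilon>, z)))"
        using fin[OF \<epsilon>] tM[OF \<epsilon>] by (simp only: mul_app)
      ultimately show ?thesis using s_z[OF \<epsilon> False] by simp
    qed
    ultimately show ?thesis by blast
  qed
qed

end

text \<open>Direction \<open>j\<close> serves to move the base point: the values of \<open>t\<close>
  at the vertices containing \<open>j\<close> form a cube based at \<open>t ({j}, z)\<close>, which
  is \<open>z\<close> here. The moving element \<open>s\<close> acts in the other directions
  only.\<close>

lemma env_move_to_base:
  assumes "z \<in> M" "t \<in> env" "t ({j}, z) = z" "finite D" "j \<notin> D"
  shows "\<exists>s\<in>env. \<forall>\<epsilon>\<subseteq>D. s (\<epsilon>, t (insert j \<epsilon>, z)) = z"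
proof -
  obtain \<omega> U where "uniform_idempotent z \<omega> U"
    using ex_uniform_idempotent_return[OF assms(1)] by auto
  then have "\<exists>s\<in>env. \<forall>\<epsilon>\<in>Pow D. s (\<epsilon>, t (insert j \<epsilon>, z)) = z"
    by (rule env_move_down_set[OF assms(1) _ assms(2,3)]) (use assms finite_subset in auto)
  then show ?thesis by auto
qed

end

section \<open>Cubes and the regionally proximal relation of order infinity\<close>

definition corner :: "nat \<Rightarrow> nat set \<Rightarrow> 'a \<Rightarrow> 'a \<Rightarrow> nat set \<Rightarrow> 'a" where
  "corner d \<delta> x y = (\<lambda>\<epsilon>\<in>cube_index d. if \<epsilon> = \<delta> then x else y)"

lemma finite_cube_index: "\<epsilon> \<in> cube_index d \<Longrightarrow> finite \<epsilon>"
  using finite_subset by auto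

lemma continuous_into_cube_space:
  assumes "\<And>\<epsilon>. \<epsilon> \<in> cube_index d \<Longrightarrow> continuous_map Z X (\<lambda>z. f z \<epsilon>)"
    and "\<And>z. z \<in> topspace Z \<Longrightarrow> f z \<in> extensional (cube_index d)"
  shows "continuous_map Z (cube_space d X) f"
  unfolding cube_space_def continuous_map_componentwise using assms by auto

lemma continuous_cube_coord:
  "\<epsilon> \<in> cube_index d \<Longrightarrow> continuous_map (cube_space d X) X (\<lambda>c. c \<epsilon>)"
  unfolding cube_space_def by (rule continuous_map_product_projection)

context compact_tds
begin

lemma compact_cube_space: "compact_space (cube_space d X)"
  and Hausdorff_cube_space: "Hausdorff_space (cube_space d X)"
  by (simp_all add: cube_space_def compact_space_product_topology compact
      Hausdorff_space_product_topology Hausdorff)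

lemma face_point_in: "x \<in> M \<Longrightarrow> face_point d X S n x \<in> topspace (cube_space d X)"
  by (auto simp: face_point_def topspace_cube_space T_in)

lemma face_point_cubes: "x \<in> M \<Longrightarrow> face_point d X S n x \<in> cubes d X S"
  unfolding cubes_def by (rule set_mp[OF closure_of_subset]) (use face_point_in in auto)

lemma closedin_cubes: "closedin (cube_space d X) (cubes d X S)"
  by (simp add: cubes_def)

lemma cubes_in: "c \<in> cubes d X S \<Longrightarrow> c \<in> cube_index d \<rightarrow>\<^sub>E M"
  using closedin_subset[OF closedin_cubes] unfolding topspace_cube_space by blast

lemma cubes_minimal:
  assumes "closedin (cube_space d X) B" "\<And>n x. x \<in> M \<Longrightarrow> face_point d X S n x \<in> B"
  shows "cubes d X S \<subseteq> B"
  unfolding cubes_def by (rule closure_of_minimal) (use assms in auto)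

lemma cubes_map:
  assumes "continuous_map (cube_space d X) (cube_space e X) \<Phi>"
    and "\<And>n x. x \<in> M \<Longrightarrow> \<Phi> (face_point d X S n x) \<in> cubes e X S" "c \<in> cubes d X S"
  shows "\<Phi> c \<in> cubes e X S"
proof -
  have "cubes d X S \<subseteq> {c \<in> topspace (cube_space d X). \<Phi> c \<in> cubes e X S}"
    by (rule cubes_minimal[OF closedin_continuous_map_preimage[OF assms(1) closedin_cubes]])
      (use assms(2) face_point_in in auto)
  then show ?thesis using assms(3) by auto
qed

lemma continuous_face_point: "continuous_map X (cube_space d X) (\<lambda>x. face_point d X S n x)"
  by (rule continuous_into_cube_space) (auto simp: face_point_def cont_T)

lemma cubes_act:
  assumes "c \<in> cubes d X S"
  shows "(\<lambda>\<epsilon>\<in>cube_index d. T (m + sum n \<epsilon>) (c \<epsilon>)) \<in> cubes d X S"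
proof (rule cubes_map[OF _ _ assms])
  show "continuous_map (cube_space d X) (cube_space d X) (\<lambda>c. \<lambda>\<epsilon>\<in>cube_index d. T (m + sum n \<epsilon>) (c \<epsilon>))"
  proof (rule continuous_into_cube_space)
    fix \<epsilon> assume \<epsilon>: "\<epsilon> \<in> cube_index d"
    then show "continuous_map (cube_space d X) X (\<lambda>c. (\<lambda>\<epsilon>\<in>cube_index d. T (m + sum n \<epsilon>) (c \<epsilon>)) \<epsilon>)"
      using continuous_map_compose[OF continuous_cube_coord[OF \<epsilon>] cont_T] by (simp add: comp_def)
  qed auto
  fix k x assume x: "x \<in> M"
  have "T (m + sum n \<epsilon>) (T (sum k \<epsilon>) x) = T (sum (\<lambda>i. n i + k i) \<epsilon>) (T m x)" for \<epsilon>
    using x by (simp add: T_add[symmetric] T_in sum.distrib algebra_simps)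
  then have "(\<lambda>\<epsilon>\<in>cube_index d. T (m + sum n \<epsilon>) (face_point d X S k x \<epsilon>)) =
    face_point d X S (\<lambda>i. n i + k i) (T m x)"
    by (auto simp: face_point_def fun_eq_iff)
  then show "(\<lambda>\<epsilon>\<in>cube_index d. T (m + sum n \<epsilon>) (face_point d X S k x \<epsilon>)) \<in> cubes d X S"
    using face_point_cubes T_in x by simp
qed

text \<open>Reflection in the directions of \<delta>: a face point is read from the vertex \<delta>
  instead of the empty one, which negates \<open>n\<close> on \<delta> and makes
  \<open>T (sum n \<delta>) x\<close> the base point.\<close>

lemma cubes_reflect:
  assumes "c \<in> cubes d X S" and \<delta>: "\<delta> \<in> cube_index d"
  shows "(\<lambda>\<epsilon>\<in>cube_index d. c ((\<epsilon> - \<delta>) \<union> (\<delta> - \<epsilon>))) \<in> cubes d X S"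
proof (rule cubes_map[OF _ _ assms(1)])
  show "continuous_map (cube_space d X) (cube_space d X)
    (\<lambda>c. \<lambda>\<epsilon>\<in>cube_index d. c ((\<epsilon> - \<delta>) \<union> (\<delta> - \<epsilon>)))"
    by (rule continuous_into_cube_space) (use \<delta> in \<open>auto intro!: continuous_cube_coord\<close>)
  fix n :: "nat \<Rightarrow> int" and x assume x: "x \<in> M"
  define m :: "nat \<Rightarrow> int" where "m i = (if i \<in> \<delta> then - n i else n i)" for i
  have "sum n ((\<epsilon> - \<delta>) \<union> (\<delta> - \<epsilon>)) = sum m \<epsilon> + sum n \<delta>" if "\<epsilon> \<in> cube_index d" for \<epsilon>
  proof -
    have f: "finite \<epsilon>" "finite \<delta>" using that \<delta> finite_cube_index by blast+
    have "sum n ((\<epsilon> - \<delta>) \<union> (\<delta> - \<epsilon>)) = sum n (\<epsilon> - \<delta>) + sum n (\<delta> - \<epsilon>)"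
      using f by (intro sum.union_disjoint) auto
    moreover have "sum m \<epsilon> = sum n (\<epsilon> - \<delta>) - sum n (\<epsilon> \<inter> \<delta>)"
    proof -
      have "sum m \<epsilon> = sum m (\<epsilon> \<inter> \<delta>) + sum m (\<epsilon> - \<delta>)" using f by (metis sum.Int_Diff)
      also have "sum m (\<epsilon> \<inter> \<delta>) = - sum n (\<epsilon> \<inter> \<delta>)"
        by (auto simp: m_def sum_negf[symmetric] intro: sum.cong)
      also have "sum m (\<epsilon> - \<delta>) = sum n (\<epsilon> - \<delta>)" by (auto simp: m_def intro: sum.cong)
      finally show ?thesis by simp
    qed
    moreover have "sum n \<delta> = sum n (\<epsilon> \<inter> \<delta>) + sum n (\<delta> - \<epsilon>)"
      using f by (metis sum.Int_Diff inf_commute)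
    ultimately show ?thesis by simp
  qed
  note sum_eq = this
  have "(\<lambda>\<epsilon>\<in>cube_index d. face_point d X S n x ((\<epsilon> - \<delta>) \<union> (\<delta> - \<epsilon>))) =
    face_point d X S m (T (sum n \<delta>) x)"
    unfolding face_point_def[of d X S m]
  proof (rule restrict_ext)
    fix \<epsilon> assume \<epsilon>: "\<epsilon> \<in> cube_index d"
    then have "(\<epsilon> - \<delta>) \<union> (\<delta> - \<epsilon>) \<in> cube_index d" using \<delta> by auto
    then show "face_point d X S n x ((\<epsilon> - \<delta>) \<union> (\<delta> - \<epsilon>)) = T (sum m \<epsilon>) (T (sum n \<delta>) x)"
      by (simp only: face_point_def restrict_apply if_True sum_eq[OF \<epsilon>] T_add[OF x])
  qed
  then show "(\<lambda>\<epsilon>\<in>cube_index d. face_point d X S n x ((\<epsilon> - \<delta>) \<union> (\<delta> - \<epsilon>))) \<in> cubes d X S"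
    using face_point_cubes T_in x by simp
qed

lemma corner_cubes_vertex:
  assumes "corner d {} x y \<in> cubes d X S" "\<delta> \<in> cube_index d"
  shows "corner d \<delta> x y \<in> cubes d X S"
proof -
  have "(\<lambda>\<epsilon>\<in>cube_index d. corner d {} x y ((\<epsilon> - \<delta>) \<union> (\<delta> - \<epsilon>))) = corner d \<delta> x y"
    unfolding corner_def
  proof (rule restrict_ext)
    fix \<epsilon> assume "\<epsilon> \<in> cube_index d"
    then have "(\<epsilon> - \<delta>) \<union> (\<delta> - \<epsilon>) \<in> cube_index d" using assms(2) by auto
    moreover have "(\<epsilon> - \<delta>) \<union> (\<delta> - \<epsilon>) = {} \<longleftrightarrow> \<epsilon> = \<delta>" by auto
    ultimately show "(\<lambda>\<epsilon>\<in>cube_index d. if \<epsilon> = {} then x else y) (\<epsilon> - \<delta> \<union> (\<delta> - \<epsilon>)) = (if \<epsilon> = \<delta> then x else y)"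
      by simp
  qed
  then show ?thesis using cubes_reflect[OF assms] by simp
qed

end

text \<open>Symmetry is obtained by swapping the two nets of the definition; the description by
  corners, which gives \<open>x\<close> and \<open>y\<close> different roles, would not show
  it.\<close>

lemma RP_sym: assumes "(x, y) \<in> RP k X S" shows "(y, x) \<in> RP k X S"
proof -
  from assms obtain F :: "((nat set \<Rightarrow> int) \<times> 'a \<times> 'a) filter" and p q where F: "F \<noteq> bot"
    "\<forall>\<^sub>F (f, x', y') in F. f \<in> face_group k \<and> x' \<in> topspace X \<and> y' \<in> topspace X"
    "limitin (cube_space k X) (\<lambda>(f, x', y'). cube_act k X S f (diag k x')) p F"
    "limitin (cube_space k X) (\<lambda>(f, x', y'). cube_act k X S f (diag k y')) q F"
    "p {} = x" "q {} = y" "\<forall>\<epsilon>\<in>cube_index k - {{}}. p \<epsilon> = q \<epsilon>"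
    unfolding RP_def by blast
  let ?s = "\<lambda>(f, x', y'). (f, y', x')"
  let ?F = "filtermap ?s F"
  have "?F \<noteq> bot" using F(1) by (simp add: filtermap_bot_iff)
  moreover have "\<forall>\<^sub>F (f, x', y') in ?F. f \<in> face_group k \<and> x' \<in> topspace X \<and> y' \<in> topspace X"
    using F(2) by (auto simp: eventually_filtermap case_prod_beta elim: eventually_mono)
  moreover have "limitin (cube_space k X) (\<lambda>(f, x', y'). cube_act k X S f (diag k x')) q ?F"
    using F(4) by (simp add: limitin_def eventually_filtermap case_prod_beta)
  moreover have "limitin (cube_space k X) (\<lambda>(f, x', y'). cube_act k X S f (diag k y')) p ?F"
    using F(3) by (simp add: limitin_def eventually_filtermap case_prod_beta)
  moreover have "\<forall>\<epsilon>\<in>cube_index k - {{}}. q \<epsilon> = p \<epsilon>" using F(7) by simp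
  ultimately show ?thesis unfolding RP_def mem_Collect_eq prod.case
    using F(5,6) by (intro exI[of _ ?F] exI[of _ q] exI[of _ p] conjI)
qed

section \<open>Cubes as values of the enveloping semigroup; regional proximality through
  corners\<close>

context minimal_compact_tds
begin

text \<open>The face in the additional direction 0, whose exponent moves the base point. Cubes with
  all base points thus arise from a single \<open>z\<close>.\<close>

definition upper :: "nat \<Rightarrow> 'a \<Rightarrow> (nat set \<times> 'a \<Rightarrow> 'a) \<Rightarrow> nat set \<Rightarrow> 'a" where
  "upper d z t = (\<lambda>\<epsilon>\<in>cube_index d. t (insert 0 \<epsilon>, z))"

lemma continuous_upper: "z \<in> M \<Longrightarrow> continuous_map coord_space (cube_space d X) (upper d z)"
  by (rule continuous_into_cube_space)
    (auto simp: upper_def finite_cube_index intro!: continuous_eval)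

lemma upper_gen:
  assumes "z \<in> M" shows "upper d z (gen n) = face_point d X S n (T (n 0) z)"
  unfolding upper_def face_point_def
proof (rule restrict_ext)
  fix \<epsilon> assume "\<epsilon> \<in> cube_index d"
  then have "finite \<epsilon>" "0 \<notin> \<epsilon>" using finite_cube_index by auto
  then show "gen n (insert 0 \<epsilon>, z) = T (sum n \<epsilon>) (T (n 0) z)"
    using assms by (simp add: T_add[symmetric] algebra_simps)
qed

lemma face_point_orbit:
  assumes "z \<in> M" shows "face_point d X S n (T m z) = upper d z (gen (n(0 := m)))"
proof -
  have "sum (n(0 := m)) \<epsilon> = sum n \<epsilon>" if "\<epsilon> \<in> cube_index d" for \<epsilon>
    using that by (intro sum.cong) auto
  then show ?thesis using assms by (auto simp: upper_gen face_point_def)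
qed

text \<open>Both sides are closed. A face point based at \<open>T m z\<close> is a value of
  \<open>upper\<close> with \<open>m\<close> spent in direction 0, and by minimality these base
  points are dense.\<close>

lemma cubes_eq_upper:
  assumes z: "z \<in> M" shows "cubes d X S = upper d z ` env"
proof
  have "upper d z t \<in> cubes d X S" if "t \<in> env" for t
    by (rule env_minimal[where P = "\<lambda>t. upper d z t \<in> cubes d X S", OF _ _ that])
      (use z upper_gen face_point_cubes T_in in
        \<open>auto intro!: closedin_continuous_map_preimage[OF continuous_upper closedin_cubes]\<close>)
  then show "upper d z ` env \<subseteq> cubes d X S" by auto
  have cl: "closedin (cube_space d X) (upper d z ` env)"
    using T1_Spaces.continuous_imp_closed_map[OF continuous_upper[OF z] compact_coord_space Hausdorff_cube_space]
      closedin_env by (simp add: closed_map_def)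
  show "cubes d X S \<subseteq> upper d z ` env"
  proof (rule cubes_minimal[OF cl])
    fix n x assume "x \<in> M"
    moreover have "M \<subseteq> {x \<in> M. face_point d X S n x \<in> upper d z ` env}"
      by (rule orbit_dense[OF closedin_continuous_map_preimage[OF continuous_face_point cl] z])
        (use face_point_orbit z gen_env T_in in auto)
    ultimately show "face_point d X S n x \<in> upper d z ` env" by auto
  qed
qed

lemma cubes_env:
  assumes c: "c \<in> cubes d X S" and s: "s \<in> env"
  shows "(\<lambda>\<epsilon>\<in>cube_index d. s (\<epsilon>, c \<epsilon>)) \<in> cubes d X S"
proof -
  define z where "z = c {}"
  have z: "z \<in> M" using cubes_in[OF c] by (auto simp: z_def)
  then obtain t where t: "t \<in> env" "c = upper d z t" using c cubes_eq_upper by blast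
  \<comment> \<open>Deleting 0 from the vertex keeps \<open>s\<close> from moving the base
    point.\<close>
  have "(\<lambda>\<epsilon>\<in>cube_index d. s (\<epsilon>, c \<epsilon>)) = upper d z (mul (pb (\<lambda>\<epsilon>. \<epsilon> - {0}) s) t)"
    unfolding upper_def
  proof (rule restrict_ext)
    fix \<epsilon> assume \<epsilon>: "\<epsilon> \<in> cube_index d"
    then have "c \<epsilon> = t (insert 0 \<epsilon>, z)" unfolding t(2) by (simp add: upper_def)
    moreover have "insert 0 \<epsilon> - {0} = \<epsilon>" using \<epsilon> by auto
    ultimately show "s (\<epsilon>, c \<epsilon>) = mul (pb (\<lambda>\<epsilon>. \<epsilon> - {0}) s) t (insert 0 \<epsilon>, z)"
      using finite_cube_index[OF \<epsilon>] z env_in[OF t(1)] by simp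
  qed
  moreover have "mul (pb (\<lambda>\<epsilon>. \<epsilon> - {0}) s) t \<in> env"
    using env_mul env_pb[OF dir_map_Diff s] t by blast
  ultimately show ?thesis using cubes_eq_upper[OF z] by blast
qed

lemma cubes_move_to_base:
  assumes c: "c \<in> cubes d X S"
  shows "\<exists>s\<in>env. \<forall>\<epsilon>\<in>cube_index d. s (\<epsilon>, c \<epsilon>) = c {}"
proof -
  define z where "z = c {}"
  have z: "z \<in> M" using cubes_in[OF c] by (auto simp: z_def)
  then obtain t where t: "t \<in> env" "c = upper d z t" using c cubes_eq_upper by blast
  have t_app: "c \<epsilon> = t (insert 0 \<epsilon>, z)" if "\<epsilon> \<in> cube_index d" for \<epsilon>
    unfolding t(2) using that by (simp add: upper_def)
  have "t ({0}, z) = z" using t_app[of "{}"] by (simp add: z_def)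
  from env_move_to_base[OF z t(1) this, of "{1..d}"]
  show ?thesis using t_app by (auto simp: z_def[symmetric])
qed

text \<open>The two cubes, moved by the same \<open>n\<close>, are opposite faces of a cube of one
  more dimension: direction 0 leads from \<open>z\<close> to the first base point, and
  \<open>Suc k\<close> from the first base point to the second. Density of the orbit of
  \<open>z\<close> then frees the base points one after the other.\<close>

lemma face_point_pair_closed:
  assumes z: "z \<in> M" and B: "closedin (prod_topology (cube_space k X) (cube_space k X)) B"
    and gen: "\<And>n. (upper k z (gen n), \<lambda>\<epsilon>\<in>cube_index k. gen n (insert 0 (insert (Suc k) \<epsilon>), z)) \<in> B"
    and xy: "x \<in> M" "y \<in> M"
  shows "(face_point k X S n x, face_point k X S n y) \<in> B"
proof -
  let ?Z = "cube_space k X"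
  have base: "(face_point k X S n (T a z), face_point k X S n (T b z)) \<in> B" for a b
  proof -
    let ?m = "n(0 := a, Suc k := b - a)"
    have "upper k z (gen ?m) = face_point k X S ?m (T a z)" using upper_gen[OF z, of k ?m] by simp
    also have "\<dots> = face_point k X S n (T a z)"
      unfolding face_point_def
    proof (rule restrict_ext)
      fix \<epsilon> assume "\<epsilon> \<in> cube_index k"
      then have "sum ?m \<epsilon> = sum n \<epsilon>" by (intro sum.cong) auto
      then show "T (sum ?m \<epsilon>) (T a z) = T (sum n \<epsilon>) (T a z)" by simp
    qed
    moreover have "(\<lambda>\<epsilon>\<in>cube_index k. gen ?m (insert 0 (insert (Suc k) \<epsilon>), z)) = face_point k X S n (T b z)"
      unfolding face_point_def
    proof (rule restrict_ext)
      fix \<epsilon> assume \<epsilon>: "\<epsilon> \<in> cube_index k"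
      then have *: "finite \<epsilon>" "0 \<notin> \<epsilon>" "Suc k \<notin> \<epsilon>" using finite_cube_index by auto
      have "sum ?m \<epsilon> = sum n \<epsilon>" using \<epsilon> by (intro sum.cong) auto
      then have "sum ?m (insert 0 (insert (Suc k) \<epsilon>)) = sum n \<epsilon> + b"
        using * by (simp del: fun_upd_apply) simp
      then show "gen ?m (insert 0 (insert (Suc k) \<epsilon>), z) = T (sum n \<epsilon>) (T b z)"
        using * z T_add[OF z, of "sum n \<epsilon>" b] by (simp only: gen_app finite_insert)
    qed
    ultimately show ?thesis using gen[of ?m] by simp
  qed
  have cont: "continuous_map X (prod_topology ?Z ?Z) (\<lambda>y. (p, face_point k X S n y))"
    "continuous_map X (prod_topology ?Z ?Z) (\<lambda>y. (face_point k X S n y, p))"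
    if "p \<in> topspace ?Z" for p
    using that continuous_face_point by (auto simp: continuous_map_pairwise comp_def)
  have "(face_point k X S n (T a z), face_point k X S n y) \<in> B" for a
  proof -
    have "M \<subseteq> {y \<in> M. (face_point k X S n (T a z), face_point k X S n y) \<in> B}"
      by (rule orbit_dense[OF closedin_continuous_map_preimage[OF cont(1) B] z])
        (use base z T_in face_point_in in auto)
    then show ?thesis using xy by auto
  qed
  then have "M \<subseteq> {x \<in> M. (face_point k X S n x, face_point k X S n y) \<in> B}"
    by (intro orbit_dense[OF closedin_continuous_map_preimage[OF cont(2) B] z])
        (use z T_in xy face_point_in in auto)
  then show ?thesis using xy by auto
qed

text \<open>Both limits are opposite faces of a cube given by one element of \<open>env\<close>. The
  face \<open>q\<close> is based at \<open>y\<close>, so some \<open>s\<close> makes it constant.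
  Off the empty vertex \<open>p\<close> agrees with \<open>q\<close>, and at the empty vertex
  \<open>s\<close> does nothing, so the same \<open>s\<close> turns \<open>p\<close> into the
  corner.\<close>

lemma RP_imp_corner:
  assumes "(x, y) \<in> RP k X S"
  shows "x \<in> M" "y \<in> M" "corner k {} x y \<in> cubes k X S"
proof -
  let ?Z = "cube_space k X"
  from assms obtain F :: "((nat set \<Rightarrow> int) \<times> 'a \<times> 'a) filter" and p q where F: "F \<noteq> bot"
    "\<forall>\<^sub>F (f, x', y') in F. f \<in> face_group k \<and> x' \<in> topspace X \<and> y' \<in> topspace X"
    "limitin ?Z (\<lambda>(f, x', y'). cube_act k X S f (diag k x')) p F"
    "limitin ?Z (\<lambda>(f, x', y'). cube_act k X S f (diag k y')) q F"
    and pq: "p {} = x" "q {} = y" "\<forall>\<epsilon>\<in>cube_index k - {{}}. p \<epsilon> = q \<epsilon>"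
    unfolding RP_def by blast
  have pqM: "p \<in> cube_index k \<rightarrow>\<^sub>E M" "q \<in> cube_index k \<rightarrow>\<^sub>E M"
    using limitin_topspace[OF F(3)] limitin_topspace[OF F(4)] by (simp_all add: topspace_cube_space)
  show x: "x \<in> M" and y: "y \<in> M" using pqM pq by auto
  define \<Phi> where "\<Phi> t = (upper k y t, \<lambda>\<epsilon>\<in>cube_index k. t (insert 0 (insert (Suc k) \<epsilon>), y))" for t
  have "continuous_map coord_space ?Z (\<lambda>t. \<lambda>\<epsilon>\<in>cube_index k. t (insert 0 (insert (Suc k) \<epsilon>), y))"
    by (rule continuous_into_cube_space) (use y in \<open>auto simp: finite_cube_index intro!: continuous_eval\<close>)
  then have "continuous_map coord_space (prod_topology ?Z ?Z) \<Phi>"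
    using continuous_upper[OF y] by (auto simp: continuous_map_pairwise comp_def \<Phi>_def)
  moreover have "Hausdorff_space (prod_topology ?Z ?Z)"
    using Hausdorff_cube_space by (simp add: Hausdorff_space_prod_topology)
  ultimately have "closed_map coord_space (prod_topology ?Z ?Z) \<Phi>"
    using T1_Spaces.continuous_imp_closed_map compact_coord_space by blast
  then have B: "closedin (prod_topology ?Z ?Z) (\<Phi> ` env)" using closedin_env by (simp add: closed_map_def)
  have "(p, q) \<in> \<Phi> ` env"
  proof (rule limitin_closedin[OF _ B])
    show "limitin (prod_topology ?Z ?Z)
      (\<lambda>w. ((\<lambda>(f, x', y'). cube_act k X S f (diag k x')) w, (\<lambda>(f, x', y'). cube_act k X S f (diag k y')) w))
      (p, q) F"
      using F(3,4) by (simp add: limitin_pairwise comp_def)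
    show "\<forall>\<^sub>F w in F. ((\<lambda>(f, x', y'). cube_act k X S f (diag k x')) w,
      (\<lambda>(f, x', y'). cube_act k X S f (diag k y')) w) \<in> \<Phi> ` env"
      using F(2)
    proof (rule eventually_mono)
      fix w :: "(nat set \<Rightarrow> int) \<times> 'a \<times> 'a"
      assume "case w of (f, x', y') \<Rightarrow> f \<in> face_group k \<and> x' \<in> M \<and> y' \<in> M"
      then obtain f u v where w: "w = (f, u, v)" "f \<in> face_group k" "u \<in> M" "v \<in> M" by (cases w) auto
      then obtain n where n: "f = (\<lambda>\<epsilon>. if \<epsilon> \<in> cube_index k then sum n \<epsilon> else 0)"
        using face_group_iff by blast
      have "\<Phi> (gen m) \<in> \<Phi> ` env" for m using gen_env by blast
      then have "(face_point k X S n u, face_point k X S n v) \<in> \<Phi> ` env"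
        by (intro face_point_pair_closed[OF y B _ w(3,4)]) (simp only: \<Phi>_def)
      then show "((\<lambda>(f, x', y'). cube_act k X S f (diag k x')) w,
        (\<lambda>(f, x', y'). cube_act k X S f (diag k y')) w) \<in> \<Phi> ` env"
        by (simp only: w(1) prod.case cube_act_diag[OF n])
    qed
    show "\<not> trivial_limit F" using F(1) by simp
  qed
  then obtain t where t: "t \<in> env" "p = upper k y t"
    "q = (\<lambda>\<epsilon>\<in>cube_index k. t (insert 0 (insert (Suc k) \<epsilon>), y))"
    by (auto simp: \<Phi>_def)
  \<comment> \<open>Now 0 carries \<open>Suc k\<close> along, so \<open>q\<close> becomes the face
    of direction 0 and its base vertex has the value \<open>y\<close>.\<close>
  let ?t = "pb (\<lambda>\<epsilon>. (\<epsilon> \<inter> {1..k}) \<union> (if 0 \<in> \<epsilon> then {0, Suc k} else {})) t"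
  have tE: "?t \<in> env" by (rule env_pb[OF dir_map_replace t(1)]) auto
  have t_app: "?t (insert 0 \<epsilon>, y) = q \<epsilon>" if "\<epsilon> \<in> cube_index k" for \<epsilon>
  proof -
    have "insert 0 \<epsilon> \<inter> {1..k} \<union> {0, Suc k} = insert 0 (insert (Suc k) \<epsilon>)" using that by auto
    then show ?thesis using that y finite_cube_index[OF that] by (simp add: t(3) del: Pow_iff)
  qed
  have "?t ({0}, y) = y" using t_app[of "{}"] pq by simp
  from env_move_to_base[OF y tE this, of "{1..k}"] obtain s
    where s: "s \<in> env" "\<And>\<epsilon>. \<epsilon> \<in> cube_index k \<Longrightarrow> s (\<epsilon>, q \<epsilon>) = y" using t_app by auto
  have "p \<in> cubes k X S" using t cubes_eq_upper[OF y] by simp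
  then have "(\<lambda>\<epsilon>\<in>cube_index k. s (\<epsilon>, p \<epsilon>)) \<in> cubes k X S" by (rule cubes_env[OF _ s(1)])
  moreover have "(\<lambda>\<epsilon>\<in>cube_index k. s (\<epsilon>, p \<epsilon>)) = corner k {} x y"
    unfolding corner_def
    by (rule restrict_ext) (use s pq x env_empty[OF s(1)] in auto)
  ultimately show "corner k {} x y \<in> cubes k X S" by simp
qed

text \<open>In direction \<open>Suc k\<close> the corner splits into the faces (x, y, ..., y) and
  (y, ..., y). Approximating face points split in the same way, with one \<open>n\<close> acting on
  the two base points \<open>u\<close> and \<open>T (n (Suc k)) u\<close>. This costs one
  dimension.\<close>

lemma corner_imp_RP:
  assumes x: "x \<in> M" and y: "y \<in> M" and c: "corner (Suc k) {} x y \<in> cubes (Suc k) X S"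
  shows "(x, y) \<in> RP k X S"
proof -
  let ?Z = "cube_space (Suc k) X"
  let ?c = "corner (Suc k) {} x y"
  define H where "H = (\<lambda>(n, u). face_point (Suc k) X S n u)"
  \<comment> \<open>The filter of all pairs \<open>(n, u)\<close> whose face points approach the
    corner; it is proper because the corner is a limit of face points.\<close>
  define N where "N = inf (filtercomap H (nhdsin ?Z ?c)) (principal (UNIV \<times> M))"
  have cZ: "?c \<in> topspace ?Z" using c closedin_subset[OF closedin_cubes] by blast
  have "N \<noteq> bot"
  proof
    assume "N = bot"
    then have "eventually (\<lambda>_. False) N" by simp
    then obtain P where P: "eventually P (nhdsin ?Z ?c)" "\<And>w. P (H w) \<Longrightarrow> w \<notin> UNIV \<times> M"
      unfolding N_def eventually_inf_principal eventually_filtercomap by blast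
    then obtain W where W: "openin ?Z W" "?c \<in> W" "\<And>w. w \<in> W \<Longrightarrow> P w"
      unfolding eventually_nhdsin using cZ by blast
    then obtain n u where "u \<in> M" "face_point (Suc k) X S n u \<in> W"
      using c unfolding cubes_def in_closure_of by blast
    then show False using W(3) P(2)[of "(n, u)"] by (auto simp: H_def)
  qed
  have lim: "limitin ?Z H ?c N"
    unfolding limitin_def
  proof (intro conjI cZ allI impI, elim conjE)
    fix W assume "openin ?Z W" "?c \<in> W"
    then have "eventually (\<lambda>c. c \<in> W) (nhdsin ?Z ?c)" unfolding eventually_nhdsin by blast
    then have "eventually (\<lambda>w. H w \<in> W) (filtercomap H (nhdsin ?Z ?c))" by (rule eventually_filtercomapI)
    then show "eventually (\<lambda>w. H w \<in> W) N" unfolding N_def eventually_inf_principal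
      by (rule eventually_mono) simp
  qed
  define G where "G = (\<lambda>(n, u). (\<lambda>\<epsilon>. if \<epsilon> \<in> cube_index k then sum n \<epsilon> else (0::int), u, T (n (Suc k)) u))"
  have evM: "eventually (\<lambda>w. snd w \<in> M) N"
    unfolding N_def eventually_inf_principal by (rule always_eventually) auto
  have lower: "limitin (cube_space k X) (\<lambda>w. \<lambda>\<epsilon>\<in>cube_index k. H w \<epsilon>) (\<lambda>\<epsilon>\<in>cube_index k. ?c \<epsilon>) N"
  proof (rule continuous_map_limit[OF _ lim, of _ "\<lambda>c. \<lambda>\<epsilon>\<in>cube_index k. c \<epsilon>", unfolded comp_def])
    show "continuous_map ?Z (cube_space k X) (\<lambda>c. \<lambda>\<epsilon>\<in>cube_index k. c \<epsilon>)"
      by (rule continuous_into_cube_space) (auto intro!: continuous_cube_coord)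
  qed
  have upper: "limitin (cube_space k X) (\<lambda>w. \<lambda>\<epsilon>\<in>cube_index k. H w (insert (Suc k) \<epsilon>))
    (\<lambda>\<epsilon>\<in>cube_index k. ?c (insert (Suc k) \<epsilon>)) N"
  proof (rule continuous_map_limit[OF _ lim, of _ "\<lambda>c. \<lambda>\<epsilon>\<in>cube_index k. c (insert (Suc k) \<epsilon>)", unfolded comp_def])
    show "continuous_map ?Z (cube_space k X) (\<lambda>c. \<lambda>\<epsilon>\<in>cube_index k. c (insert (Suc k) \<epsilon>))"
      by (rule continuous_into_cube_space) (auto intro!: continuous_cube_coord)
  qed
  have H_lower: "(\<lambda>\<epsilon>\<in>cube_index k. H (n, u) \<epsilon>) = face_point k X S n u" for n u
    unfolding face_point_def H_def by (rule restrict_ext) auto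
  have H_upper: "(\<lambda>\<epsilon>\<in>cube_index k. H (n, u) (insert (Suc k) \<epsilon>)) = face_point k X S n (T (n (Suc k)) u)"
    if "u \<in> M" for n u
    unfolding face_point_def H_def
  proof (rule restrict_ext)
    fix \<epsilon> assume \<epsilon>: "\<epsilon> \<in> cube_index k"
    then have "finite \<epsilon>" "Suc k \<notin> \<epsilon>" using finite_cube_index by auto
    moreover have "insert (Suc k) \<epsilon> \<in> cube_index (Suc k)" using \<epsilon> by auto
    ultimately show "(case (n, u) of (n, u) \<Rightarrow> \<lambda>\<epsilon>\<in>cube_index (Suc k). T (sum n \<epsilon>) u) (insert (Suc k) \<epsilon>) =
      T (sum n \<epsilon>) (T (n (Suc k)) u)"
      using that by (simp add: T_add[symmetric] algebra_simps del: Pow_iff)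
  qed
  have act: "cube_act k X S (\<lambda>\<epsilon>. if \<epsilon> \<in> cube_index k then sum n \<epsilon> else 0) (diag k u) = face_point k X S n u" for n u
    by (rule cube_act_diag[OF refl])
  have "filtermap G N \<noteq> bot" using \<open>N \<noteq> bot\<close> by (simp add: filtermap_bot_iff)
  moreover have "\<forall>\<^sub>F (f, x', y') in filtermap G N. f \<in> face_group k \<and> x' \<in> M \<and> y' \<in> M"
    unfolding eventually_filtermap using evM
    by (rule eventually_mono) (use T_in face_group_iff in \<open>auto simp: G_def simp del: Pow_iff\<close>)
  moreover have "limitin (cube_space k X) (\<lambda>(f, x', y'). cube_act k X S f (diag k x'))
    (\<lambda>\<epsilon>\<in>cube_index k. ?c \<epsilon>) (filtermap G N)"
  proof -
    have "limitin (cube_space k X) (\<lambda>w. (\<lambda>(f, x', y'). cube_act k X S f (diag k x')) (G w))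
      (\<lambda>\<epsilon>\<in>cube_index k. ?c \<epsilon>) N"
    proof (rule limitin_transform_eventually[OF always_eventually lower], rule allI)
      fix w :: "(nat \<Rightarrow> int) \<times> 'a"
      show "(\<lambda>\<epsilon>\<in>cube_index k. H w \<epsilon>) = (\<lambda>(f, x', y'). cube_act k X S f (diag k x')) (G w)"
        by (cases w) (simp only: G_def prod.case act H_lower)
    qed
    then show ?thesis unfolding limitin_def eventually_filtermap .
  qed
  moreover have "limitin (cube_space k X) (\<lambda>(f, x', y'). cube_act k X S f (diag k y'))
    (\<lambda>\<epsilon>\<in>cube_index k. ?c (insert (Suc k) \<epsilon>)) (filtermap G N)"
  proof -
    have "\<forall>\<^sub>F w in N. (\<lambda>\<epsilon>\<in>cube_index k. H w (insert (Suc k) \<epsilon>)) =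
      (\<lambda>(f, x', y'). cube_act k X S f (diag k y')) (G w)"
      using evM
    proof (rule eventually_mono)
      fix w :: "(nat \<Rightarrow> int) \<times> 'a" assume "snd w \<in> M"
      then show "(\<lambda>\<epsilon>\<in>cube_index k. H w (insert (Suc k) \<epsilon>)) =
        (\<lambda>(f, x', y'). cube_act k X S f (diag k y')) (G w)"
        using H_upper[of "snd w" "fst w"] act by (cases w) (simp only: G_def prod.case prod.sel)
    qed
    then have "limitin (cube_space k X) (\<lambda>w. (\<lambda>(f, x', y'). cube_act k X S f (diag k y')) (G w))
      (\<lambda>\<epsilon>\<in>cube_index k. ?c (insert (Suc k) \<epsilon>)) N"
      by (rule limitin_transform_eventually[OF _ upper])
    then show ?thesis unfolding limitin_def eventually_filtermap .
  qed
  ultimately show ?thesis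
    unfolding RP_def mem_Collect_eq prod.case
    by (intro exI[of _ "filtermap G N"] exI[of _ "\<lambda>\<epsilon>\<in>cube_index k. ?c \<epsilon>"]
        exI[of _ "\<lambda>\<epsilon>\<in>cube_index k. ?c (insert (Suc k) \<epsilon>)"] conjI) (auto simp: corner_def)
qed

section \<open>The regionally proximal relation of order infinity as a closed invariant equivalence
  relation\<close>

abbreviation "R \<equiv> RP_infinity X S"

lemma RP_infinity_iff:
  "(x, y) \<in> R \<longleftrightarrow> x \<in> M \<and> y \<in> M \<and> (\<forall>d\<ge>1. corner d {} x y \<in> cubes d X S)"
proof
  assume "(x, y) \<in> R"
  then have *: "(x, y) \<in> RP d X S" if "d \<ge> 1" for d using that by (auto simp: RP_infinity_def)
  show "x \<in> M \<and> y \<in> M \<and> (\<forall>d\<ge>1. corner d {} x y \<in> cubes d X S)"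
    using RP_imp_corner(1,2)[OF *[of 1]] RP_imp_corner(3)[OF *] by simp
next
  assume "x \<in> M \<and> y \<in> M \<and> (\<forall>d\<ge>1. corner d {} x y \<in> cubes d X S)"
  then have "(x, y) \<in> RP d X S" for d by (intro corner_imp_RP) simp_all
  then show "(x, y) \<in> R" by (simp add: RP_infinity_def)
qed

lemma R_refl: "x \<in> M \<Longrightarrow> (x, x) \<in> R"
proof -
  assume x: "x \<in> M"
  have "corner d {} x x = face_point d X S (\<lambda>_. 0) x" for d
    by (auto simp: corner_def face_point_def int_iterate_0)
  then show ?thesis using face_point_cubes[OF x] x by (simp add: RP_infinity_iff)
qed

lemma R_sym: assumes "(x, y) \<in> R" shows "(y, x) \<in> R"
  unfolding RP_infinity_def INT_iff
proof
  fix d :: nat assume "d \<in> {1..}"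
  then have "(x, y) \<in> RP d X S" using assms unfolding RP_infinity_def by blast
  then show "(y, x) \<in> RP d X S" by (rule RP_sym)
qed

text \<open>An \<open>s\<close> that moves (z, y, ..., y) to its base point sends \<open>y\<close>
  to \<open>z\<close> at every non-empty vertex. Applied to (x, y, ..., y) it therefore gives (x, z,
  ..., z).\<close>

lemma R_trans:
  assumes "(x, y) \<in> R" "(y, z) \<in> R" shows "(x, z) \<in> R"
  unfolding RP_infinity_iff
proof (intro conjI allI impI)
  show "x \<in> M" "z \<in> M" using assms by (auto simp: RP_infinity_iff)
  fix d :: nat assume "d \<ge> 1"
  then have "corner d {} x y \<in> cubes d X S" "corner d {} z y \<in> cubes d X S"
    using assms(1) R_sym[OF assms(2)] by (auto simp: RP_infinity_iff)
  note c = this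
  obtain s where s: "s \<in> env"
    "\<And>\<epsilon>. \<epsilon> \<in> cube_index d \<Longrightarrow> s (\<epsilon>, corner d {} z y \<epsilon>) = z"
  proof -
    have "corner d {} z y {} = z" by (simp add: corner_def)
    moreover obtain s where "s \<in> env"
      "\<forall>\<epsilon>\<in>cube_index d. s (\<epsilon>, corner d {} z y \<epsilon>) = corner d {} z y {}"
      using cubes_move_to_base[OF c(2)] by blast
    ultimately show ?thesis by (intro that[of s]) simp_all
  qed
  have "(\<lambda>\<epsilon>\<in>cube_index d. s (\<epsilon>, corner d {} x y \<epsilon>)) \<in> cubes d X S"
    by (rule cubes_env[OF c(1) s(1)])
  moreover have "(\<lambda>\<epsilon>\<in>cube_index d. s (\<epsilon>, corner d {} x y \<epsilon>)) = corner d {} x z"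
    unfolding corner_def[of d "{}" x z]
  proof (rule restrict_ext)
    fix \<epsilon> assume \<epsilon>: "\<epsilon> \<in> cube_index d"
    then show "s (\<epsilon>, corner d {} x y \<epsilon>) = (if \<epsilon> = {} then x else z)"
      using s(2)[OF \<epsilon>] env_empty[OF s(1) \<open>x \<in> M\<close>] by (simp add: corner_def split: if_splits)
  qed
  ultimately show "corner d {} x z \<in> cubes d X S" by simp
qed

lemma R_equiv: "equiv M R"
proof (intro equivI)
  show "R \<subseteq> M \<times> M" by (auto simp: RP_infinity_iff)
  show "refl_on M R" using R_refl by (intro refl_onI) auto
  show "sym R" using R_sym by (rule symI)
  show "trans R" using R_trans by (rule transI)
qed

lemma R_T: assumes "(x, y) \<in> R" shows "(T n x, T n y) \<in> R"
  unfolding RP_infinity_iff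
proof (intro conjI allI impI)
  show "T n x \<in> M" "T n y \<in> M" using assms by (auto simp: RP_infinity_iff T_in)
  fix d :: nat assume "d \<ge> 1"
  then have "corner d {} x y \<in> cubes d X S" using assms by (auto simp: RP_infinity_iff)
  from cubes_act[OF this, of n "\<lambda>_. 0"]
  have "(\<lambda>\<epsilon>\<in>cube_index d. T n (corner d {} x y \<epsilon>)) \<in> cubes d X S" by simp
  moreover have "(\<lambda>\<epsilon>\<in>cube_index d. T n (corner d {} x y \<epsilon>)) = corner d {} (T n x) (T n y)"
    by (auto simp: corner_def)
  ultimately show "corner d {} (T n x) (T n y) \<in> cubes d X S" by simp
qed

lemma closedin_R: "closedin (prod_topology X X) R"
proof -
  have *: "closedin (prod_topology X X)
    {w \<in> topspace (prod_topology X X). corner d {} (fst w) (snd w) \<in> cubes d X S}" for d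
  proof (rule closedin_continuous_map_preimage[OF _ closedin_cubes])
    show "continuous_map (prod_topology X X) (cube_space d X) (\<lambda>w. corner d {} (fst w) (snd w))"
      by (rule continuous_into_cube_space)
        (auto simp: corner_def continuous_map_fst continuous_map_snd)
  qed
  have "R = (\<Inter>d\<in>{1..}. {w \<in> topspace (prod_topology X X). corner d {} (fst w) (snd w) \<in> cubes d X S})"
    by (auto simp: RP_infinity_iff)
  then show ?thesis using * by (simp only:) (intro closedin_Inter; auto)
qed

end

section \<open>Generic points and saturation\<close>

lemma saturatedI:
  assumes "L \<subseteq> A" "\<And>a. a \<in> A \<Longrightarrow> \<phi> a \<in> \<phi> ` L \<Longrightarrow> a \<in> L"
  shows "saturated A \<phi> L"
  using assms by (auto simp: saturated_def)

lemma openin_prod_topologyD: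
  assumes "openin (prod_topology X Y) N" "(a, b) \<in> N"
  shows "\<exists>U V. openin X U \<and> openin Y V \<and> a \<in> U \<and> b \<in> V \<and> U \<times> V \<subseteq> N"
  using assms by (simp add: openin_prod_topology_alt)

lemma compact_metrizable_imp_second_countable:
  assumes "compact_space Z" "metrizable_space Z" shows "second_countable Z"
proof -
  obtain M d where "Metric_space M d" and Z: "Z = Metric_space.mtopology M d"
    using assms(2) by (auto simp: metrizable_space_def)
  interpret Metric_space M d by fact
  have "\<exists>K. finite K \<and> K \<subseteq> M \<and> M \<subseteq> (\<Union>x\<in>K. mball x (1 / real (Suc n)))" for n
    using assms(1) compactin_imp_mtotally_bounded[of M]
    by (auto simp: Z compact_space_def mtotally_bounded_def)
  then obtain K where K: "\<And>n. finite (K n)" "\<And>n. K n \<subseteq> M"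
    "\<And>n. M \<subseteq> (\<Union>x\<in>K n. mball x (1 / real (Suc n)))" by metis
  let ?B = "\<Union>n. (\<lambda>x. mball x (1 / real (Suc n))) ` K n"
  have "countable ?B" using K(1) by (intro countable_UN) (auto intro: countable_finite)
  moreover have "\<forall>V\<in>?B. openin Z V" by (auto simp: Z)
  moreover have "\<exists>V\<in>?B. x \<in> V \<and> V \<subseteq> U" if "openin Z U" "x \<in> U" for U x
  proof -
    obtain r where r: "r > 0" "mball x r \<subseteq> U" using \<open>openin Z U\<close> \<open>x \<in> U\<close> by (auto simp: Z openin_mtopology)
    have xM: "x \<in> M" using openin_subset[OF \<open>openin Z U\<close>] \<open>x \<in> U\<close> by (auto simp: Z)
    obtain n where n: "1 / real (Suc n) < r / 2" using reals_Archimedean[of "r / 2"] r(1)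
      by (auto simp: inverse_eq_divide)
    obtain y where y: "y \<in> K n" "x \<in> mball y (1 / real (Suc n))" using K(3) xM by blast
    have "mball y (1 / real (Suc n)) \<subseteq> mball x r"
    proof
      fix u assume u: "u \<in> mball y (1 / real (Suc n))"
      have "d x u \<le> d x y + d y u" using u y xM by (intro triangle) (auto simp: in_mball)
      also have "\<dots> < r" using u y n commute[of x y] by (auto simp: in_mball)
      finally show "u \<in> mball x r" using u xM by (auto simp: in_mball)
    qed
    moreover have "mball y (1 / real (Suc n)) \<in> ?B" using y(1) by blast
    ultimately show ?thesis using y(2) r(2) by (meson order_trans)
  qed
  ultimately show ?thesis unfolding second_countable_def by (intro exI[of _ ?B]) simp
qed

lemma dense_gdelta_Inter:
  assumes "compact_space X" "metrizable_space X" "countable \<G>"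
    and "\<And>G. G \<in> \<G> \<Longrightarrow> openin X G \<and> X closure_of G = topspace X"
  shows "dense_gdelta X (topspace X \<inter> \<Inter>\<G>)"
proof -
  let ?\<G> = "insert (topspace X) \<G>"
  have *: "openin X G \<and> X closure_of G = topspace X" if "G \<in> ?\<G>" for G
    using that assms(4) by auto
  have "gdelta_in X (\<Inter>?\<G>)"
    by (rule gdelta_in_Inter) (use assms(3) * open_imp_gdelta_in in blast)+
  moreover have "X closure_of \<Inter>?\<G> = topspace X"
    by (rule Baire_category) (use assms * compact_imp_locally_compact_space metrizable_imp_regular_space in auto)
  ultimately show ?thesis by (simp add: dense_gdelta_def)
qed

context compact_tds
begin

lemma metrizable_cube_space: "metrizable_space (cube_space d X)"
  unfolding cube_space_def metrizable_space_product_topology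
  by (intro disjI2 conjI countable_finite) (auto simp: metrizable)

lemma face_orbit_closure_cubes:
  assumes "x \<in> M" shows "face_orbit_closure d X S x \<subseteq> cubes d X S"
  unfolding face_orbit_closure_eq cubes_def by (rule closure_of_mono) (use assms in auto)

lemma face_orbit_closure_base:
  assumes x: "x \<in> M" and c: "c \<in> face_orbit_closure d X S x" shows "c {} = x"
proof -
  have "face_orbit_closure d X S x \<subseteq> {c \<in> topspace (cube_space d X). c {} \<in> {x}}"
    unfolding face_orbit_closure_eq
  proof (rule closure_of_minimal)
    show "closedin (cube_space d X) {c \<in> topspace (cube_space d X). c {} \<in> {x}}"
      using x Hausdorff
      by (intro closedin_continuous_map_preimage[OF continuous_cube_coord]) (auto simp: closedin_Hausdorff_singleton)
  qed (use x face_point_in in \<open>auto simp: face_point_def int_iterate_0\<close>)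
  then show ?thesis using c by auto
qed

lemma cubes_meets:
  assumes "c \<in> cubes d X S" "openin (cube_space d X) W" "c \<in> W"
  shows "\<exists>n. \<exists>x\<in>M. face_point d X S n x \<in> W"
proof -
  have "\<exists>y. y \<in> {face_point d X S n x |n x. x \<in> M} \<and> y \<in> W"
    using assms unfolding cubes_def in_closure_of by simp
  then show ?thesis by auto
qed

text \<open>At a point that lies on the boundary of none of the countably many open sets of points whose
  face orbit meets a given basic open set, the face orbit closure is upper semicontinuous.\<close>
lemma ex_generic_points:
  "\<exists>X\<^sub>0. dense_gdelta X X\<^sub>0 \<and>
    (\<forall>x\<in>X\<^sub>0. \<forall>c\<in>cubes d X S. c {} = x \<longrightarrow> c \<in> face_orbit_closure d X S x)"
proof -
  let ?Z = "cube_space d X"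
  obtain \<B> where \<B>: "countable \<B>" "\<And>B. B \<in> \<B> \<Longrightarrow> openin ?Z B"
    "\<And>U c. openin ?Z U \<Longrightarrow> c \<in> U \<Longrightarrow> \<exists>B\<in>\<B>. c \<in> B \<and> B \<subseteq> U"
    using compact_metrizable_imp_second_countable[OF compact_cube_space metrizable_cube_space]
    unfolding second_countable_def by metis
  define A where "A B = (\<Union>n. {x \<in> M. face_point d X S n x \<in> B})" for B
  have A_open: "openin X (A B)" if "B \<in> \<B>" for B
    unfolding A_def
    by (intro openin_Union) (use openin_continuous_map_preimage[OF continuous_face_point \<B>(2)[OF that]] in auto)
  define G where "G B = A B \<union> (M - X closure_of (A B))" for B
  let ?X\<^sub>0 = "M \<inter> \<Inter>(G ` \<B>)"
  have "dense_gdelta X ?X\<^sub>0"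
  proof (rule dense_gdelta_Inter[OF compact metrizable])
    show "countable (G ` \<B>)" using \<B>(1) by simp
    fix H assume "H \<in> G ` \<B>"
    then obtain B where B: "B \<in> \<B>" "H = G B" by auto
    have "openin X H" unfolding B(2) G_def using A_open[OF B(1)] by (intro openin_Un openin_diff) auto
    moreover have "M \<subseteq> X closure_of H"
    proof
      fix x assume x: "x \<in> M"
      show "x \<in> X closure_of H"
      proof (cases "x \<in> X closure_of (A B)")
        case True
        then show ?thesis using closure_of_mono[of "A B" H] by (auto simp: B(2) G_def)
      next
        case False
        then have "x \<in> H" using x by (simp add: B(2) G_def)
        then show ?thesis using closure_of_subset[OF openin_subset[OF \<open>openin X H\<close>]] by blast
      qed
    qed
    ultimately show "openin X H \<and> X closure_of H = M" using closure_of_subset_topspace by fastforce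
  qed
  moreover have "c \<in> face_orbit_closure d X S x"
    if x: "x \<in> ?X\<^sub>0" and c: "c \<in> cubes d X S" "c {} = x" for x c
    unfolding face_orbit_closure_eq in_closure_of
  proof (intro conjI allI impI)
    show cZ: "c \<in> topspace ?Z" using c(1) cubes_in topspace_cube_space by blast
    fix W assume "c \<in> W \<and> openin ?Z W"
    then obtain B where B: "B \<in> \<B>" "c \<in> B" "B \<subseteq> W" using \<B>(3) by blast
    have "x \<in> X closure_of (A B)"
      unfolding in_closure_of
    proof (intro conjI allI impI)
      fix V assume V: "x \<in> V \<and> openin X V"
      let ?W = "B \<inter> {c \<in> topspace ?Z. c {} \<in> V}"
      have "openin ?Z ?W"
        using \<B>(2)[OF B(1)] V openin_continuous_map_preimage[OF continuous_cube_coord[of "{}" d X]] by auto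
      moreover have "c \<in> ?W" using B(2) cZ c(2) V by auto
      ultimately obtain n y where y: "y \<in> M" "face_point d X S n y \<in> ?W"
        using cubes_meets[OF c(1)] by blast
      then have "y \<in> V" by (simp add: face_point_def int_iterate_0)
      then show "\<exists>y. y \<in> A B \<and> y \<in> V" using y by (auto simp: A_def)
    qed (use x in auto)
    moreover have "x \<in> G B" using x B(1) by auto
    ultimately obtain n where "face_point d X S n x \<in> B" by (auto simp: G_def A_def)
    then show "\<exists>y. y \<in> range (\<lambda>n. face_point d X S n x) \<and> y \<in> W" using B(3) by blast
  qed
  ultimately show ?thesis by blast
qed

section \<open>Saturation of the cubes under an open extension\<close>

lemma continuous_fun_upd:
  assumes "\<epsilon> \<in> cube_index d"
  shows "continuous_map (prod_topology (cube_space d X) X) (cube_space d X) (\<lambda>w. (fst w)(\<epsilon> := snd w))"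
proof (rule continuous_into_cube_space)
  fix \<eta> assume \<eta>: "\<eta> \<in> cube_index d"
  show "continuous_map (prod_topology (cube_space d X) X) X (\<lambda>w. ((fst w)(\<epsilon> := snd w)) \<eta>)"
  proof (cases "\<eta> = \<epsilon>")
    case False
    then show ?thesis
      using continuous_map_compose[OF continuous_map_fst continuous_cube_coord[OF \<eta>]] by (simp add: comp_def)
  qed (simp add: continuous_map_snd)
qed (use assms in \<open>auto simp: topspace_cube_space PiE_iff extensional_def\<close>)

context
  fixes Y :: "'b topology" and Q \<pi>
  assumes ext: "extension X S Y Q \<pi>" and inj_Q: "inj_on Q (topspace Y)" and op: "open_map X Y \<pi>"
begin

lemma \<pi>_in: "x \<in> M \<Longrightarrow> \<pi> x \<in> topspace Y"
  using ext by (auto simp: extension_def)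

lemma \<pi>_T:
  assumes "x \<in> M" "y \<in> M" "\<pi> x = \<pi> y" shows "\<pi> (T n x) = \<pi> (T n y)"
proof (induction n rule: int_induct[where k = 0])
  case base
  then show ?case using assms by (simp add: int_iterate_0)
next
  case (step1 i)
  then show ?case using ext T_in assms by (simp add: T_Suc extension_def)
next
  case (step2 i)
  have "Q (\<pi> (T (i - 1) x)) = \<pi> (T i x)" "Q (\<pi> (T (i - 1) y)) = \<pi> (T i y)"
    using ext T_Suc[OF assms(1), of "i - 1"] T_Suc[OF assms(2), of "i - 1"] T_in assms
    by (auto simp: extension_def)
  then show ?case using step2 inj_Q \<pi>_in T_in assms by (metis inj_onD)
qed

lemma cubes_replace_coord:
  assumes D: "D \<subseteq> M" "X closure_of D = M"
    and corner: "\<And>x y. x \<in> D \<Longrightarrow> y \<in> M \<Longrightarrow> \<pi> y = \<pi> x \<Longrightarrow> corner d \<epsilon> y x \<in> cubes d X S"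
    and \<epsilon>: "\<epsilon> \<in> cube_index d"
    and c: "c \<in> cubes d X S" "y \<in> M" "\<pi> y = \<pi> (c \<epsilon>)"
  shows "c(\<epsilon> := y) \<in> cubes d X S"
proof -
  let ?Z = "cube_space d X"
  define A where "A = {c \<in> topspace ?Z. \<forall>y\<in>M. \<pi> y = \<pi> (c \<epsilon>) \<longrightarrow> c(\<epsilon> := y) \<in> cubes d X S}"
  \<comment> \<open>A bad replacement \<open>y0\<close> at \<open>c0\<close> persists: since \<pi>
    is open, each \<open>c\<close> near \<open>c0\<close> has a point of the relevant fibre near
    \<open>y0\<close>, and it is again bad.\<close>
  have "openin ?Z (topspace ?Z - A)"
  proof (subst openin_subopen, intro ballI)
    fix c0 assume c0: "c0 \<in> topspace ?Z - A"
    then obtain y0 where y0: "y0 \<in> M" "\<pi> y0 = \<pi> (c0 \<epsilon>)" "c0(\<epsilon> := y0) \<notin> cubes d X S"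
      by (auto simp: A_def)
    define N where "N = {w \<in> topspace (prod_topology ?Z X). (fst w)(\<epsilon> := snd w) \<in> topspace ?Z - cubes d X S}"
    have "openin (prod_topology ?Z X) N"
      unfolding N_def by (rule openin_continuous_map_preimage[OF continuous_fun_upd[OF \<epsilon>]])
        (use closedin_cubes in \<open>auto simp: closedin_def\<close>)
    moreover have "(c0, y0) \<in> N"
    proof -
      have "c0(\<epsilon> := y0) \<in> topspace ?Z"
        using c0 y0(1) \<epsilon> by (auto simp: topspace_cube_space PiE_iff extensional_def)
      then show ?thesis using c0 y0 by (simp add: N_def)
    qed
    ultimately have "\<exists>W V. openin ?Z W \<and> openin X V \<and> c0 \<in> W \<and> y0 \<in> V \<and> W \<times> V \<subseteq> N"
      by (rule openin_prod_topologyD)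
    then obtain W V where WV: "openin ?Z W" "openin X V" "c0 \<in> W" "y0 \<in> V" "W \<times> V \<subseteq> N" by blast
    let ?O = "W \<inter> {c \<in> topspace ?Z. (\<pi> \<circ> (\<lambda>c. c \<epsilon>)) c \<in> \<pi> ` V}"
    have "continuous_map ?Z Y (\<pi> \<circ> (\<lambda>c. c \<epsilon>))"
      using ext by (intro continuous_map_compose[OF continuous_cube_coord[OF \<epsilon>]]) (auto simp: extension_def)
    moreover have "openin Y (\<pi> ` V)" using op WV(2) unfolding open_map_def by blast
    ultimately have "openin ?Z {c \<in> topspace ?Z. (\<pi> \<circ> (\<lambda>c. c \<epsilon>)) c \<in> \<pi> ` V}"
      by (rule openin_continuous_map_preimage)
    then have "openin ?Z ?O" by (rule openin_Int[OF WV(1)])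
    moreover have "c0 \<in> ?O"
    proof -
      have "\<pi> (c0 \<epsilon>) \<in> \<pi> ` V" using y0(2) WV(4) by (metis imageI)
      then show ?thesis using WV(3) c0 by simp
    qed
    moreover have "?O \<subseteq> topspace ?Z - A"
    proof
      fix c assume "c \<in> ?O"
      then obtain y where y: "c \<in> W" "c \<in> topspace ?Z" "y \<in> V" "\<pi> y = \<pi> (c \<epsilon>)" by force
      then have "(c, y) \<in> N" using WV(5) by blast
      moreover have "y \<in> M" using y(3) openin_subset[OF WV(2)] by blast
      ultimately show "c \<in> topspace ?Z - A" using y by (auto simp: A_def N_def)
    qed
    ultimately show "\<exists>G. openin ?Z G \<and> c0 \<in> G \<and> G \<subseteq> topspace ?Z - A" by (intro exI[of _ ?O] conjI)
  qed
  moreover have "A \<subseteq> topspace ?Z" by (auto simp: A_def)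
  ultimately have A: "closedin ?Z A" by (simp add: closedin_def)
  have "face_point d X S n x \<in> A" if x: "x \<in> M" for n x
  proof -
    have "X closure_of D \<subseteq> {x \<in> M. face_point d X S n x \<in> A}"
    proof (rule closure_of_minimal[OF _ closedin_continuous_map_preimage[OF continuous_face_point A]], rule subsetI)
      fix x assume xD: "x \<in> D"
      then have x: "x \<in> M" using D by auto
      have "(face_point d X S n x)(\<epsilon> := y) \<in> cubes d X S"
        if y: "y \<in> M" "\<pi> y = \<pi> (face_point d X S n x \<epsilon>)" for y
      proof -
        let ?s = "sum n \<epsilon>"
        \<comment> \<open>Undoing the translation at all vertices turns the altered face point into
          a corner over \<open>x\<close>, where the hypothesis applies.\<close>
        have "\<pi> (T (- ?s) y) = \<pi> (T (- ?s) (T ?s x))"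
          using y \<epsilon> x T_in by (intro \<pi>_T) (auto simp: face_point_def)
        then have "corner d \<epsilon> (T (- ?s) y) x \<in> cubes d X S"
          using corner[OF xD T_in[OF y(1)]] T_inverse(1)[OF x] by simp
        from cubes_act[OF this, of 0 n]
        have "(\<lambda>\<eta>\<in>cube_index d. T (sum n \<eta>) (corner d \<epsilon> (T (- ?s) y) x \<eta>)) \<in> cubes d X S" by simp
        moreover have "(\<lambda>\<eta>\<in>cube_index d. T (sum n \<eta>) (corner d \<epsilon> (T (- ?s) y) x \<eta>)) =
          (face_point d X S n x)(\<epsilon> := y)"
          using \<epsilon> T_inverse(2)[OF y(1)] by (auto simp: corner_def face_point_def fun_eq_iff)
        ultimately show ?thesis by simp
      qed
      then show "x \<in> {x \<in> M. face_point d X S n x \<in> A}" using x face_point_in[OF x] by (auto simp: A_def)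
    qed
    then show ?thesis using x D(2) by auto
  qed
  then have "cubes d X S \<subseteq> A" by (rule cubes_minimal[OF A])
  then show ?thesis using c by (auto simp: A_def)
qed

lemma cubic_characteristic_factorI:
  assumes D: "D \<subseteq> M" "X closure_of D = M"
    and corner: "\<And>x y \<epsilon>. x \<in> D \<Longrightarrow> y \<in> M \<Longrightarrow> \<pi> y = \<pi> x \<Longrightarrow> \<epsilon> \<in> cube_index d \<Longrightarrow>
      corner d \<epsilon> y x \<in> cubes d X S"
  shows "cubic_characteristic_factor d X S Y Q \<pi>"
proof -
  have replace: "c' \<in> cubes d X S"
    if c: "c \<in> cubes d X S" and c': "c' \<in> cube_index d \<rightarrow>\<^sub>E M"
      and eq: "\<And>\<epsilon>. \<epsilon> \<in> cube_index d \<Longrightarrow> \<pi> (c' \<epsilon>) = \<pi> (c \<epsilon>)" for c c'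
  proof -
    have "(\<lambda>\<eta>. if \<eta> \<in> V then c' \<eta> else c \<eta>) \<in> cubes d X S" if "finite V" "V \<subseteq> cube_index d" for V
      using that
    proof (induction V)
      case empty
      then show ?case using c by simp
    next
      case (insert \<epsilon> V)
      let ?c = "\<lambda>\<eta>. if \<eta> \<in> V then c' \<eta> else c \<eta>"
      have \<epsilon>: "\<epsilon> \<in> cube_index d" using insert by blast
      have "?c(\<epsilon> := c' \<epsilon>) \<in> cubes d X S"
      proof (rule cubes_replace_coord[OF D _ \<epsilon>])
        show "c' \<epsilon> \<in> M" using c' \<epsilon> by (rule PiE_mem)
        show "\<pi> (c' \<epsilon>) = \<pi> (?c \<epsilon>)" using eq[OF \<epsilon>] by simp
      qed (use insert corner \<epsilon> in blast)+
      moreover have "?c(\<epsilon> := c' \<epsilon>) = (\<lambda>\<eta>. if \<eta> \<in> insert \<epsilon> V then c' \<eta> else c \<eta>)" by auto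
      ultimately show ?case by simp
    qed
    from this[of "cube_index d"] have "(\<lambda>\<eta>. if \<eta> \<in> cube_index d then c' \<eta> else c \<eta>) \<in> cubes d X S"
      by simp
    moreover have "(\<lambda>\<eta>. if \<eta> \<in> cube_index d then c' \<eta> else c \<eta>) = c'"
      using cubes_in[OF c] c' by (auto simp: PiE_iff extensional_def fun_eq_iff)
    ultimately show ?thesis by simp
  qed
  obtain X\<^sub>0 where X0: "dense_gdelta X X\<^sub>0"
    "\<And>x c. x \<in> X\<^sub>0 \<Longrightarrow> c \<in> cubes d X S \<Longrightarrow> c {} = x \<Longrightarrow> c \<in> face_orbit_closure d X S x"
    using ex_generic_points[of d] by blast
  have "saturated (star_index d \<rightarrow>\<^sub>E M) (star_map d \<pi>) (star_proj d ` face_orbit_closure d X S x)"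
    if xX0: "x \<in> X\<^sub>0" for x
  proof -
    have x: "x \<in> M" using xX0 X0(1) gdelta_in_subset by (auto simp: dense_gdelta_def)
    let ?L = "star_proj d ` face_orbit_closure d X S x"
    have "?L \<subseteq> star_index d \<rightarrow>\<^sub>E M"
    proof
      fix a assume "a \<in> ?L"
      then obtain c where c: "c \<in> face_orbit_closure d X S x" "a = star_proj d c" by auto
      then have "c \<in> cube_index d \<rightarrow>\<^sub>E M" using face_orbit_closure_cubes[OF x] cubes_in by blast
      then show "a \<in> star_index d \<rightarrow>\<^sub>E M" unfolding c(2) star_proj_def by (intro restrict_PiE_iff[THEN iffD2] ballI) (auto simp: PiE_iff)
    qed
    moreover have "a \<in> ?L" if a: "a \<in> star_index d \<rightarrow>\<^sub>E M" and im: "star_map d \<pi> a \<in> star_map d \<pi> ` ?L" for a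
    proof -
      obtain c where c: "c \<in> face_orbit_closure d X S x" "star_map d \<pi> a = star_map d \<pi> (star_proj d c)"
        using im by auto
      have eq: "\<pi> (a \<epsilon>) = \<pi> (c \<epsilon>)" if "\<epsilon> \<in> star_index d" for \<epsilon>
        using fun_cong[OF c(2), of \<epsilon>] that by (simp add: star_map_def star_proj_def)
      \<comment> \<open>The base coordinate \<open>x\<close> of \<open>c\<close> is kept and the
        others are exchanged within their fibres. This stays in \<open>cubes\<close>, and genericity
        of \<open>x\<close> leads back to the face orbit closure.\<close>
      define c' where "c' = (\<lambda>\<epsilon>\<in>cube_index d. if \<epsilon> = {} then x else a \<epsilon>)"
      have "c' \<in> cubes d X S"
      proof (rule replace)
        show "c \<in> cubes d X S" using c(1) face_orbit_closure_cubes[OF x] by blast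
        show "c' \<in> cube_index d \<rightarrow>\<^sub>E M" using a x by (auto simp: c'_def)
        show "\<pi> (c' \<epsilon>) = \<pi> (c \<epsilon>)" if "\<epsilon> \<in> cube_index d" for \<epsilon>
          using that eq face_orbit_closure_base[OF x c(1)] by (simp add: c'_def)
      qed
      then have "c' \<in> face_orbit_closure d X S x" by (rule X0(2)[OF xX0]) (simp add: c'_def)
      moreover have "star_proj d c' = a"
        using a by (auto simp: star_proj_def c'_def fun_eq_iff PiE_iff extensional_def)
      ultimately show ?thesis by blast
    qed
    ultimately show ?thesis by (rule saturatedI)
  qed
  then show ?thesis using ext X0(1) by (auto simp: cubic_characteristic_factor_def)
qed

end

end

section \<open>Continuity points of the factor map\<close>

text \<open>The functions are the distances to the points of a countable dense set, with 0 as
  default on the empty space. Their sublevel sets form a base, and their minima over a closed set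
  will serve as its code.\<close>

lemma ex_base_functions:
  assumes "compact_space Z" "metrizable_space Z"
  obtains h :: "nat \<Rightarrow> 'a \<Rightarrow> real" where "\<And>n. continuous_map Z euclideanreal (h n)"
    "\<And>U x. openin Z U \<Longrightarrow> x \<in> U \<Longrightarrow> \<exists>n r. h n x < r \<and> {y \<in> topspace Z. h n y < r} \<subseteq> U"
proof -
  obtain M d where "Metric_space M d" and Z: "Z = Metric_space.mtopology M d"
    using assms(2) by (auto simp: metrizable_space_def)
  interpret Metric_space M d by fact
  have "separable_space Z"
    by (rule second_countable_imp_separable_space[OF compact_metrizable_imp_second_countable[OF assms]])
  then obtain C where C: "countable C" "C \<subseteq> M" "Z closure_of C = M"
    by (auto simp: separable_space_def Z)
  define h where "h n = (if C = {} then (\<lambda>_. 0) else d (from_nat_into C n))" for n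
  have cont: "continuous_map Z euclideanreal (h n)" for n
  proof (cases "C = {}")
    case False
    then have "from_nat_into C n \<in> M" using C(2) from_nat_into[OF False] by blast
    from continuous_map_mdist[of Z "metric (M, d)" "\<lambda>_. from_nat_into C n" "\<lambda>x. x"] this
    show ?thesis using False by (simp add: h_def Z mtopology_of_def mspace_metric mdist_metric)
  qed (simp add: h_def)
  have base: "\<exists>n r. h n x < r \<and> {y \<in> topspace Z. h n y < r} \<subseteq> U" if U: "openin Z U" "x \<in> U" for U x
  proof -
    obtain r where r: "r > 0" "mball x r \<subseteq> U" using U by (auto simp: Z openin_mtopology)
    have x: "x \<in> M" using openin_subset[OF U(1)] U(2) by (auto simp: Z)
    then have "x \<in> Z closure_of C" using C(3) by simp
    moreover have "x \<in> mball x (r / 2)" using x r(1) by simp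
    ultimately obtain c where c: "c \<in> C" "c \<in> mball x (r / 2)"
      unfolding in_closure_of Z using openin_mball by blast
    obtain n where n: "from_nat_into C n = c" using from_nat_into_surj[OF C(1) c(1)] by blast
    have h: "h n = d c" using c(1) n by (auto simp: h_def)
    have "y \<in> U" if "y \<in> M" "d c y < r / 2" for y
    proof -
      have "d x y \<le> d x c + d c y" using x c that by (intro triangle) auto
      then have "y \<in> mball x r" using x c that by simp
      then show ?thesis using r(2) by blast
    qed
    then show ?thesis using c(2) by (intro exI[of _ n] exI[of _ "r / 2"]) (auto simp: h Z commute)
  qed
  show ?thesis by (rule that[OF cont base])
qed

lemma attains_Inf:
  fixes h :: "'a \<Rightarrow> real"
  assumes "compactin Z K" "K \<noteq> {}" "continuous_map Z euclideanreal h"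
  obtains x where "x \<in> K" "h x = Inf (h ` K)" "\<And>y. y \<in> K \<Longrightarrow> Inf (h ` K) \<le> h y"
proof -
  have "compact (h ` K)" using image_compactin[OF assms(1,3)] by simp
  then obtain x where x: "x \<in> K" "\<And>y. y \<in> K \<Longrightarrow> h x \<le> h y"
    using compact_attains_inf[of "h ` K"] assms(2) by auto
  then have "Inf (h ` K) = h x" by (intro cInf_eq_minimum) auto
  then show ?thesis using that x by simp
qed

locale coded_minimal_tds = minimal_compact_tds +
  fixes h :: "nat \<Rightarrow> 'a \<Rightarrow> real"
  assumes h_cont: "\<And>n. continuous_map X euclideanreal (h n)"
    and h_base: "\<And>U x. openin X U \<Longrightarrow> x \<in> U \<Longrightarrow> \<exists>n r. h n x < r \<and> {y \<in> M. h n y < r} \<subseteq> U"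
begin

lemma R_in: "(x, y) \<in> R \<Longrightarrow> x \<in> M \<and> y \<in> M"
  by (simp add: RP_infinity_iff)

lemma R_class_eq: "(x, y) \<in> R \<Longrightarrow> R `` {x} = R `` {y}"
  by (rule equiv_class_eq[OF R_equiv])

lemma closedin_sat:
  assumes "closedin X F" shows "closedin X (R `` F)"
proof -
  have "R `` F = snd ` (R \<inter> (F \<times> M))" using R_in by force
  moreover have "closedin (prod_topology X X) (R \<inter> (F \<times> M))"
    using closedin_R assms by (intro closedin_Int) (auto simp: closedin_prod_Times_iff)
  moreover have "closed_map (prod_topology X X) X snd"
    by (rule Abstract_Topological_Spaces.closed_map_snd[OF compact])
  ultimately show ?thesis by (simp add: closed_map_def)
qed

lemma openin_sat_interior:
  assumes "openin X A" shows "openin X {x \<in> M. R `` {x} \<subseteq> A}"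
proof -
  have "{x \<in> M. R `` {x} \<subseteq> A} = M - R `` (M - A)"
    using R_in R_sym by blast
  moreover have "closedin X (M - A)" using assms by blast
  ultimately show ?thesis using closedin_sat by (simp add: openin_diff)
qed

lemma homeo_T: "homeomorphic_map X X (T n)"
  unfolding homeomorphic_map_maps homeomorphic_maps_def
  using cont_T T_inverse by (intro exI[of _ "T (- n)"]) auto

lemma closedin_T_image: "closedin X F \<Longrightarrow> closedin X (T n ` F)"
  using homeo_T by (auto simp: homeomorphic_eq_everything_map closed_map_def)

lemma openin_T_image: "openin X F \<Longrightarrow> openin X (T n ` F)"
  using homeo_T by (auto simp: homeomorphic_eq_everything_map open_map_def)

lemma T_image_inverse: "F \<subseteq> M \<Longrightarrow> T (- n) ` T n ` F = F" "F \<subseteq> M \<Longrightarrow> T n ` T (- n) ` F = F"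
  using T_inverse by (force simp: image_image subset_iff)+

lemma sat_T_image:
  assumes "F \<subseteq> M" shows "R `` (T n ` F) = T n ` (R `` F)"
proof
  show "T n ` (R `` F) \<subseteq> R `` (T n ` F)" using R_T by blast
  show "R `` (T n ` F) \<subseteq> T n ` (R `` F)"
  proof
    fix y assume "y \<in> R `` (T n ` F)"
    then obtain x where x: "x \<in> F" "(T n x, y) \<in> R" by auto
    then have "(x, T (- n) y) \<in> R" "y \<in> M"
      using R_T[OF x(2), of "- n"] T_inverse[of x n] assms R_in by (auto simp: subset_iff)
    then show "y \<in> T n ` (R `` F)" using x(1) T_inverse(2)[of y n] by (metis ImageI imageI)
  qed
qed

text \<open>\<open>B\<close> is the preimage of a closed nowhere dense subset of the quotient by \<open>R\<close>.\<close>
definition nwd :: "'a set \<Rightarrow> bool" where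
  "nwd B \<longleftrightarrow> closedin X B \<and> R `` B \<subseteq> B \<and> (\<forall>V. openin X V \<longrightarrow> R `` V \<subseteq> V \<longrightarrow> V \<subseteq> B \<longrightarrow> V = {})"

lemma nwd_closedin: "nwd B \<Longrightarrow> closedin X B"
  and nwd_sat: "nwd B \<Longrightarrow> R `` B \<subseteq> B"
  and nwdD: "nwd B \<Longrightarrow> openin X V \<Longrightarrow> R `` V \<subseteq> V \<Longrightarrow> V \<subseteq> B \<Longrightarrow> V = {}"
  by (simp_all add: nwd_def)

lemma nwd_T_image:
  assumes "nwd B" shows "nwd (T n ` B)"
  unfolding nwd_def
proof (intro conjI allI impI)
  have B: "closedin X B" "R `` B \<subseteq> B" "B \<subseteq> M" using assms closedin_subset by (auto simp: nwd_def)
  show "closedin X (T n ` B)" by (rule closedin_T_image[OF B(1)])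
  show "R `` (T n ` B) \<subseteq> T n ` B" using sat_T_image[OF B(3)] B(2) by auto
  fix V assume V: "openin X V" "R `` V \<subseteq> V" "V \<subseteq> T n ` B"
  have VM: "V \<subseteq> M" using V(1) openin_subset by blast
  have "T (- n) ` V \<subseteq> T (- n) ` T n ` B" using V(3) by (rule image_mono)
  then have "T (- n) ` V \<subseteq> B" by (simp only: T_image_inverse(1)[OF B(3)])
  moreover have "R `` (T (- n) ` V) \<subseteq> T (- n) ` V" using sat_T_image[OF VM] V(2) by auto
  ultimately have "T (- n) ` V = {}" by (intro nwdD[OF assms openin_T_image[OF V(1)]])
  then show "V = {}" by simp
qed

lemma nwd_Un:
  assumes "nwd A" "nwd B" shows "nwd (A \<union> B)"
  unfolding nwd_def
proof (intro conjI allI impI)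
  show "closedin X (A \<union> B)" using nwd_closedin[OF assms(1)] nwd_closedin[OF assms(2)] by (rule closedin_Un)
  show "R `` (A \<union> B) \<subseteq> A \<union> B" using nwd_sat[OF assms(1)] nwd_sat[OF assms(2)] by blast
  fix V assume V: "openin X V" "R `` V \<subseteq> V" "V \<subseteq> A \<union> B"
  have "R `` (V - A) \<subseteq> V - A"
  proof
    fix y assume "y \<in> R `` (V - A)"
    then obtain x where x: "x \<in> V" "x \<notin> A" "(x, y) \<in> R" by auto
    moreover have "y \<notin> A" using x R_sym[OF x(3)] nwd_sat[OF assms(1)] by blast
    ultimately show "y \<in> V - A" using V(2) by blast
  qed
  moreover have "openin X (V - A)" using V(1) nwd_closedin[OF assms(1)] by (rule openin_diff)
  moreover have "V - A \<subseteq> B" using V(3) by blast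
  ultimately have "V - A = {}" by (intro nwdD[OF assms(2)])
  then have "V \<subseteq> A" by blast
  then show "V = {}" by (rule nwdD[OF assms(1) V(1,2)])
qed

text \<open>Rational levels keep the family countable. The translates \<open>T i\<close> are
  included to make the set \<open>C\<close> of continuity points invariant.\<close>

definition "sets_family = (\<lambda>(i, n, q). T i ` {x \<in> M. h n x \<le> of_rat q}) ` UNIV"

lemma countable_sets_family: "countable sets_family"
  unfolding sets_family_def by (rule countable_image) simp

lemma sets_family_closed: assumes "F \<in> sets_family" shows "closedin X F"
proof -
  obtain i n q where F: "F = T i ` {x \<in> M. h n x \<in> {..of_rat q}}"
    using assms by (auto simp: sets_family_def)
  have "closedin X {x \<in> M. h n x \<in> {..of_rat q}}"
    by (rule closedin_continuous_map_preimage[OF h_cont]) auto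
  then show ?thesis unfolding F by (rule closedin_T_image)
qed

lemma sets_family_base:
  assumes "openin X U" "x \<in> U" shows "\<exists>F\<in>sets_family. x \<in> F \<and> F \<subseteq> U"
proof -
  obtain n r where r: "h n x < r" "{y \<in> M. h n y < r} \<subseteq> U" using h_base[OF assms] by blast
  obtain q where q: "h n x < of_rat q" "of_rat q < r" using of_rat_dense[OF r(1)] by blast
  let ?F = "{y \<in> M. h n y \<le> of_rat q}"
  have "x \<in> M" using assms openin_subset by blast
  then have "x \<in> ?F" "?F \<subseteq> U" using q r by auto
  moreover have "?F \<in> sets_family"
    unfolding sets_family_def by (rule image_eqI[of _ _ "(0, n, q)"]) (simp_all add: int_iterate_0)
  ultimately show ?thesis by (intro bexI[of _ ?F] conjI)
qed

lemma sets_family_T: assumes "F \<in> sets_family" shows "T k ` F \<in> sets_family"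
proof -
  obtain i n q where F: "F = T i ` {x \<in> M. h n x \<le> of_rat q}"
    using assms by (auto simp: sets_family_def)
  have "T k ` F = T (k + i) ` {x \<in> M. h n x \<le> of_rat q}"
    unfolding F image_image by (intro image_cong) (simp_all add: T_add)
  then show ?thesis unfolding sets_family_def by (intro image_eqI[of _ _ "(k + i, n, q)"]) simp_all
qed

text \<open>The preimage of the complement of the boundary of the image of \<open>F\<close> in the quotient by \<open>R\<close>.\<close>
definition "good F = (M - R `` F) \<union> {x \<in> M. R `` {x} \<subseteq> X interior_of (R `` F)}"

lemma openin_good: "closedin X F \<Longrightarrow> openin X (good F)"
  unfolding good_def by (intro openin_Un openin_diff openin_sat_interior closedin_sat) auto

lemma good_sat: assumes "x \<in> good F" "(x, y) \<in> R" shows "y \<in> good F"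
proof -
  have "R `` {x} = R `` {y}" "y \<in> M" using R_class_eq R_in assms by auto
  moreover have "x \<in> R `` F \<longleftrightarrow> y \<in> R `` F" using assms(2) R_sym R_trans by blast
  ultimately show ?thesis using assms(1) unfolding good_def by auto
qed

text \<open>Read in the quotient: the boundary of a closed set is nowhere dense.\<close>

lemma nwd_bad: assumes "closedin X F" shows "nwd (M - good F)"
  unfolding nwd_def
proof (intro conjI allI impI)
  show "closedin X (M - good F)" using openin_good[OF assms] by blast
  show "R `` (M - good F) \<subseteq> M - good F" using good_sat R_sym R_in by blast
  fix V assume V: "openin X V" "R `` V \<subseteq> V" "V \<subseteq> M - good F"
  have "V \<subseteq> R `` F" using V(3) by (auto simp: good_def)
  then have int: "V \<subseteq> X interior_of (R `` F)" using V(1) by (simp add: interior_of_maximal)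
  have "x \<in> good F" if "x \<in> V" for x
  proof -
    have "R `` {x} \<subseteq> V" using that V(2) by blast
    then show ?thesis using int that V(3) by (auto simp: good_def)
  qed
  then show "V = {}" using V(3) by blast
qed

text \<open>This transfers nowhere density from the quotient to X, so that Baire's theorem can be
  used in X. If \<open>V\<close> were non-empty, finitely many of its translates would cover the
  space, and so would those of \<open>B\<close>; but \<open>nwd\<close> passes to translates and
  finite unions, and fails for a non-empty whole space.\<close>

lemma nwd_empty_interior:
  assumes "nwd B" "openin X V" "V \<subseteq> B" shows "V = {}"
proof (rule ccontr)
  assume "V \<noteq> {}"
  then obtain v where v: "v \<in> V" by auto
  have "M \<subseteq> \<Union>(range (\<lambda>n. T n ` V))"
  proof
    fix x assume x: "x \<in> M"
    have "v \<in> X closure_of range (\<lambda>n. T n x)"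
      using minimal x v openin_subset[OF assms(2)] by (auto simp: minimal_tds_def)
    then have "\<exists>y. y \<in> range (\<lambda>n. T n x) \<and> y \<in> V" using v assms(2) by (simp add: in_closure_of)
    then obtain n where "T n x \<in> V" by auto
    then show "x \<in> \<Union>(range (\<lambda>n. T n ` V))"
      using T_inverse(1)[OF x, of n] by (metis UN_I UNIV_I imageI)
  qed
  moreover have "openin X U" if "U \<in> range (\<lambda>n. T n ` V)" for U
    using that openin_T_image[OF assms(2)] by auto
  ultimately obtain \<F> where \<F>: "finite \<F>" "\<F> \<subseteq> range (\<lambda>n. T n ` V)" "M \<subseteq> \<Union>\<F>"
    using compactinD[of X M "range (\<lambda>n. T n ` V)"] compact unfolding compact_space_def by blast
  then obtain I where I: "finite I" "M \<subseteq> (\<Union>n\<in>I. T n ` V)" by (metis finite_subset_image)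
  have "nwd (\<Union>n\<in>J. T n ` B)" if "finite J" for J
    using that
  proof induction
    case empty
    show ?case by (auto simp: nwd_def)
  next
    case (insert n J)
    then show ?case using nwd_Un[OF nwd_T_image[OF assms(1)]] by simp
  qed
  then have "nwd (\<Union>n\<in>I. T n ` B)" using I(1) by blast
  moreover have "M \<subseteq> (\<Union>n\<in>I. T n ` B)" using I(2) assms(3) by blast
  moreover have "R `` M \<subseteq> M" using R_in by blast
  ultimately have "M = {}" by (intro nwdD[of _ M]) auto
  then show False using v openin_subset[OF assms(2)] by auto
qed

lemma good_dense: assumes "closedin X F" shows "X closure_of (good F) = M"
proof -
  have "X interior_of (M - good F) = {}"
    by (rule nwd_empty_interior[OF nwd_bad[OF assms]]) (auto simp: interior_of_subset)
  then have "M - X closure_of (good F) = {}" by (simp add: interior_of_complement)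
  then show ?thesis using closure_of_subset_topspace[of X "good F"] by auto
qed

text \<open>The points at which fibres vary continuously. Upper semicontinuity holds everywhere
  because \<open>R\<close> is closed; lying in \<open>good F\<close> adds that if the fibre meets
  \<open>F\<close>, then so do all nearby fibres.\<close>

definition "C = M \<inter> \<Inter>(good ` sets_family)"

lemma C_M: "C \<subseteq> M" by (simp add: C_def)

lemma C_dense_gdelta: "dense_gdelta X C"
  unfolding C_def
  by (rule dense_gdelta_Inter[OF compact metrizable])
    (use countable_sets_family openin_good good_dense sets_family_closed in auto)

lemma C_sat: "x \<in> C \<Longrightarrow> (x, y) \<in> R \<Longrightarrow> y \<in> C"
  unfolding C_def using good_sat R_in by blast

lemma C_T: assumes "x \<in> C" shows "T k x \<in> C"
proof -
  have x: "x \<in> M" using assms C_M by blast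
  have "T k x \<in> good F" if F: "F \<in> sets_family" for F
  proof -
    let ?F = "T (- k) ` F"
    have F': "?F \<in> sets_family" by (rule sets_family_T[OF F])
    have FM: "F \<subseteq> M" "?F \<subseteq> M"
      by (rule closedin_subset[OF sets_family_closed], fact)+
    have sat: "R `` F = T k ` (R `` ?F)"
      using sat_T_image[OF FM(2), of k] unfolding T_image_inverse(2)[OF FM(1), of k] .
    have "x \<in> good ?F" using assms F' by (simp add: C_def)
    then consider "x \<notin> R `` ?F" | "R `` {x} \<subseteq> X interior_of (R `` ?F)" unfolding good_def by blast
    then show ?thesis
    proof cases
      case 1
      have "T k x \<notin> R `` F"
      proof
        assume "T k x \<in> R `` F"
        then obtain y where y: "y \<in> R `` ?F" "T k x = T k y" unfolding sat by (rule imageE)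
        from y(1) obtain u where "(u, y) \<in> R" by (rule ImageE)
        then have "y \<in> M" using R_in[of u y] by blast
        then have "x = y" using T_inverse(1)[OF x, of k] T_inverse(1)[of y k] y(2) by metis
        then show False using 1 y(1) by simp
      qed
      then show ?thesis using T_in[OF x] by (simp add: good_def)
    next
      case 2
      have "R `` {T k x} = T k ` (R `` {x})" using sat_T_image[of "{x}" k] x by simp
      also have "\<dots> \<subseteq> T k ` (X interior_of (R `` ?F))" using 2 by (rule image_mono)
      also have "\<dots> \<subseteq> X interior_of (R `` F)"
        unfolding sat
        by (intro interior_of_maximal image_mono interior_of_subset openin_T_image openin_interior_of)
      finally show ?thesis using T_in[OF x] by (simp add: good_def)
    qed
  qed
  then show ?thesis using T_in[OF x] by (simp add: C_def)
qed

section \<open>The almost one-to-one modifications\<close>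

text \<open>A closed set \<open>K\<close> is coded by the sequence of the minima of the \<open>h n\<close> over \<open>K\<close>; \<open>\<kappa>\<close> recovers
  \<open>K\<close> from its code. The code of the fibre of \<open>x\<close> is \<open>code x\<close>, so that \<open>Yset\<close> represents
  the closure of the set of fibres of points of \<open>C\<close> in the hyperspace of \<open>X\<close>.\<close>

abbreviation "XE \<equiv> prod_topology X (euclidean :: (nat \<Rightarrow> real) topology)"

definition "\<kappa> \<psi> = {x \<in> M. \<forall>n. \<psi> n \<le> h n x}"

definition "code x = (\<lambda>n. Inf (h n ` (R `` {x})))"

definition "Yset = closure (code ` C)"

definition "Xset = {w. snd w \<in> Yset \<and> fst w \<in> \<kappa> (snd w)}"

definition "Xtop = subtopology XE Xset"

lemma compactin_class: assumes "x \<in> M" shows "compactin X (R `` {x})"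
  using closedin_sat[of "{x}"] assms Hausdorff compact
  by (simp add: closedin_Hausdorff_singleton closedin_compact_space)

lemma class_self: "x \<in> M \<Longrightarrow> x \<in> R `` {x}"
  using R_refl by blast

lemma code_attained:
  assumes "x \<in> M" obtains y where "y \<in> R `` {x}" "h n y = code x n"
  using attains_Inf[OF compactin_class[OF assms] _ h_cont[of n]] class_self[OF assms]
  unfolding code_def by blast

lemma code_le: assumes "(x, y) \<in> R" shows "code x n \<le> h n y"
proof -
  have "x \<in> M" using R_in assms by blast
  then show ?thesis
    using attains_Inf[OF compactin_class _ h_cont[of n], of x] class_self[of x] assms
    unfolding code_def by (metis Image_singleton_iff empty_iff)
qed

text \<open>If \<open>y\<close> lies outside the closed class, some sublevel set of an
  \<open>h n\<close> contains \<open>y\<close> and misses the class, so the minimum of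
  \<open>h n\<close> over the class exceeds \<open>h n y\<close>.\<close>

lemma \<kappa>_code: assumes x: "x \<in> M" shows "\<kappa> (code x) = R `` {x}"
proof
  show "R `` {x} \<subseteq> \<kappa> (code x)"
  proof
    fix y assume "y \<in> R `` {x}"
    then have "(x, y) \<in> R" by simp
    then show "y \<in> \<kappa> (code x)" using code_le R_in[of x y] by (simp add: \<kappa>_def)
  qed
  show "\<kappa> (code x) \<subseteq> R `` {x}"
  proof
    fix y assume y: "y \<in> \<kappa> (code x)"
    show "y \<in> R `` {x}"
    proof (rule ccontr)
      assume "y \<notin> R `` {x}"
      moreover have "openin X (M - R `` {x})"
        using compactin_imp_closedin[OF Hausdorff compactin_class[OF x]] by (simp add: openin_diff)
      ultimately obtain n r where r: "h n y < r" "{z \<in> M. h n z < r} \<subseteq> M - R `` {x}"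
        using h_base[of "M - R `` {x}" y] y by (auto simp: \<kappa>_def)
      obtain z where z: "z \<in> R `` {x}" "h n z = code x n" using code_attained[OF x] .
      have "code x n \<le> h n y" using y by (simp add: \<kappa>_def)
      moreover have "z \<in> M" using z(1) R_in by blast
      ultimately have "z \<in> {z \<in> M. h n z < r}" using r(1) z(2) by simp
      then show False using r(2) z(1) by blast
    qed
  qed
qed

lemma continuous_snd_coord: "continuous_map XE euclideanreal (\<lambda>w. snd w n)"
proof -
  have "continuous_map euclidean euclideanreal (\<lambda>\<psi> :: nat \<Rightarrow> real. \<psi> n)"
    by simp
  then have "continuous_map XE euclideanreal ((\<lambda>\<psi>. \<psi> n) \<circ> snd)"
    by (rule continuous_map_compose[OF continuous_map_snd])
  then show ?thesis by (simp add: comp_def)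
qed

lemma continuous_h_fst: "continuous_map XE euclideanreal (\<lambda>w. h n (fst w))"
  using continuous_map_compose[OF continuous_map_fst h_cont] by (simp add: comp_def)

lemma continuous_defect: "continuous_map XE euclideanreal (\<lambda>w. snd w n - h n (fst w))"
  by (intro continuous_map_diff continuous_snd_coord continuous_h_fst)

definition "coded = (\<Inter>n. {w \<in> topspace XE. snd w n - h n (fst w) \<in> {..0}})"

lemma coded_iff: "w \<in> coded \<longleftrightarrow> fst w \<in> \<kappa> (snd w)"
  by (cases w) (auto simp: coded_def \<kappa>_def)

lemma closedin_coded: "closedin XE coded"
proof -
  have "closedin XE {w \<in> topspace XE. snd w n - h n (fst w) \<in> {..0}}" for n
    by (rule closedin_continuous_map_preimage[OF continuous_defect]) simp
  then show ?thesis unfolding coded_def by (intro closedin_INT) simp_all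
qed

lemma code_in_Yset: "c \<in> C \<Longrightarrow> code c \<in> Yset"
  unfolding Yset_def by (rule subsetD[OF closure_subset imageI])

text \<open>Attainment is a closed condition on pairs, and projection along the compact space X is a
  closed map, so it passes from codes to their limits. Thus every element of \<open>Yset\<close> is
  still the sequence of minima over its own \<open>\<kappa>\<close>.\<close>

lemma Yset_attained:
  assumes "\<psi> \<in> Yset" shows "\<exists>x\<in>\<kappa> \<psi>. h n x = \<psi> n"
proof -
  let ?Z = "coded \<inter> {w \<in> topspace XE. snd w n - h n (fst w) \<in> {0}}"
  have "closedin XE ?Z"
    by (rule closedin_Int[OF closedin_coded closedin_continuous_map_preimage[OF continuous_defect]]) simp
  then have "closed (snd ` ?Z)"
    using Abstract_Topological_Spaces.closed_map_snd[OF compact, of "euclidean :: (nat \<Rightarrow> real) topology"]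
    by (simp add: closed_map_def)
  moreover have "code ` C \<subseteq> snd ` ?Z"
  proof
    fix \<phi> assume "\<phi> \<in> code ` C"
    then obtain c where c: "c \<in> M" "\<phi> = code c" using C_M by blast
    obtain y where y: "y \<in> R `` {c}" "h n y = code c n" using code_attained[OF c(1)] .
    have "y \<in> M" using y(1) R_in by blast
    then have "(y, code c) \<in> ?Z" using y \<kappa>_code[OF c(1)] by (simp add: coded_iff)
    then show "\<phi> \<in> snd ` ?Z" unfolding c(2) by force
  qed
  ultimately have "Yset \<subseteq> snd ` ?Z" unfolding Yset_def by (rule closure_minimal[rotated])
  then have "\<psi> \<in> snd ` ?Z" using assms by (rule subsetD)
  then obtain w where "w \<in> ?Z" "\<psi> = snd w" by (rule imageE)
  then show ?thesis by (intro bexI[of _ "fst w"]) (auto simp: coded_iff)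
qed

lemma \<kappa>_nonempty: "\<psi> \<in> Yset \<Longrightarrow> \<kappa> \<psi> \<noteq> {}"
  using Yset_attained by blast

lemma \<kappa>_M: "x \<in> \<kappa> \<psi> \<Longrightarrow> x \<in> M"
  by (simp add: \<kappa>_def)

lemma \<kappa>_inj:
  assumes "\<psi> \<in> Yset" "\<phi> \<in> Yset" "\<kappa> \<psi> = \<kappa> \<phi>" shows "\<psi> = \<phi>"
proof
  fix n
  obtain x y where xy: "x \<in> \<kappa> \<psi>" "h n x = \<psi> n" "y \<in> \<kappa> \<phi>" "h n y = \<phi> n"
    using Yset_attained assms(1,2) by metis
  then have "x \<in> \<kappa> \<phi>" "y \<in> \<kappa> \<psi>" using assms(3) by auto
  then have "\<phi> n \<le> h n x" "\<psi> n \<le> h n y" by (simp_all add: \<kappa>_def)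
  then show "\<psi> n = \<phi> n" using xy by simp
qed

text \<open>Lower semicontinuity of \<open>\<kappa>\<close> on \<open>Yset\<close>, the source of
  the openness of \<pi>'. If \<open>\<phi> n < r\<close>, the point of
  \<open>\<kappa> \<phi>\<close> where \<open>h n\<close> attains \<open>\<phi> n\<close> lies in a
  sublevel set inside \<open>U\<close>.\<close>

lemma \<kappa>_lower:
  assumes "x \<in> \<kappa> \<psi>" "openin X U" "x \<in> U"
  shows "\<exists>n r. \<psi> n < r \<and> (\<forall>\<phi>\<in>Yset. \<phi> n < r \<longrightarrow> (\<exists>y\<in>\<kappa> \<phi>. y \<in> U))"
proof -
  obtain n r where r: "h n x < r" "{y \<in> M. h n y < r} \<subseteq> U" using h_base[OF assms(2,3)] by blast
  have "\<psi> n \<le> h n x" using assms(1) by (simp add: \<kappa>_def)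
  then have "\<psi> n < r" using r(1) by simp
  moreover have "\<exists>y\<in>\<kappa> \<phi>. y \<in> U" if \<phi>: "\<phi> \<in> Yset" "\<phi> n < r" for \<phi>
  proof -
    obtain y where "y \<in> \<kappa> \<phi>" "h n y = \<phi> n" using Yset_attained[OF \<phi>(1)] by blast
    then show ?thesis using \<phi>(2) r(2) \<kappa>_M[of y \<phi>] by (intro bexI[of _ y]) auto
  qed
  ultimately show ?thesis by blast
qed

lemma open_coord_less: "open {\<phi> :: nat \<Rightarrow> real. \<phi> n < r}" "open {\<phi> :: nat \<Rightarrow> real. r < \<phi> n}"
  by (auto intro!: open_Collect_less continuous_intros continuous_on_product_coordinates)

lemma Yset_approx:
  assumes "\<psi> \<in> Yset" "open G" "\<psi> \<in> G" obtains c where "c \<in> C" "code c \<in> G"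
proof -
  have "code ` C \<inter> G \<noteq> {}"
    using assms unfolding Yset_def closure_iff_nhds_not_empty by (metis order_refl)
  then show ?thesis using that by auto
qed

text \<open>Limits of fibres stay within one fibre because \<open>R\<close> is closed: otherwise a
  genuine fibre nearby would meet two open sets whose product misses \<open>R\<close>.\<close>

lemma \<kappa>_class:
  assumes "\<psi> \<in> Yset" "x \<in> \<kappa> \<psi>" "y \<in> \<kappa> \<psi>" shows "(x, y) \<in> R"
proof (rule ccontr)
  assume "(x, y) \<notin> R"
  then have "(x, y) \<in> topspace (prod_topology X X) - R" using \<kappa>_M[OF assms(2)] \<kappa>_M[OF assms(3)] by auto
  moreover have "openin (prod_topology X X) (topspace (prod_topology X X) - R)"
    using closedin_R by blast
  ultimately have "\<exists>U V. openin X U \<and> openin X V \<and> x \<in> U \<and> y \<in> V \<and> U \<times> V \<subseteq> topspace (prod_topology X X) - R"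
    by (intro openin_prod_topologyD)
  then obtain U V where UV: "openin X U" "openin X V" "x \<in> U" "y \<in> V" "U \<times> V \<inter> R = {}" by blast
  obtain n r where n: "\<psi> n < r" "\<And>\<phi>. \<phi> \<in> Yset \<Longrightarrow> \<phi> n < r \<Longrightarrow> \<exists>y\<in>\<kappa> \<phi>. y \<in> U"
    using \<kappa>_lower[OF assms(2) UV(1,3)] by meson
  obtain m s where m: "\<psi> m < s" "\<And>\<phi>. \<phi> \<in> Yset \<Longrightarrow> \<phi> m < s \<Longrightarrow> \<exists>y\<in>\<kappa> \<phi>. y \<in> V"
    using \<kappa>_lower[OF assms(3) UV(2,4)] by meson
  have "open ({\<phi>. \<phi> n < r} \<inter> {\<phi>. \<phi> m < s})" by (intro open_Int open_coord_less)
  then obtain c where c: "c \<in> C" "code c n < r" "code c m < s"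
    using Yset_approx[OF assms(1)] n(1) m(1) by blast
  obtain u where u: "u \<in> \<kappa> (code c)" "u \<in> U" using n(2)[OF code_in_Yset[OF c(1)] c(2)] by blast
  obtain v where v: "v \<in> \<kappa> (code c)" "v \<in> V" using m(2)[OF code_in_Yset[OF c(1)] c(3)] by blast
  have "(c, u) \<in> R" "(c, v) \<in> R" using u(1) v(1) \<kappa>_code[of c] c(1) C_M by auto
  then have "(u, v) \<in> R" using R_trans[OF R_sym] by blast
  then show False using UV(5) u(2) v(2) by blast
qed

text \<open>Over \<open>C\<close> the code is determined: by the choice of \<open>C\<close>, if some \<open>y\<close> in the fibre of \<open>c\<close> were not
  in \<open>\<kappa> \<psi>\<close>, then all fibres near that of \<open>c\<close> would still come close to \<open>y\<close>.\<close>
lemma code_unique: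
  assumes c: "c \<in> C" and \<psi>: "\<psi> \<in> Yset" and x: "x \<in> \<kappa> \<psi>" "(c, x) \<in> R"
  shows "\<psi> = code c"
proof -
  have cM: "c \<in> M" using c C_M by blast
  have "\<kappa> \<psi> = R `` {c}"
  proof
    show "\<kappa> \<psi> \<subseteq> R `` {c}" using \<kappa>_class[OF \<psi> x(1)] R_trans[OF x(2)] by blast
    show "R `` {c} \<subseteq> \<kappa> \<psi>"
    proof
      fix y assume "y \<in> R `` {c}"
      then have y: "(c, y) \<in> R" "y \<in> M" using R_in[of c y] by auto
      show "y \<in> \<kappa> \<psi>"
      proof (rule ccontr)
        assume "y \<notin> \<kappa> \<psi>"
        then obtain n where n: "h n y < \<psi> n" using y(2) by (auto simp: \<kappa>_def not_le)
        \<comment> \<open>The midpoint leaves room on both sides: \<open>h n\<close> is below it on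
          \<open>F\<close>, while the \<open>n\<close>-th entry of codes near \<open>\<psi>\<close>
          is above it.\<close>
        let ?r = "(h n y + \<psi> n) / 2"
        have "openin X {z \<in> M. h n z \<in> {..<?r}}"
          by (rule openin_continuous_map_preimage[OF h_cont]) simp
        moreover have "y \<in> {z \<in> M. h n z \<in> {..<?r}}" using y(2) n by simp
        ultimately obtain F where F: "F \<in> sets_family" "y \<in> F" "F \<subseteq> {z \<in> M. h n z \<in> {..<?r}}"
          using sets_family_base by meson
        have "c \<in> good F" using c F(1) by (simp add: C_def)
        moreover have "c \<in> R `` F" using F(2) R_sym[OF y(1)] by blast
        ultimately have "R `` {c} \<subseteq> X interior_of (R `` F)" by (simp add: good_def)
        then have "x \<in> X interior_of (R `` F)" using x(2) by blast
        then obtain m s where m: "\<psi> m < s"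
          "\<And>\<phi>. \<phi> \<in> Yset \<Longrightarrow> \<phi> m < s \<Longrightarrow> \<exists>y\<in>\<kappa> \<phi>. y \<in> X interior_of (R `` F)"
          using \<kappa>_lower[OF x(1) openin_interior_of] by meson
        have "open ({\<phi>. \<phi> m < s} \<inter> {\<phi>. ?r < \<phi> n})" by (intro open_Int open_coord_less)
        moreover have "\<psi> \<in> {\<phi>. \<phi> m < s} \<inter> {\<phi>. ?r < \<phi> n}" using m(1) n by simp
        ultimately obtain b where b: "b \<in> C" "code b \<in> {\<phi>. \<phi> m < s} \<inter> {\<phi>. ?r < \<phi> n}"
          by (rule Yset_approx[OF \<psi>])
        then obtain u where u: "u \<in> \<kappa> (code b)" "u \<in> X interior_of (R `` F)"
          using m(2)[OF code_in_Yset[OF b(1)]] by blast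
        have "(b, u) \<in> R" using u(1) \<kappa>_code[of b] b(1) C_M by auto
        moreover obtain f where f: "f \<in> F" "(f, u) \<in> R" using u(2) interior_of_subset by fast
        ultimately have "(b, f) \<in> R" using R_trans[OF _ R_sym] by blast
        then have "code b n \<le> h n f" by (rule code_le)
        moreover have "h n f < ?r" using F(3) f(1) by auto
        ultimately show False using b(2) by simp
      qed
    qed
  qed
  then show ?thesis using \<kappa>_inj[OF \<psi> code_in_Yset[OF c]] \<kappa>_code[OF cM] by simp
qed

lemma compact_Yset: "compact Yset"
proof -
  have "compact (h n ` M)" for n
    using image_compactin[OF _ h_cont[of n], of M] compact by (simp add: compact_space_def)
  then have "compactin (product_topology (\<lambda>_. euclideanreal) UNIV) (PiE UNIV (\<lambda>n. h n ` M))"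
    by (simp add: compactin_PiE)
  then have P: "compact (PiE UNIV (\<lambda>n :: nat. h n ` M))" by (simp add: euclidean_product_topology)
  have "code c \<in> PiE UNIV (\<lambda>n. h n ` M)" if "c \<in> C" for c
  proof -
    have "code c n \<in> h n ` M" for n
    proof -
      have "c \<in> M" using that C_M by blast
      then obtain y where y: "y \<in> R `` {c}" "h n y = code c n" by (rule code_attained)
      then have "y \<in> M" using R_in by blast
      then show ?thesis using y(2) by (metis imageI)
    qed
    then show ?thesis by (intro PiE_I) simp_all
  qed
  then have "Yset \<subseteq> PiE UNIV (\<lambda>n. h n ` M)"
    unfolding Yset_def by (intro closure_minimal compact_imp_closed[OF P]) auto
  then show ?thesis using P closed_closure compact_Int_closed[OF P, of Yset]
    by (simp add: Yset_def Int_absorb1)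
qed

lemma topspace_Xtop: "topspace Xtop = Xset"
  by (auto simp: Xtop_def Xset_def \<kappa>_M)

lemma compact_Xtop: "compact_space Xtop"
proof -
  have "Xset = coded \<inter> M \<times> Yset" by (auto simp: Xset_def coded_iff \<kappa>_M)
  moreover have "compactin XE (M \<times> Yset)"
    using compact compact_Yset by (simp add: compactin_Times compact_space_def)
  ultimately have "compactin XE Xset"
    using closed_Int_compactin[OF closedin_coded] by simp
  then show ?thesis by (simp add: Xtop_def compact_space_subtopology)
qed

lemma continuous_fst: "continuous_map Xtop X fst"
  unfolding Xtop_def by (intro continuous_map_from_subtopology continuous_map_fst)

lemma continuous_snd: "continuous_map Xtop (top_of_set Yset) snd"
  unfolding Xtop_def continuous_map_in_subtopology
  by (auto simp: Xset_def intro: continuous_map_from_subtopology continuous_map_snd)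

lemma image_snd: "snd ` Xset = Yset"
proof
  show "Yset \<subseteq> snd ` Xset"
  proof
    fix \<psi> assume \<psi>: "\<psi> \<in> Yset"
    then obtain x where "x \<in> \<kappa> \<psi>" using \<kappa>_nonempty by blast
    then show "\<psi> \<in> snd ` Xset" using \<psi> by (intro image_eqI[of _ _ "(x, \<psi>)"]) (auto simp: Xset_def)
  qed
qed (auto simp: Xset_def)

lemma closed_map_Xtop_snd: "closed_map Xtop (top_of_set Yset) snd"
  using T1_Spaces.continuous_imp_closed_map[OF continuous_snd compact_Xtop]
  by (simp add: Hausdorff_space_subtopology)

lemma open_map_Xtop_snd: "open_map Xtop (top_of_set Yset) snd"
  unfolding open_map_def
proof (intro allI impI)
  fix G assume G: "openin Xtop G"
  then obtain H where H: "openin XE H" "G = H \<inter> Xset"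
    unfolding Xtop_def openin_subtopology by blast
  show "openin (top_of_set Yset) (snd ` G)"
  proof (subst openin_subopen, intro ballI)
    fix \<psi> assume "\<psi> \<in> snd ` G"
    then obtain x where x: "(x, \<psi>) \<in> H" "x \<in> \<kappa> \<psi>" "\<psi> \<in> Yset" by (auto simp: H(2) Xset_def)
    obtain U V where UV: "openin X U" "open V" "x \<in> U" "\<psi> \<in> V" "U \<times> V \<subseteq> H"
      using openin_prod_topologyD[OF H(1) x(1)] by auto
    obtain n r where n: "\<psi> n < r" "\<And>\<phi>. \<phi> \<in> Yset \<Longrightarrow> \<phi> n < r \<Longrightarrow> \<exists>y\<in>\<kappa> \<phi>. y \<in> U"
      using \<kappa>_lower[OF x(2) UV(1,3)] by meson
    let ?W = "Yset \<inter> (V \<inter> {\<phi>. \<phi> n < r})"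
    have "openin (top_of_set Yset) ?W" using UV(2) open_coord_less by (intro openin_open_Int open_Int)
    moreover have "\<psi> \<in> ?W" using x(3) UV(4) n(1) by simp
    moreover have "?W \<subseteq> snd ` G"
    proof
      fix \<phi> assume \<phi>: "\<phi> \<in> ?W"
      then obtain y where y: "y \<in> \<kappa> \<phi>" "y \<in> U" using n(2)[of \<phi>] by blast
      have "(y, \<phi>) \<in> H" using y(2) \<phi> UV(5) by blast
      moreover have "(y, \<phi>) \<in> Xset" using y(1) \<phi> by (simp add: Xset_def)
      ultimately have "(y, \<phi>) \<in> G" by (simp add: H(2))
      then show "\<phi> \<in> snd ` G" by force
    qed
    ultimately show "\<exists>T. openin (top_of_set Yset) T \<and> \<psi> \<in> T \<and> T \<subseteq> snd ` G" by blast
  qed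
qed

lemma quotient_map_Xtop_snd: "quotient_map Xtop (top_of_set Yset) snd"
  using continuous_open_imp_quotient_map[OF continuous_snd open_map_Xtop_snd] image_snd
  by (simp add: topspace_Xtop)

text \<open>The map that \<open>T k\<close> induces on the hyperspace, written in codes.\<close>

definition "code_T k \<psi> = (\<lambda>n. Inf ((\<lambda>x. h n (T k x)) ` \<kappa> \<psi>))"

lemma continuous_h_T: "continuous_map X euclideanreal (\<lambda>x. h n (T k x))"
  using continuous_map_compose[OF cont_T h_cont] by (simp add: comp_def)

lemma compactin_\<kappa>: assumes "\<psi> \<in> Yset" shows "compactin X (\<kappa> \<psi>)"
proof -
  have "continuous_map X XE (\<lambda>x. (x, \<psi>))"
    by (simp add: continuous_map_pairwise comp_def)
  from closedin_continuous_map_preimage[OF this closedin_coded]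
  have "closedin X (\<kappa> \<psi>)" by (simp add: coded_iff \<kappa>_def Collect_conj_eq Int_absorb)
  then show ?thesis by (rule closedin_compact_space[OF compact])
qed

lemma code_T_props:
  assumes "\<psi> \<in> Yset"
  shows "\<exists>x\<in>\<kappa> \<psi>. h n (T k x) = code_T k \<psi> n" "x \<in> \<kappa> \<psi> \<Longrightarrow> code_T k \<psi> n \<le> h n (T k x)"
  using attains_Inf[OF compactin_\<kappa>[OF assms] \<kappa>_nonempty[OF assms] continuous_h_T[of n k]]
  unfolding code_T_def by metis+

text \<open>A minimum over the fibres of a map that is both open and closed is continuous: strict
  sublevel sets are images of open sets, and non-strict ones are images of closed sets.\<close>

lemma continuous_code_T: "continuous_map (top_of_set Yset) euclidean (code_T k)"
proof -
  have "continuous_map (top_of_set Yset) euclideanreal (\<lambda>\<psi>. code_T k \<psi> n)" for n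
  proof -
    let ?h = "\<lambda>w. h n (T k (fst w))"
    have cont: "continuous_map Xtop euclideanreal ?h"
      using continuous_map_compose[OF continuous_fst continuous_h_T] by (simp add: comp_def)
    have "openin (top_of_set Yset) {\<psi> \<in> Yset. code_T k \<psi> n < a}" for a
    proof -
      have "openin Xtop {w \<in> topspace Xtop. ?h w \<in> {..<a}}"
        by (rule openin_continuous_map_preimage[OF cont]) simp
      then have "openin (top_of_set Yset) (snd ` {w \<in> topspace Xtop. ?h w \<in> {..<a}})"
        using open_map_Xtop_snd unfolding open_map_def by blast
      moreover have "snd ` {w \<in> topspace Xtop. ?h w \<in> {..<a}} = {\<psi> \<in> Yset. code_T k \<psi> n < a}"
      proof (intro equalityI subsetI)
        fix \<psi> assume "\<psi> \<in> {\<psi> \<in> Yset. code_T k \<psi> n < a}"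
        then have \<psi>: "\<psi> \<in> Yset" "code_T k \<psi> n < a" by auto
        then obtain x where "x \<in> \<kappa> \<psi>" "h n (T k x) < a" using code_T_props(1)[OF \<psi>(1), of n k] by auto
        then have "(x, \<psi>) \<in> {w \<in> topspace Xtop. ?h w \<in> {..<a}}" using \<psi> by (simp add: topspace_Xtop Xset_def)
        then show "\<psi> \<in> snd ` {w \<in> topspace Xtop. ?h w \<in> {..<a}}" by force
      next
        fix \<psi> assume "\<psi> \<in> snd ` {w \<in> topspace Xtop. ?h w \<in> {..<a}}"
        then obtain x where "x \<in> \<kappa> \<psi>" "h n (T k x) < a" "\<psi> \<in> Yset" by (auto simp: topspace_Xtop Xset_def)
        then show "\<psi> \<in> {\<psi> \<in> Yset. code_T k \<psi> n < a}" using code_T_props(2)[of \<psi> x k n] by simp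
      qed
      ultimately show ?thesis by simp
    qed
    moreover have "openin (top_of_set Yset) {\<psi> \<in> Yset. code_T k \<psi> n > a}" for a
    proof -
      have "closedin Xtop {w \<in> topspace Xtop. ?h w \<in> {..a}}"
        by (rule closedin_continuous_map_preimage[OF cont]) simp
      then have "closedin (top_of_set Yset) (snd ` {w \<in> topspace Xtop. ?h w \<in> {..a}})"
        using closed_map_Xtop_snd unfolding closed_map_def by blast
      moreover have "snd ` {w \<in> topspace Xtop. ?h w \<in> {..a}} = {\<psi> \<in> Yset. code_T k \<psi> n \<le> a}"
      proof (intro equalityI subsetI)
        fix \<psi> assume "\<psi> \<in> {\<psi> \<in> Yset. code_T k \<psi> n \<le> a}"
        then have \<psi>: "\<psi> \<in> Yset" "code_T k \<psi> n \<le> a" by auto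
        then obtain x where "x \<in> \<kappa> \<psi>" "h n (T k x) \<le> a" using code_T_props(1)[OF \<psi>(1), of n k] by auto
        then have "(x, \<psi>) \<in> {w \<in> topspace Xtop. ?h w \<in> {..a}}" using \<psi> by (simp add: topspace_Xtop Xset_def)
        then show "\<psi> \<in> snd ` {w \<in> topspace Xtop. ?h w \<in> {..a}}" by force
      next
        fix \<psi> assume "\<psi> \<in> snd ` {w \<in> topspace Xtop. ?h w \<in> {..a}}"
        then obtain x where "x \<in> \<kappa> \<psi>" "h n (T k x) \<le> a" "\<psi> \<in> Yset" by (auto simp: topspace_Xtop Xset_def)
        then show "\<psi> \<in> {\<psi> \<in> Yset. code_T k \<psi> n \<le> a}" using code_T_props(2)[of \<psi> x k n] by simp
      qed
      ultimately have "openin (top_of_set Yset) (Yset - {\<psi> \<in> Yset. code_T k \<psi> n \<le> a})"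
        by (metis openin_diff openin_topspace topspace_euclidean_subtopology)
      moreover have "Yset - {\<psi> \<in> Yset. code_T k \<psi> n \<le> a} = {\<psi> \<in> Yset. code_T k \<psi> n > a}" by auto
      ultimately show ?thesis by simp
    qed
    ultimately show ?thesis
      unfolding continuous_map_upper_lower_semicontinuous_lt by simp
  qed
  then have "continuous_map (top_of_set Yset) (product_topology (\<lambda>_. euclideanreal) UNIV) (code_T k)"
    unfolding continuous_map_componentwise_UNIV by blast
  then show ?thesis unfolding euclidean_product_topology .
qed

lemma code_T_code: assumes "c \<in> M" shows "code_T k (code c) = code (T k c)"
proof -
  have "R `` {T k c} = T k ` (R `` {c})" using sat_T_image[of "{c}" k] assms by simp
  then show ?thesis unfolding code_T_def \<kappa>_code[OF assms] code_def[of "T k c"] by (simp add: image_image)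
qed

lemma code_T_in: assumes "\<psi> \<in> Yset" shows "code_T k \<psi> \<in> Yset"
proof -
  have "code_T k ` closure (code ` C) \<subseteq> closure (code_T k ` code ` C)"
  proof (rule image_closure_subset)
    show "continuous_on (closure (code ` C)) (code_T k)"
      using continuous_code_T by (simp add: Yset_def)
    show "code_T k ` code ` C \<subseteq> closure (code_T k ` code ` C)" by (rule closure_subset)
  qed auto
  also have "\<dots> \<subseteq> Yset"
    unfolding Yset_def using code_T_code C_M C_T by (intro closure_mono) force
  finally show ?thesis using assms unfolding Yset_def by blast
qed

text \<open>The identity is clear on codes of classes and extends by continuity to their
  closure.\<close>

lemma code_T_inverse: assumes "\<psi> \<in> Yset" shows "code_T (- k) (code_T k \<psi>) = \<psi>"
proof -
  have cont: "continuous_on Yset (\<lambda>\<psi>. code_T (- k) (code_T k \<psi>) n - \<psi> n)" for n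
  proof (intro continuous_on_diff)
    have "continuous_on Yset (\<lambda>\<psi>. code_T (- k) (code_T k \<psi>))"
      using continuous_code_T code_T_in
      by (intro continuous_on_compose2[of Yset "code_T (- k)" Yset "code_T k"]) auto
    then show "continuous_on Yset (\<lambda>\<psi>. code_T (- k) (code_T k \<psi>) n)"
      by (rule continuous_on_product_then_coordinatewise)
    show "continuous_on Yset (\<lambda>\<psi>. \<psi> n)" by (rule continuous_on_product_then_coordinatewise) simp
  qed
  have "code_T (- k) (code_T k \<psi>) n - \<psi> n = 0" for n
  proof (rule continuous_constant_on_closure[OF cont[of n, unfolded Yset_def]])
    show "code_T (- k) (code_T k \<phi>) n - \<phi> n = 0" if \<phi>: "\<phi> \<in> code ` C" for \<phi>
    proof -
      obtain c where c: "c \<in> M" "\<phi> = code c" using \<phi> C_M by blast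
      then show ?thesis by (simp add: code_T_code T_in T_inverse(1))
    qed
    show "\<psi> \<in> closure (code ` C)" using assms by (simp only: Yset_def)
  qed
  then show ?thesis by (simp add: fun_eq_iff)
qed

end

section \<open>Preimages, iterates and lifts of cubes along an extension\<close>

lemma gdelta_in_preimage:
  assumes f: "continuous_map Z Y f" and G: "gdelta_in Y G"
  shows "gdelta_in Z {z \<in> topspace Z. f z \<in> G}"
proof -
  obtain \<U> where \<U>: "countable \<U>" "\<And>U. U \<in> \<U> \<Longrightarrow> openin Y U" "\<Inter>\<U> = G"
    using G unfolding gdelta_in_alt intersection_of_def by auto
  let ?\<V> = "insert (topspace Z) ((\<lambda>U. {z \<in> topspace Z. f z \<in> U}) ` \<U>)"
  have "gdelta_in Z (\<Inter>?\<V>)"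
  proof (rule gdelta_in_Inter)
    show "countable ?\<V>" using \<U>(1) by simp
    fix V assume "V \<in> ?\<V>"
    then have "openin Z V" using openin_continuous_map_preimage[OF f \<U>(2)] by auto
    then show "gdelta_in Z V" by (rule open_imp_gdelta_in)
  qed simp
  moreover have "\<Inter>?\<V> = {z \<in> topspace Z. f z \<in> G}" using \<U>(3) by auto
  ultimately show ?thesis by simp
qed

lemma extension_int_iterate:
  assumes "compact_tds X S" "compact_tds Z P" "extension Z P X S f" "\<xi> \<in> topspace Z"
  shows "f (int_iterate Z P n \<xi>) = int_iterate X S n (f \<xi>)"
proof -
  interpret X: compact_tds X S by fact
  interpret Z: compact_tds Z P by fact
  have fM: "f \<zeta> \<in> topspace X" if "\<zeta> \<in> topspace Z" for \<zeta>
    using assms(3) that by (auto simp: extension_def)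
  have eq: "f (P \<zeta>) = S (f \<zeta>)" if "\<zeta> \<in> topspace Z" for \<zeta>
    using assms(3) that by (auto simp: extension_def)
  show ?thesis
  proof (induction n rule: int_induct[where k = 0])
    case base
    then show ?case by (simp add: int_iterate_0)
  next
    case (step1 i)
    then show ?case using eq[OF Z.T_in[OF assms(4)]] assms(4) fM[OF assms(4)]
      by (simp add: Z.T_Suc X.T_Suc)
  next
    case (step2 i)
    have "S (f (Z.T (i - 1) \<xi>)) = S (X.T (i - 1) (f \<xi>))"
      using step2 eq[OF Z.T_in[OF assms(4), of "i - 1"]] Z.T_Suc[OF assms(4), of "i - 1"]
        X.T_Suc[OF fM[OF assms(4)], of "i - 1"] by simp
    from inj_onD[OF X.inj_S this] show ?case
      using fM[OF Z.T_in[OF assms(4)]] X.T_in[OF fM[OF assms(4)]] by blast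
  qed
qed

text \<open>The image of the compact set of cubes upstairs is closed, and it contains all face
  points because their base points lift.\<close>

lemma cubes_lift:
  assumes "compact_tds X S" "compact_tds Z P" and ext: "extension Z P X S f" and c: "c \<in> cubes d X S"
  shows "\<exists>b\<in>cubes d Z P. \<forall>\<epsilon>\<in>cube_index d. f (b \<epsilon>) = c \<epsilon>"
proof -
  interpret X: compact_tds X S by fact
  interpret Z: compact_tds Z P by fact
  define \<Phi> where "\<Phi> b = (\<lambda>\<epsilon>\<in>cube_index d. f (b \<epsilon>))" for b
  have "continuous_map (cube_space d Z) (cube_space d X) \<Phi>"
  proof (rule continuous_into_cube_space)
    fix \<epsilon> assume \<epsilon>: "\<epsilon> \<in> cube_index d"
    have "continuous_map (cube_space d Z) X (f \<circ> (\<lambda>b. b \<epsilon>))"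
      using ext by (intro continuous_map_compose[OF continuous_cube_coord[OF \<epsilon>]]) (simp add: extension_def)
    then show "continuous_map (cube_space d Z) X (\<lambda>b. \<Phi> b \<epsilon>)" using \<epsilon> by (simp add: \<Phi>_def comp_def)
  qed (simp add: \<Phi>_def)
  then have "closed_map (cube_space d Z) (cube_space d X) \<Phi>"
    using T1_Spaces.continuous_imp_closed_map Z.compact_cube_space X.Hausdorff_cube_space by blast
  then have "closedin (cube_space d X) (\<Phi> ` cubes d Z P)"
    using Z.closedin_cubes unfolding closed_map_def by blast
  moreover have "face_point d X S n x \<in> \<Phi> ` cubes d Z P" if x: "x \<in> topspace X" for n x
  proof -
    obtain \<xi> where \<xi>: "\<xi> \<in> topspace Z" "x = f \<xi>" using ext x by (auto simp: extension_def)
    have "\<Phi> (face_point d Z P n \<xi>) = face_point d X S n x"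
      unfolding \<Phi>_def face_point_def[of d X]
    proof (rule restrict_ext)
      fix \<epsilon> assume "\<epsilon> \<in> cube_index d"
      then show "f (face_point d Z P n \<xi> \<epsilon>) = X.T (sum n \<epsilon>) x"
        using extension_int_iterate[OF assms(1,2) ext \<xi>(1)] by (simp add: face_point_def \<xi>(2))
    qed
    then show ?thesis using Z.face_point_cubes[OF \<xi>(1)] by (metis imageI)
  qed
  ultimately have "cubes d X S \<subseteq> \<Phi> ` cubes d Z P" by (rule X.cubes_minimal)
  then obtain b where "b \<in> cubes d Z P" "c = \<Phi> b" using c by blast
  then show ?thesis by (intro bexI[of _ b]) (simp_all add: \<Phi>_def)
qed

section \<open>The system of pairs and its two projections\<close>

context coded_minimal_tds
begin

definition "T_pair k w = (T k (fst w), code_T k (snd w))"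

lemma T_pair_in: assumes "w \<in> Xset" shows "T_pair k w \<in> Xset"
proof -
  have w: "snd w \<in> Yset" "fst w \<in> \<kappa> (snd w)" using assms by (auto simp: Xset_def)
  have "T k (fst w) \<in> \<kappa> (code_T k (snd w))"
    unfolding \<kappa>_def using code_T_props(2)[OF w] T_in[OF \<kappa>_M[OF w(2)]] by simp
  then show ?thesis using code_T_in[OF w(1)] by (simp add: Xset_def T_pair_def)
qed

lemma T_pair_inverse: assumes "w \<in> Xset" shows "T_pair (- k) (T_pair k w) = w"
proof -
  have w: "snd w \<in> Yset" "fst w \<in> M" using assms \<kappa>_M by (auto simp: Xset_def)
  show ?thesis using code_T_inverse[OF w(1)] T_inverse(1)[OF w(2)] by (simp add: T_pair_def)
qed

lemma continuous_T_pair: "continuous_map Xtop Xtop (T_pair k)"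
proof -
  have "continuous_map Xtop X (T k \<circ> fst)" by (rule continuous_map_compose[OF continuous_fst cont_T])
  moreover have "continuous_map Xtop euclidean (code_T k \<circ> snd)"
    by (rule continuous_map_compose[OF continuous_snd continuous_code_T])
  ultimately have "continuous_map Xtop XE (T_pair k)"
    by (simp add: continuous_map_pairwise comp_def T_pair_def)
  moreover have "T_pair k \<in> topspace Xtop \<rightarrow> Xset" using T_pair_in by (simp add: topspace_Xtop)
  ultimately show ?thesis
    using continuous_map_in_subtopology[of Xtop XE Xset "T_pair k"] unfolding Xtop_def[symmetric] by blast
qed

lemma homeomorphic_T_pair: "homeomorphic_map Xtop Xtop (T_pair k)"
  unfolding homeomorphic_map_maps homeomorphic_maps_def
  using continuous_T_pair T_pair_inverse[of _ k] T_pair_inverse[of _ "- k"]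
  by (intro exI[of _ "T_pair (- k)"]) (simp add: topspace_Xtop)

lemma homeomorphic_code_T: "homeomorphic_map (top_of_set Yset) (top_of_set Yset) (code_T k)"
proof -
  have "continuous_map (top_of_set Yset) (top_of_set Yset) (code_T j)" for j
    using continuous_code_T code_T_in by (simp add: continuous_map_in_subtopology)
  then show ?thesis
    unfolding homeomorphic_map_maps homeomorphic_maps_def
    using code_T_inverse[of _ k] code_T_inverse[of _ "- k"]
    by (intro exI[of _ "code_T (- k)"]) simp
qed

lemma Xset_code: "x \<in> C \<Longrightarrow> (x, code x) \<in> Xset"
  using code_in_Yset \<kappa>_code[of x] C_M class_self[of x] by (auto simp: Xset_def)

lemma Xset_unique:
  assumes "w \<in> Xset" "w' \<in> Xset" "fst w = fst w'" "fst w \<in> C" shows "w = w'"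
proof -
  have "(fst w, fst w) \<in> R" using assms(4) C_M R_refl by blast
  then have "snd w = code (fst w)" "snd w' = code (fst w)"
    using code_unique[OF assms(4)] assms(1-3) by (auto simp: Xset_def)
  then show ?thesis using assms(3) by (simp add: prod_eq_iff)
qed

text \<open>Lower semicontinuity puts a point of a genuine fibre near any given pair. That fibre
  lies wholly in \<open>C\<close>, because \<open>C\<close> is a union of classes.\<close>

lemma Xset_dense:
  assumes "openin Xtop G" "w \<in> G" shows "\<exists>w'\<in>G. fst w' \<in> C"
proof -
  obtain H where H: "openin XE H" "G = H \<inter> Xset"
    using assms(1) unfolding Xtop_def openin_subtopology by blast
  obtain x \<psi> where w: "w = (x, \<psi>)" by (cases w)
  have x: "(x, \<psi>) \<in> H" "x \<in> \<kappa> \<psi>" "\<psi> \<in> Yset" using assms(2) by (auto simp: H(2) Xset_def w)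
  obtain U V where UV: "openin X U" "open V" "x \<in> U" "\<psi> \<in> V" "U \<times> V \<subseteq> H"
    using openin_prod_topologyD[OF H(1) x(1)] by auto
  obtain n r where n: "\<psi> n < r" "\<And>\<phi>. \<phi> \<in> Yset \<Longrightarrow> \<phi> n < r \<Longrightarrow> \<exists>y\<in>\<kappa> \<phi>. y \<in> U"
    using \<kappa>_lower[OF x(2) UV(1,3)] by meson
  have "open (V \<inter> {\<phi>. \<phi> n < r})" using UV(2) open_coord_less by (intro open_Int)
  moreover have "\<psi> \<in> V \<inter> {\<phi>. \<phi> n < r}" using UV(4) n(1) by simp
  ultimately obtain c where c: "c \<in> C" "code c \<in> V \<inter> {\<phi>. \<phi> n < r}" by (rule Yset_approx[OF x(3)])
  then obtain y where y: "y \<in> \<kappa> (code c)" "y \<in> U" using n(2)[OF code_in_Yset[OF c(1)]] by blast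
  then have "(c, y) \<in> R" using \<kappa>_code[of c] c(1) C_M by auto
  then have "y \<in> C" by (rule C_sat[OF c(1)])
  moreover have "(y, code c) \<in> H" using y(2) c(2) UV(5) by blast
  moreover have "(y, code c) \<in> Xset" using y(1) code_in_Yset[OF c(1)] by (simp add: Xset_def)
  ultimately show ?thesis by (intro bexI[of _ "(y, code c)"]) (simp_all add: H(2))
qed

lemma image_fst: "fst ` Xset = M"
proof
  show "fst ` Xset \<subseteq> M" using \<kappa>_M by (auto simp: Xset_def)
  have "closed_map Xtop X fst"
    by (rule T1_Spaces.continuous_imp_closed_map[OF continuous_fst compact_Xtop Hausdorff])
  then have "closedin X (fst ` Xset)" unfolding closed_map_def using topspace_Xtop closedin_topspace by metis
  moreover have "C \<subseteq> fst ` Xset" using Xset_code by force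
  ultimately have "X closure_of C \<subseteq> fst ` Xset" by (rule closure_of_minimal[rotated])
  then show "M \<subseteq> fst ` Xset" using C_dense_gdelta by (simp add: dense_gdelta_def)
qed

text \<open>A limit of fibres may be smaller than the class containing it; saturating recovers the
  class.\<close>

definition "factor_map \<psi> = R `` \<kappa> \<psi>"

lemma factor_map_eq: assumes "w \<in> Xset" shows "factor_map (snd w) = R `` {fst w}"
proof -
  have w: "snd w \<in> Yset" "fst w \<in> \<kappa> (snd w)" using assms by (auto simp: Xset_def)
  have "(fst w, y) \<in> R" if "x \<in> \<kappa> (snd w)" "(x, y) \<in> R" for x y
    using \<kappa>_class[OF w that(1)] that(2) by (rule R_trans)
  then show ?thesis using w(2) by (auto simp: factor_map_def)
qed

lemma factor_map_almost_one_to_one: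
  "almost_one_to_one_extension (top_of_set Yset) (code_T 1) (X_infinity X S) (S_infinity S) factor_map"
proof -
  have ext: "extension (top_of_set Yset) (code_T 1) (X_infinity X S) (S_infinity S) factor_map"
    unfolding extension_def
  proof (intro conjI ballI)
    have "continuous_map X (X_infinity X S) (\<lambda>x. R `` {x})"
      unfolding X_infinity_def by (rule quotient_imp_continuous_map[OF quotient_map_quotient_space])
    from continuous_map_compose[OF continuous_fst this]
    have "continuous_map Xtop (X_infinity X S) (factor_map \<circ> snd)"
      by (rule continuous_map_eq) (simp add: topspace_Xtop factor_map_eq)
    then show "continuous_map (top_of_set Yset) (X_infinity X S) factor_map"
      by (rule continuous_compose_quotient_map[OF quotient_map_Xtop_snd])
    have "factor_map ` Yset = (\<lambda>w. factor_map (snd w)) ` Xset"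
      unfolding image_snd[symmetric] by (simp add: image_image)
    also have "\<dots> = (\<lambda>w. R `` {fst w}) ` Xset" by (intro image_cong factor_map_eq) simp_all
    also have "\<dots> = (\<lambda>x. R `` {x}) ` (fst ` Xset)" by (simp add: image_image)
    also have "\<dots> = M // R" unfolding image_fst by (auto simp: quotient_def)
    finally show "factor_map ` topspace (top_of_set Yset) = topspace (X_infinity X S)"
      by (simp add: X_infinity_def)
    fix \<psi> assume "\<psi> \<in> topspace (top_of_set Yset)"
    then have "\<psi> \<in> snd ` Xset" using image_snd by simp
    then obtain w where w: "w \<in> Xset" "\<psi> = snd w" by auto
    have x: "fst w \<in> M" using w(1) image_fst by blast
    have "factor_map (code_T 1 \<psi>) = R `` {T 1 (fst w)}"
      using factor_map_eq[OF T_pair_in[OF w(1), of 1]] by (simp add: T_pair_def w(2))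
    also have "\<dots> = T 1 ` (R `` {fst w})" using sat_T_image[of "{fst w}" 1] x by simp
    finally show "factor_map (code_T 1 \<psi>) = S_infinity S (factor_map \<psi>)"
      by (simp add: w(2) factor_map_eq[OF w(1)] S_infinity_def int_iterate_1)
  qed
  let ?A = "\<lambda>F. snd ` {w \<in> topspace Xtop. fst w \<in> good F}"
  \<comment> \<open>This is the set of \<open>\<psi>\<close> with \<open>\<kappa> \<psi>\<close>
    inside \<open>C\<close>, since each \<open>good F\<close> contains a class as soon as it meets
    it. In the present form it is an intersection of images of open sets under an open map.\<close>
  define Y0 where "Y0 = Yset \<inter> \<Inter>(?A ` sets_family)"
  have Y0_iff: "\<psi> \<in> Y0 \<longleftrightarrow> \<psi> \<in> Yset \<and> \<kappa> \<psi> \<subseteq> C" for \<psi>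
  proof
    assume \<psi>: "\<psi> \<in> Y0"
    have "x \<in> good F" if x: "x \<in> \<kappa> \<psi>" and F: "F \<in> sets_family" for x F
    proof -
      have "\<psi> \<in> ?A F" using \<psi> F by (simp add: Y0_def)
      then obtain w where w: "w \<in> Xset" "fst w \<in> good F" "\<psi> = snd w" by (auto simp: topspace_Xtop)
      then have "(fst w, x) \<in> R" using \<kappa>_class[of \<psi> "fst w" x] x by (simp add: Xset_def)
      then show ?thesis by (rule good_sat[OF w(2)])
    qed
    then show "\<psi> \<in> Yset \<and> \<kappa> \<psi> \<subseteq> C" using \<psi> \<kappa>_M by (auto simp: Y0_def C_def)
  next
    assume \<psi>: "\<psi> \<in> Yset \<and> \<kappa> \<psi> \<subseteq> C"
    then obtain x where x: "x \<in> \<kappa> \<psi>" "x \<in> C" using \<kappa>_nonempty by blast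
    have "\<psi> \<in> ?A F" if F: "F \<in> sets_family" for F
      by (rule image_eqI[of _ _ "(x, \<psi>)"]) (use x \<psi> F in \<open>auto simp: C_def topspace_Xtop Xset_def\<close>)
    then show "\<psi> \<in> Y0" using \<psi> by (simp add: Y0_def)
  qed
  have "gdelta_in (top_of_set Yset) Y0"
  proof -
    have "openin (top_of_set Yset) (?A F)" if "F \<in> sets_family" for F
      using openin_continuous_map_preimage[OF continuous_fst openin_good[OF sets_family_closed[OF that]]]
        open_map_Xtop_snd unfolding open_map_def by blast
    then have "gdelta_in (top_of_set Yset) V" if "V \<in> insert Yset (?A ` sets_family)" for V
      using that gdelta_in_topspace[of "top_of_set Yset"] by (auto intro: open_imp_gdelta_in)
    then have "gdelta_in (top_of_set Yset) (\<Inter>(insert Yset (?A ` sets_family)))"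
      using countable_sets_family by (intro gdelta_in_Inter) simp_all
    then show ?thesis by (simp add: Y0_def)
  qed
  moreover have "top_of_set Yset closure_of Y0 = Yset"
  proof
    show "top_of_set Yset closure_of Y0 \<subseteq> Yset"
      using closure_of_subset_topspace[of "top_of_set Yset" Y0] by simp
    show "Yset \<subseteq> top_of_set Yset closure_of Y0"
    proof
      fix \<psi> assume \<psi>: "\<psi> \<in> Yset"
      show "\<psi> \<in> top_of_set Yset closure_of Y0"
        unfolding in_closure_of
      proof (intro conjI allI impI)
        fix G assume "\<psi> \<in> G \<and> openin (top_of_set Yset) G"
        then obtain H where H: "open H" "G = Yset \<inter> H" "\<psi> \<in> H" by (auto simp: openin_open)
        obtain c where c: "c \<in> C" "code c \<in> H" using Yset_approx[OF \<psi> H(1,3)] .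
        have "\<kappa> (code c) \<subseteq> C" using \<kappa>_code[of c] c(1) C_M C_sat[OF c(1)] by auto
        then show "\<exists>y. y \<in> Y0 \<and> y \<in> G"
          using c code_in_Yset[OF c(1)] H(2) Y0_iff[of "code c"] by (intro exI[of _ "code c"]) simp
      qed (simp add: \<psi>)
    qed
  qed
  moreover have "{\<phi> \<in> topspace (top_of_set Yset). factor_map \<phi> = factor_map \<psi>} = {\<psi>}" if "\<psi> \<in> Y0" for \<psi>
  proof -
    have \<psi>: "\<psi> \<in> Yset" "\<kappa> \<psi> \<subseteq> C" using that Y0_iff by blast+
    obtain c where c: "c \<in> \<kappa> \<psi>" "c \<in> C" using \<kappa>_nonempty[OF \<psi>(1)] \<psi>(2) by blast
    have "c \<in> M" using c(2) C_M by blast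
    then have "\<psi> = code c" using code_unique[OF c(2) \<psi>(1) c(1)] R_refl by blast
    moreover have "\<phi> = code c" if \<phi>: "\<phi> \<in> Yset" "factor_map \<phi> = factor_map \<psi>" for \<phi>
    proof -
      obtain x where x: "x \<in> \<kappa> \<phi>" using \<kappa>_nonempty[OF \<phi>(1)] by blast
      have "R `` {x} = R `` {c}"
        using factor_map_eq[of "(x, \<phi>)"] factor_map_eq[of "(c, \<psi>)"] x c(1) \<phi> \<psi>(1) by (simp add: Xset_def)
      then have "(c, x) \<in> R" using class_self[OF \<kappa>_M[OF x]] by simp
      then show ?thesis by (rule code_unique[OF c(2) \<phi>(1) x])
    qed
    ultimately show ?thesis using \<psi>(1) by auto
  qed
  ultimately show ?thesis
    unfolding almost_one_to_one_extension_def dense_gdelta_def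
    using ext by (intro conjI exI[of _ Y0] ballI) simp_all
qed

text \<open>The functions \<open>h n\<close> separate points, so interleaving their values with the
  code realizes the pairs as sequences of reals.\<close>

definition emb :: "'a \<times> (nat \<Rightarrow> real) \<Rightarrow> nat \<Rightarrow> real" where
  "emb w = (\<lambda>n. if even n then h (n div 2) (fst w) else snd w (n div 2))"

lemma inj_emb: "inj_on emb Xset"
proof (rule inj_onI)
  fix v w assume vw: "v \<in> Xset" "w \<in> Xset" "emb v = emb w"
  have "snd v n = snd w n" for n using fun_cong[OF vw(3), of "2 * n + 1"] by (simp add: emb_def)
  moreover have h: "h n (fst v) = h n (fst w)" for n using fun_cong[OF vw(3), of "2 * n"] by (simp add: emb_def)
  have "fst v = fst w"
  proof (rule ccontr)
    assume "fst v \<noteq> fst w"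
    have M: "fst v \<in> M" "fst w \<in> M" using vw image_fst by blast+
    have "openin X (M - {fst w})" using M(2) Hausdorff by (simp add: closedin_Hausdorff_singleton openin_diff)
    then obtain n r where "h n (fst v) < r" "{y \<in> M. h n y < r} \<subseteq> M - {fst w}"
      using h_base[of "M - {fst w}" "fst v"] \<open>fst v \<noteq> fst w\<close> M(1) by blast
    then show False using M(2) h[of n] by auto
  qed
  ultimately show "v = w" by (simp add: prod_eq_iff fun_eq_iff)
qed

lemma homeomorphic_emb: "homeomorphic_map Xtop (top_of_set (emb ` Xset)) emb"
proof (rule continuous_imp_homeomorphic_map[OF _ compact_Xtop])
  have "continuous_map XE euclideanreal (\<lambda>w. emb w n)" for n
    unfolding emb_def using continuous_h_fst continuous_snd_coord by (cases "even n") simp_all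
  then have "continuous_map XE (product_topology (\<lambda>_. euclideanreal) UNIV) emb"
    unfolding continuous_map_componentwise_UNIV by blast
  then have "continuous_map XE euclidean emb" unfolding euclidean_product_topology .
  then show "continuous_map Xtop (top_of_set (emb ` Xset)) emb"
    unfolding continuous_map_in_subtopology by (simp add: topspace_Xtop Xtop_def continuous_map_from_subtopology)
qed (simp_all add: Hausdorff_space_subtopology topspace_Xtop inj_emb)

lemma ex_extensions:
  "\<exists>(X' :: (nat \<Rightarrow> real) topology) S' (Y' :: (nat \<Rightarrow> real) topology) R' \<theta>' \<pi>' \<theta>.
    metric_tds X' S' \<and> metric_tds Y' R' \<and>
    extension X' S' Y' R' \<pi>' \<and>
    almost_one_to_one_extension X' S' X S \<theta>' \<and>
    almost_one_to_one_extension Y' R' (X_infinity X S) (S_infinity S) \<theta> \<and>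
    (\<forall>x\<in>topspace X'. pi_infinity X S (\<theta>' x) = \<theta> (\<pi>' x)) \<and>
    (\<forall>d\<ge>1. cubic_characteristic_factor d X' S' Y' R' \<pi>')"
proof -
  define X' where "X' = top_of_set (emb ` Xset)"
  define Y' where "Y' = top_of_set Yset"
  obtain dec where dec: "homeomorphic_maps Xtop X' emb dec"
    using homeomorphic_emb unfolding X'_def homeomorphic_map_maps by blast
  have dec_hom: "homeomorphic_map X' Xtop dec"
    using dec homeomorphic_maps_sym homeomorphic_map_maps by blast
  have emb_hom: "homeomorphic_map Xtop X' emb" using dec homeomorphic_map_maps by blast
  have topX': "topspace X' = emb ` Xset" by (simp add: X'_def)
  have dec_emb: "dec (emb w) = w" if "w \<in> Xset" for w
    using dec that by (simp add: homeomorphic_maps_def topspace_Xtop)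
  have dec_in: "dec \<xi> \<in> Xset" "emb (dec \<xi>) = \<xi>" if "\<xi> \<in> topspace X'" for \<xi>
    using that dec_emb by (auto simp: topX')
  have dec_image: "dec ` topspace X' = Xset" using dec_emb by (force simp: topX')
  have dec_cont: "continuous_map X' Xtop dec" by (rule homeomorphic_imp_continuous_map[OF dec_hom])
  define S' where "S' = emb \<circ> T_pair 1 \<circ> dec"
  define \<theta>' where "\<theta>' = fst \<circ> dec"
  define \<pi>' where "\<pi>' = snd \<circ> dec"
  have dec_S': "dec (S' \<xi>) = T_pair 1 (dec \<xi>)" if "\<xi> \<in> topspace X'" for \<xi>
    using dec_in[OF that] by (simp add: S'_def dec_emb T_pair_in)
  have tdsX': "metric_tds X' S'"
    unfolding metric_tds_def
  proof (intro conjI)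
    show "compact_space X'" using homeomorphic_compact_space[OF homeomorphic_map_imp_homeomorphic_space[OF emb_hom]] compact_Xtop by simp
    show "metrizable_space X'" unfolding X'_def
      by (intro metrizable_space_subtopology metrizable_space_euclidean)
    show "homeomorphic_map X' X' S'"
      unfolding S'_def
      by (rule homeomorphic_map_compose[OF dec_hom homeomorphic_map_compose[OF homeomorphic_T_pair emb_hom]])
  qed
  have tdsY': "metric_tds Y' (code_T 1)"
    unfolding metric_tds_def Y'_def
    using compact_Yset homeomorphic_code_T metrizable_space_subtopology[OF metrizable_space_euclidean]
    by (simp add: compact_space_subtopology)
  have ext\<pi>: "extension X' S' Y' (code_T 1) \<pi>'"
    unfolding extension_def
  proof (intro conjI ballI)
    show "continuous_map X' Y' \<pi>'"
      unfolding \<pi>'_def Y'_def by (rule continuous_map_compose[OF dec_cont continuous_snd])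
    show "\<pi>' ` topspace X' = topspace Y'"
      unfolding \<pi>'_def image_comp[symmetric] dec_image image_snd by (simp add: Y'_def)
    show "\<pi>' (S' \<xi>) = code_T 1 (\<pi>' \<xi>)" if "\<xi> \<in> topspace X'" for \<xi>
      using dec_S'[OF that] by (simp add: \<pi>'_def T_pair_def)
  qed
  have ext\<theta>: "extension X' S' X S \<theta>'"
    unfolding extension_def
  proof (intro conjI ballI)
    show "continuous_map X' X \<theta>'"
      unfolding \<theta>'_def by (rule continuous_map_compose[OF dec_cont continuous_fst])
    show "\<theta>' ` topspace X' = M"
      unfolding \<theta>'_def image_comp[symmetric] dec_image by (rule image_fst)
    show "\<theta>' (S' \<xi>) = S (\<theta>' \<xi>)" if "\<xi> \<in> topspace X'" for \<xi>
      using dec_S'[OF that] by (simp add: \<theta>'_def T_pair_def int_iterate_1)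
  qed
  define D where "D = {\<xi> \<in> topspace X'. \<theta>' \<xi> \<in> C}"
  have D_gdelta: "gdelta_in X' D"
    unfolding D_def
    by (rule gdelta_in_preimage[of X' X]) (use ext\<theta> C_dense_gdelta in \<open>auto simp: extension_def dense_gdelta_def\<close>)
  have D_dense: "X' closure_of D = topspace X'"
  proof
    show "X' closure_of D \<subseteq> topspace X'" by (rule closure_of_subset_topspace)
    show "topspace X' \<subseteq> X' closure_of D"
    proof
      fix \<xi> assume \<xi>: "\<xi> \<in> topspace X'"
      show "\<xi> \<in> X' closure_of D"
        unfolding in_closure_of
      proof (intro conjI allI impI \<xi>)
        fix G assume G: "\<xi> \<in> G \<and> openin X' G"
        have "openin Xtop {w \<in> topspace Xtop. emb w \<in> G}"
          by (rule openin_continuous_map_preimage[OF homeomorphic_imp_continuous_map[OF emb_hom]]) (use G in simp)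
        moreover have "dec \<xi> \<in> {w \<in> topspace Xtop. emb w \<in> G}" using dec_in[OF \<xi>] G by (simp add: topspace_Xtop)
        ultimately obtain w where w: "w \<in> {w \<in> topspace Xtop. emb w \<in> G}" "fst w \<in> C"
          using Xset_dense by blast
        then have "w \<in> Xset" "emb w \<in> G" by (simp_all add: topspace_Xtop)
        then show "\<exists>y. y \<in> D \<and> y \<in> G"
          using w(2) dec_emb by (intro exI[of _ "emb w"]) (simp add: D_def \<theta>'_def topX')
      qed
    qed
  qed
  have unique: "\<zeta> = \<xi>" if "\<xi> \<in> topspace X'" "\<theta>' \<xi> \<in> C" "\<zeta> \<in> topspace X'" "\<theta>' \<zeta> = \<theta>' \<xi>" for \<xi> \<zeta>
  proof -
    have "dec \<zeta> = dec \<xi>"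
      by (rule Xset_unique) (use that dec_in in \<open>auto simp: \<theta>'_def\<close>)
    then show ?thesis using dec_in(2)[OF that(1)] dec_in(2)[OF that(3)] by simp
  qed
  have "{\<zeta> \<in> topspace X'. \<theta>' \<zeta> = \<theta>' \<xi>} = {\<xi>}" if "\<xi> \<in> D" for \<xi>
    using that unique[of \<xi>] by (auto simp: D_def)
  then have aoo\<theta>': "almost_one_to_one_extension X' S' X S \<theta>'"
    unfolding almost_one_to_one_extension_def dense_gdelta_def using ext\<theta> D_gdelta D_dense by blast
  have comm: "pi_infinity X S (\<theta>' \<xi>) = factor_map (\<pi>' \<xi>)" if "\<xi> \<in> topspace X'" for \<xi>
    using factor_map_eq[OF dec_in(1)[OF that]] by (simp add: pi_infinity_def \<theta>'_def \<pi>'_def)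
  have cX': "compact_tds X' S'" by (rule compact_tds.intro[OF tdsX'])
  have cX: "compact_tds X S" by (rule compact_tds.intro[OF tds])
  have char: "cubic_characteristic_factor d X' S' Y' (code_T 1) \<pi>'" if d: "d \<ge> 1" for d
  proof (rule compact_tds.cubic_characteristic_factorI[OF cX' ext\<pi>])
    show "inj_on (code_T 1) (topspace Y')"
      using tdsY' by (simp add: metric_tds_def homeomorphic_map_def)
    show "open_map X' Y' \<pi>'"
      unfolding \<pi>'_def Y'_def
      by (rule open_map_compose[OF homeomorphic_imp_open_map[OF dec_hom] open_map_Xtop_snd])
    show "D \<subseteq> topspace X'" by (auto simp: D_def)
    show "X' closure_of D = topspace X'" by (rule D_dense)
    fix \<xi> \<zeta> \<epsilon> assume \<xi>D: "\<xi> \<in> D" and \<zeta>: "\<zeta> \<in> topspace X'" "\<pi>' \<zeta> = \<pi>' \<xi>" and \<epsilon>: "\<epsilon> \<in> cube_index d"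
    have \<xi>: "\<xi> \<in> topspace X'" "\<theta>' \<xi> \<in> C" using \<xi>D by (auto simp: D_def)
    have "R `` {\<theta>' \<zeta>} = R `` {\<theta>' \<xi>}"
      using comm[OF \<zeta>(1)] comm[OF \<xi>(1)] \<zeta>(2) by (simp add: pi_infinity_def)
    moreover have "\<theta>' \<xi> \<in> M" using \<xi>(2) C_M by blast
    ultimately have R: "(\<theta>' \<zeta>, \<theta>' \<xi>) \<in> R" using class_self[of "\<theta>' \<xi>"] by blast
    have \<zeta>C: "\<theta>' \<zeta> \<in> C" by (rule C_sat[OF \<xi>(2) R_sym[OF R]])
    have "corner d {} (\<theta>' \<zeta>) (\<theta>' \<xi>) \<in> cubes d X S" using R d by (simp add: RP_infinity_iff)
    then have "corner d \<epsilon> (\<theta>' \<zeta>) (\<theta>' \<xi>) \<in> cubes d X S" by (rule corner_cubes_vertex[OF _ \<epsilon>])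
    \<comment> \<open>All coordinates of the lift lie over \<open>C\<close>, where
      \<open>\<theta>'\<close> is injective, so the lift can only be the corner of
      \<open>\<zeta>\<close> and \<open>\<xi>\<close>.\<close>
    from cubes_lift[OF cX cX' ext\<theta> this] obtain b where b: "b \<in> cubes d X' S'"
      "\<And>\<eta>. \<eta> \<in> cube_index d \<Longrightarrow> \<theta>' (b \<eta>) = corner d \<epsilon> (\<theta>' \<zeta>) (\<theta>' \<xi>) \<eta>" by blast
    have bP: "b \<in> cube_index d \<rightarrow>\<^sub>E topspace X'" by (rule compact_tds.cubes_in[OF cX' b(1)])
    have "b = corner d \<epsilon> \<zeta> \<xi>"
    proof (rule PiE_ext[OF bP])
      show "corner d \<epsilon> \<zeta> \<xi> \<in> cube_index d \<rightarrow>\<^sub>E topspace X'" using \<zeta>(1) \<xi>(1) by (auto simp: corner_def)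
      fix \<eta> assume \<eta>: "\<eta> \<in> cube_index d"
      have "b \<eta> \<in> topspace X'" using bP \<eta> by (rule PiE_mem)
      then show "b \<eta> = corner d \<epsilon> \<zeta> \<xi> \<eta>"
        using b(2)[OF \<eta>] \<eta> unique[OF \<zeta>(1) \<zeta>C] unique[OF \<xi>] by (simp add: corner_def split: if_splits)
    qed
    then show "corner d \<epsilon> \<zeta> \<xi> \<in> cubes d X' S'" using b(1) by simp
  qed
  show ?thesis
    using tdsX' tdsY' ext\<pi> aoo\<theta>' factor_map_almost_one_to_one[folded Y'_def] comm char
    by (intro exI[of _ X'] exI[of _ S'] exI[of _ Y'] exI[of _ "code_T 1"] exI[of _ \<theta>'] exI[of _ \<pi>']
        exI[of _ factor_map] conjI ballI allI impI)
qed

end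

theorem proposition5p21:
  fixes X :: "'a topology" and S :: "'a \<Rightarrow> 'a"
  assumes "metric_tds X S" and "minimal_tds X S"
  shows "\<exists>(X' :: (nat \<Rightarrow> real) topology) S' (Y' :: (nat \<Rightarrow> real) topology) R' \<theta>' \<pi>' \<theta>.
    metric_tds X' S' \<and> metric_tds Y' R' \<and>
    extension X' S' Y' R' \<pi>' \<and>
    almost_one_to_one_extension X' S' X S \<theta>' \<and>
    almost_one_to_one_extension Y' R' (X_infinity X S) (S_infinity S) \<theta> \<and>
    (\<forall>x\<in>topspace X'. pi_infinity X S (\<theta>' x) = \<theta> (\<pi>' x)) \<and>
    (\<forall>d\<ge>1. cubic_characteristic_factor d X' S' Y' R' \<pi>')"
proof -
  have "compact_space X" "metrizable_space X" using assms(1) by (auto simp: metric_tds_def)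
  then obtain h :: "nat \<Rightarrow> 'a \<Rightarrow> real" where h: "\<And>n. continuous_map X euclideanreal (h n)"
    "\<And>U x. openin X U \<Longrightarrow> x \<in> U \<Longrightarrow> \<exists>n r. h n x < r \<and> {y \<in> topspace X. h n y < r} \<subseteq> U"
    using ex_base_functions by blast
  interpret coded_minimal_tds X S h
    by unfold_locales (use assms h in blast)+
  show ?thesis by (rule ex_extensions)
qed

end
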